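(* For smooth functions $u>0$ on $\mathbb{S}^n$ with $A_u=\bar\nabla^2u+u\bar g$ positive definite, let $$\mathcal{J}_1(u)=\frac1{\omega_n}\int_{\mathbb{S}^n}\log u\,d\theta-\frac1{n+1}\log\left(\frac1{\omega_n}\int_{\mathbb{S}^n}u\det(A_u)\,d\theta\right)+\frac12\left(\frac1{\omega_n}\int_{\mathbb{S}^n}u\det(A_u)\,d\theta-1\right)^2 .$$ The unit ball, i.e. the soliton $u\equiv1$ (a critical point of $\mathcal{J}_1$), is stable for $\mathcal{J}_1$ among variations in directions $\eta\perp\operatorname{span}\{1,x_1,\dots,x_{n+1}\}$: for every $\eta\in C^\infty(\mathbb{S}^n)$ that is $L^2(\mathbb{S}^n)$-orthogonal to the constants and to the coordinate functions $x_1,\dots,x_{n+1}$, $$\left.\frac{d^2}{ds^2}\mathcal{J}_1(1+s\eta)\right|_{s=0}\ge0 .$$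
   Context: $\bar g,\bar\nabla$ are the standard metric and covariant derivative on $\mathbb{S}^n\subset\mathbb{R}^{n+1}$, $d\theta$ the surface measure, $\omega_n$ the area of $\mathbb{S}^n$; $\det(A_u)$ is the determinant of the endomorphism $\bar g^{ik}(\bar\nabla_k\bar\nabla_ju+u\bar g_{kj})$; $x_1,\dots,x_{n+1}$ are the restrictions to $\mathbb{S}^n$ of the coordinate functions of $\mathbb{R}^{n+1}$. A soliton is a positive solution of $u\det(A_u)=1$. *)

theory Defs
  imports "HOL-Analysis.Analysis"
begin

text \<open>
  The sphere \<open>S^n\<close> is \<^term>\<open>sphere (0::real^'n) 1\<close>, with \<open>CARD('n) = n + 1\<close>. Functions on the
  sphere are represented by functions on the whole of \<open>real^'n\<close>; every notion below depends
  only on their values on the sphere.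
\<close>

subsection \<open>Smooth functions\<close>

text \<open>Meant for open \<open>U\<close>; derivatives are then the ordinary Frechet derivatives.\<close>

primrec Ck_on :: "nat \<Rightarrow> 'a::euclidean_space set \<Rightarrow> ('a \<Rightarrow> real) \<Rightarrow> bool" where
  "Ck_on 0 U f \<longleftrightarrow> continuous_on U f"
| "Ck_on (Suc k) U f \<longleftrightarrow>
     f differentiable_on U \<and> (\<forall>b\<in>Basis. Ck_on k U (\<lambda>x. frechet_derivative f (at x) b))"

text \<open>Smoothness on an embedded submanifold: locally the restriction of a smooth function.\<close>

definition smooth_on_sphere :: "(real^'n \<Rightarrow> real) \<Rightarrow> bool" where
  "smooth_on_sphere u \<longleftrightarrow>
     (\<forall>p\<in>sphere 0 1. \<exists>U F. open U \<and> p \<in> U \<and> (\<forall>k. Ck_on k U F) \<and>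
        (\<forall>x\<in>U \<inter> sphere 0 1. F x = u x))"

subsection \<open>Covariant derivatives for the round metric\<close>

definition tangent_space :: "real^'n \<Rightarrow> (real^'n) set" where
  "tangent_space p = {v. v \<bullet> p = 0}"

definition tangent_proj :: "real^'n \<Rightarrow> real^'n \<Rightarrow> real^'n" where
  "tangent_proj p v = v - (v \<bullet> p) *\<^sub>R p"

text \<open>
  The differential at \<open>p\<close> of a (scalar or vector valued) function on the sphere, applied to \<open>v\<close>.
  It is computed from the extension that is constant along rays; for tangent \<open>v\<close> every
  differentiable extension gives the same value, and the radial direction \<open>v = p\<close> gives 0.
\<close>

definition sphere_deriv ::
    "(real^'n \<Rightarrow> 'b::real_normed_vector) \<Rightarrow> real^'n \<Rightarrow> real^'n \<Rightarrow> 'b" where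
  "sphere_deriv f p v = frechet_derivative (\<lambda>x. f (x /\<^sub>R norm x)) (at p) v"

text \<open>
  The Riemannian gradient: the tangent vector at \<open>p\<close> whose inner product with every
  tangent \<open>v\<close> is \<open>sphere_deriv u p v\<close> (tangent, since \<open>sphere_deriv u p p = 0\<close>).
\<close>

definition sphere_grad :: "(real^'n \<Rightarrow> real) \<Rightarrow> real^'n \<Rightarrow> real^'n" where
  "sphere_grad u p = (\<chi> i. sphere_deriv u p (axis i 1))"

text \<open>
  The Levi-Civita connection of the induced metric: the covariant derivative of a tangent vector
  field \<open>Y\<close> is the tangential part of its Euclidean directional derivative.
\<close>

definition cov_deriv :: "(real^'n \<Rightarrow> real^'n) \<Rightarrow> real^'n \<Rightarrow> real^'n \<Rightarrow> real^'n" where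
  "cov_deriv Y p v = tangent_proj p (sphere_deriv Y p v)"

definition sphere_hessian :: "(real^'n \<Rightarrow> real) \<Rightarrow> real^'n \<Rightarrow> real^'n \<Rightarrow> real^'n \<Rightarrow> real" where
  "sphere_hessian u p v w = cov_deriv (sphere_grad u) p v \<bullet> w"

text \<open>The tensor \<open>A_u\<close> as a bilinear form, and with one index raised as an endomorphism of the
  tangent space.\<close>

definition A_form :: "(real^'n \<Rightarrow> real) \<Rightarrow> real^'n \<Rightarrow> real^'n \<Rightarrow> real^'n \<Rightarrow> real" where
  "A_form u p v w = sphere_hessian u p v w + u p * (v \<bullet> w)"

definition A_endo :: "(real^'n \<Rightarrow> real) \<Rightarrow> real^'n \<Rightarrow> real^'n \<Rightarrow> real^'n" where
  "A_endo u p v = cov_deriv (sphere_grad u) p v + u p *\<^sub>R v"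

subsection \<open>Determinant of an endomorphism of a subspace\<close>

definition orthonormal_basis_of :: "'a::euclidean_space set \<Rightarrow> 'a set \<Rightarrow> bool" where
  "orthonormal_basis_of S B \<longleftrightarrow>
     B \<subseteq> S \<and> pairwise orthogonal B \<and> (\<forall>b\<in>B. norm b = 1) \<and> span B = S"

text \<open>
  The Leibniz formula for the matrix \<open>b \<bullet> L c\<close> (\<open>b, c \<in> B\<close>) of \<open>L\<close> in an orthonormal
  basis \<open>B\<close> of \<open>S\<close>. The value does not depend on the basis when \<open>L\<close> is a linear map from \<open>S\<close>
  to \<open>S\<close>. The library's \<^const>\<open>det\<close> is not applicable because its index set is a type.
\<close>

definition det_on :: "'a::euclidean_space set \<Rightarrow> ('a \<Rightarrow> 'a) \<Rightarrow> real" where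
  "det_on S L =
     (let B = (SOME B. orthonormal_basis_of S B)
      in \<Sum>\<pi>\<in>{\<pi>. \<pi> permutes B}. of_int (sign \<pi>) * (\<Prod>b\<in>B. b \<bullet> L (\<pi> b)))"

definition det_A :: "(real^'n \<Rightarrow> real) \<Rightarrow> real^'n \<Rightarrow> real" where
  "det_A u p = det_on (tangent_space p) (A_endo u p)"

subsection \<open>Surface measure\<close>

text \<open>
  The surface measure of a Borel subset \<open>E\<close> of the sphere is \<open>n + 1\<close> times the Lebesgue measure
  of the cone \<open>{t x | x \<in> E, 0 < t < 1}\<close>, so that Lebesgue measure is \<open>r^n dr d\<theta>\<close> in polar
  coordinates.
\<close>

definition sphere_measure :: "(real^'n) measure" where
  "sphere_measure =
     distr (density (restrict_space lborel (ball 0 1 - {0})) (\<lambda>_. of_nat CARD('n)))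
       (restrict_space borel (sphere 0 1)) (\<lambda>x. x /\<^sub>R norm x)"

definition sphere_mean :: "(real^'n \<Rightarrow> real) \<Rightarrow> real" where
  "sphere_mean f =
     (LINT p|sphere_measure. f p) / measure sphere_measure (sphere (0::real^'n) 1)"

definition L2_orthogonal :: "(real^'n \<Rightarrow> real) \<Rightarrow> (real^'n \<Rightarrow> real) \<Rightarrow> bool" where
  "L2_orthogonal f g \<longleftrightarrow> (LINT p|sphere_measure. f p * g p) = 0"

subsection \<open>The functional and solitons\<close>

definition admissible :: "(real^'n \<Rightarrow> real) \<Rightarrow> bool" where
  "admissible u \<longleftrightarrow> smooth_on_sphere u \<and>
     (\<forall>p\<in>sphere 0 1. u p > 0 \<and> (\<forall>v\<in>tangent_space p - {0}. A_form u p v v > 0))"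

definition soliton :: "(real^'n \<Rightarrow> real) \<Rightarrow> bool" where
  "soliton u \<longleftrightarrow> smooth_on_sphere u \<and> (\<forall>p\<in>sphere 0 1. u p > 0 \<and> u p * det_A u p = 1)"

text \<open>The functional is meant for admissible \<open>u\<close> only.\<close>

definition J1 :: "(real^'n \<Rightarrow> real) \<Rightarrow> real" where
  "J1 u = sphere_mean (\<lambda>p. ln (u p))
     - 1 / real CARD('n) * ln (sphere_mean (\<lambda>p. u p * det_A u p))
     + 1 / 2 * (sphere_mean (\<lambda>p. u p * det_A u p) - 1)\<^sup>2"

end

(*
  With r(x) = eta(x/|x|) and U(x) = |x| r(x), the endomorphism A_(1 + s eta) at p is the restriction
  of I + s D^2 U(p) to the tangent space, and D^2 U(p) p = 0; hence det A_(1 + s eta) is the ordinary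
  determinant det (I + s D^2 U(p)), a polynomial in s.  Since the surface measure is rotation
  invariant, the integral of each x_i d_j f - x_j d_i f vanishes, and all integrations by parts follow
  from this: the mean V(s) of u det A_u has V'(0) = (n+1) mean(eta) and
  V''(0) = (n+1) mean(U Laplace(U)), so that for eta of mean zero the second variation of J_1 is
  mean |grad eta|^2 - (n+1) mean eta^2.  For eta orthogonal to the spherical harmonics of degree
  at most 1 it is nonnegative because the next eigenvalue of the Laplacian is 2(n+1).  This gap is
  obtained without elliptic theory: polynomials are dense in C(S^n), they restrict to finite sums of
  spherical harmonics h_k, and for the projection P of an approximation of eta to degrees k >= 2
  one expands 0 <= |grad (eta - phi)|^2 with phi = sum_k (2(n+1) / (k(k+n-1))) h_k.
*)
theory Submission
  imports Defs
begin

subsection \<open>Calculus of partial derivatives\<close>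

text \<open>Polynomials approximate \<open>\<eta>\<close> only uniformly, with no control of
  gradients, so the gap cannot be carried over by a limit of Dirichlet energies. The comparison
  function phi is built to avoid this. Pairing in energy against a solid harmonic of degree k is
  k(k+n-1) times pairing in L2, so the weights 2(n+1)/(k(k+n-1)) cancel the eigenvalues: the cross
  term becomes 2(n+1) times the L2 product of \<open>\<eta>\<close> and P. For k >= 2 the weights
  are at most 1, which bounds the energy of phi by 2(n+1) times the squared L2 norm of P. Only L2
  quantities of the approximation remain, and for these uniform closeness is enough. On the volume
  side, u det A_u is at each point a polynomial in s with coefficients continuous on the sphere, so
  V itself is a polynomial and its derivatives are formal; only the mean of ln u is differentiated
  under the integral. The integrals in V'(0) and V''(0) come from divergences of homogeneous vector
  fields: Euler's relation converts an ambient divergence into a tangential one at the price of a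
  shift of the constant by the degree.\<close>

definition pd :: "'n::finite \<Rightarrow> (real^'n \<Rightarrow> real) \<Rightarrow> real^'n \<Rightarrow> real" where
  "pd i f x = frechet_derivative f (at x) (axis i 1)"

definition smooth_on :: "(real^'n) set \<Rightarrow> (real^'n \<Rightarrow> real) \<Rightarrow> bool" where
  "smooth_on S f \<longleftrightarrow> (\<forall>k. Ck_on k S f)"

lemma Basis_eq_axis: "(Basis :: (real^'n) set) = range (\<lambda>i. axis i 1)"
  by (auto simp: Basis_vec_def)

lemma Ck_on_Suc:
  "Ck_on (Suc k) S f \<longleftrightarrow> f differentiable_on S \<and> (\<forall>i. Ck_on k S (pd i f))"
  by (simp add: Basis_eq_axis pd_def[abs_def])

text \<open>From here on \<open>Ck_on_Suc\<close> unfolds successor orders, which keeps every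
  derivative in the form \<open>pd i f\<close>.\<close>

declare Ck_on.simps(2) [simp del]

lemma sum_axis_mult [simp]: "(\<Sum>j\<in>UNIV. axis i 1 $ j * c j) = (c i :: real)"
  by (simp add: axis_def if_distrib[of "\<lambda>x. x * _"] cong: if_cong)

lemma frechet_derivative_eq_pd:
  fixes f :: "real^'n \<Rightarrow> real"
  assumes "f differentiable at x"
  shows "frechet_derivative f (at x) v = (\<Sum>i\<in>UNIV. v $ i * pd i f x)"
proof -
  have lin: "linear (frechet_derivative f (at x))"
    using assms by (rule linear_frechet_derivative)
  have "frechet_derivative f (at x) v =
      frechet_derivative f (at x) (\<Sum>i\<in>UNIV. v $ i *\<^sub>R axis i 1)"
    using basis_expansion[of v] by (simp add: scalar_mult_eq_scaleR)
  also have "\<dots> = (\<Sum>i\<in>UNIV. v $ i * pd i f x)"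
    by (simp add: linear_sum[OF lin] linear_scale[OF lin] pd_def)
  finally show ?thesis .
qed

lemma has_derivative_pd:
  fixes f :: "real^'n \<Rightarrow> real"
  assumes "f differentiable at x"
  shows "(f has_derivative (\<lambda>v. \<Sum>i\<in>UNIV. v $ i * pd i f x)) (at x)"
  using assms by (simp add: frechet_derivative_works frechet_derivative_eq_pd[OF assms, abs_def])

lemma pd_eqI: "(f has_derivative f') (at x) \<Longrightarrow> pd i f x = f' (axis i 1)"
  by (simp add: pd_def frechet_derivative_at[symmetric])

text \<open>The two functions have the same Frechet derivatives at \<open>x\<close>, so the choice
  operator inside \<open>frechet_derivative\<close> returns the same value even where neither is
  differentiable.\<close>

lemma pd_cong:
  assumes "open S" "x \<in> S" "\<And>y. y \<in> S \<Longrightarrow> f y = g y"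
  shows "pd i f x = pd i g x"
proof -
  have "(f has_derivative D) (at x) \<longleftrightarrow> (g has_derivative D) (at x)" for D
    using assms has_derivative_transform_within_open[of f D x UNIV S g]
      has_derivative_transform_within_open[of g D x UNIV S f] by auto
  then show ?thesis
    by (simp add: pd_def frechet_derivative_def)
qed

lemma differentiable_on_cong_open:
  fixes f :: "real^'n \<Rightarrow> real"
  assumes "\<And>y. y \<in> S \<Longrightarrow> f y = g y" "f differentiable_on S"
  shows "g differentiable_on S"
  unfolding differentiable_on_def
proof
  fix x assume "x \<in> S"
  then obtain D where "(f has_derivative D) (at x within S)"
    using assms(2) by (auto simp: differentiable_on_def differentiable_def)
  from has_derivative_transform[OF \<open>x \<in> S\<close> assms(1)[symmetric] this]
  show "g differentiable at x within S"
    by (auto simp: differentiable_def)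
qed

lemma Ck_on_cong:
  fixes f g :: "real^'n \<Rightarrow> real"
  assumes "open S" "\<And>y. y \<in> S \<Longrightarrow> f y = g y" "Ck_on k S f"
  shows "Ck_on k S g"
  using assms(2,3)
proof (induction k arbitrary: f g)
  case 0
  then show ?case by (simp cong: continuous_on_cong)
next
  case (Suc k)
  have "Ck_on k S (pd i g)" for i
  proof (rule Suc.IH)
    show "pd i f y = pd i g y" if "y \<in> S" for y
      by (rule pd_cong[OF assms(1) that Suc.prems(1)])
    show "Ck_on k S (pd i f)"
      using Suc.prems(2) by (simp add: Ck_on_Suc)
  qed
  moreover have "g differentiable_on S"
    by (rule differentiable_on_cong_open[OF Suc.prems(1)]) (use Suc.prems(2) in \<open>simp_all add: Ck_on_Suc\<close>)
  ultimately show ?case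
    by (simp add: Ck_on_Suc)
qed

lemma Ck_on_subset: "Ck_on k S f \<Longrightarrow> T \<subseteq> S \<Longrightarrow> Ck_on k T f" for f :: "real^'n \<Rightarrow> real"
proof (induction k arbitrary: f)
  case 0
  then show ?case using continuous_on_subset by auto
next
  case (Suc k)
  then show ?case using differentiable_on_subset[OF _ Suc.prems(2), of f] by (simp add: Ck_on_Suc)
qed

text \<open>Differentiability and \<open>pd\<close> at a point only see a neighbourhood of it. This
  turns the local extensions supplied by \<open>smooth_on_sphere\<close> into one statement on the
  punctured space.\<close>

lemma Ck_on_locally:
  fixes f :: "real^'n \<Rightarrow> real"
  assumes "open S" "\<And>p. p \<in> S \<Longrightarrow> \<exists>V. open V \<and> p \<in> V \<and> Ck_on k V f"
  shows "Ck_on k S f"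
  using assms
proof (induction k arbitrary: f)
  case 0
  have "isCont f p" if "p \<in> S" for p
    using 0(2)[OF that] by (auto simp: continuous_on_eq_continuous_at)
  then show ?case
    by (simp add: continuous_at_imp_continuous_on)
next
  case (Suc k)
  have "f differentiable at p" if "p \<in> S" for p
    using Suc.prems(2)[OF that]
    unfolding Ck_on_Suc differentiable_on_def by (metis at_within_open)
  moreover have "Ck_on k S (pd i f)" for i
  proof (rule Suc.IH[OF Suc.prems(1)])
    show "\<exists>V. open V \<and> p \<in> V \<and> Ck_on k V (pd i f)" if "p \<in> S" for p
      using Suc.prems(2)[OF that] unfolding Ck_on_Suc by blast
  qed
  ultimately show ?case
    by (simp add: Ck_on_Suc differentiable_at_imp_differentiable_on)
qed

lemma Ck_on_Suc_imp_Ck_on: "Ck_on (Suc k) S f \<Longrightarrow> Ck_on k S f" for f :: "real^'n \<Rightarrow> real"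
proof (induction k arbitrary: f)
  case 0
  then show ?case by (simp add: Ck_on_Suc differentiable_imp_continuous_on)
next
  case (Suc k)
  then show ?case by (simp add: Ck_on_Suc[of "Suc k"] Ck_on_Suc[of k])
qed

lemma pd_const [simp]: "pd i (\<lambda>_::real^'n. c) x = 0"
  using pd_eqI[OF has_derivative_const] .

lemma Ck_on_const [simp]: "Ck_on k S (\<lambda>_. c)" for S :: "(real^'n) set"
proof (induction k arbitrary: c)
  case (Suc k)
  then show ?case by (simp add: Ck_on_Suc pd_const[abs_def])
qed simp

lemma Ck_on_Suc_differentiable:
  fixes f :: "real^'n \<Rightarrow> real"
  shows "open S \<Longrightarrow> Ck_on (Suc k) S f \<Longrightarrow> x \<in> S \<Longrightarrow> f differentiable at x"
  by (simp add: Ck_on_Suc differentiable_on_eq_differentiable_at)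

lemma pd_add:
  assumes "f differentiable at x" "g differentiable at x"
  shows "pd i (\<lambda>x. f x + g x) x = pd i f x + pd i g x"
  by (subst pd_eqI[OF has_derivative_add[OF assms[THEN has_derivative_pd]]]) simp

lemma pd_mult:
  assumes "f differentiable at x" "g differentiable at x"
  shows "pd i (\<lambda>x. f x * g x) x = f x * pd i g x + pd i f x * g x"
  by (subst pd_eqI[OF has_derivative_mult[OF assms[THEN has_derivative_pd]]]) simp

lemma differentiable_coord [simp]: "(\<lambda>x::real^'n. x $ j) differentiable at x within S"
  by (intro bounded_linear_imp_differentiable bounded_linear_vec_nth)

lemma pd_coord [simp]: "pd i (\<lambda>x::real^'n. x $ j) x = (if i = j then 1 else 0)"
proof -
  have "((\<lambda>x::real^'n. x $ j) has_derivative (\<lambda>x. x $ j)) (at x)"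
    by (intro bounded_linear_imp_has_derivative bounded_linear_vec_nth)
  from pd_eqI[OF this] show ?thesis by (simp add: axis_def)
qed

lemma pd_cmult:
  assumes "f differentiable at x"
  shows "pd i (\<lambda>x. c * f x) x = c * pd i f x"
  using pd_mult[of "\<lambda>_. c" x f i] assms by simp

lemma pd_minus:
  assumes "f differentiable at x"
  shows "pd i (\<lambda>x. - f x) x = - pd i f x"
  using pd_cmult[OF assms, of i "-1"] by simp

lemma pd_diff:
  assumes "f differentiable at x" "g differentiable at x"
  shows "pd i (\<lambda>x. f x - g x) x = pd i f x - pd i g x"
  using pd_add[OF assms(1) differentiable_minus[OF assms(2)]] pd_minus[OF assms(2)] by simp

lemma pd_sum:
  assumes "\<And>j. j \<in> J \<Longrightarrow> f j differentiable at x"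
  shows "pd i (\<lambda>x. \<Sum>j\<in>J. f j x) x = (\<Sum>j\<in>J. pd i (f j) x)"
  using assms
proof (induction J rule: infinite_finite_induct)
  case (insert j J)
  then show ?case by (simp add: pd_add differentiable_sum)
qed auto

lemma Ck_on_add:
  fixes f :: "real^'n \<Rightarrow> real"
  assumes "open S" "Ck_on k S f" "Ck_on k S g"
  shows "Ck_on k S (\<lambda>x. f x + g x)"
  using assms(2,3)
proof (induction k arbitrary: f g)
  case 0
  then show ?case by (auto intro: continuous_intros)
next
  case (Suc k)
  have "Ck_on k S (pd i (\<lambda>x. f x + g x))" for i
  proof (rule Ck_on_cong[OF assms(1)])
    show "Ck_on k S (\<lambda>x. pd i f x + pd i g x)"
      using Suc.prems by (intro Suc.IH) (auto simp: Ck_on_Suc)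
    show "pd i f y + pd i g y = pd i (\<lambda>x. f x + g x) y" if "y \<in> S" for y
      using Ck_on_Suc_differentiable[OF assms(1) _ that] Suc.prems by (simp add: pd_add)
  qed
  then show ?case
    using Suc.prems by (simp add: Ck_on_Suc differentiable_on_add)
qed

lemma Ck_on_mult:
  fixes f :: "real^'n \<Rightarrow> real"
  assumes "open S" "Ck_on k S f" "Ck_on k S g"
  shows "Ck_on k S (\<lambda>x. f x * g x)"
  using assms(2,3)
proof (induction k arbitrary: f g)
  case 0
  then show ?case by (simp add: continuous_on_mult)
next
  case (Suc k)
  have "Ck_on k S (pd i (\<lambda>x. f x * g x))" for i
  proof (rule Ck_on_cong[OF assms(1)])
    show "Ck_on k S (\<lambda>x. f x * pd i g x + pd i f x * g x)"
    proof (rule Ck_on_add[OF assms(1)])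
      show "Ck_on k S (\<lambda>x. f x * pd i g x)"
        by (rule Suc.IH) (use Suc.prems(2) Suc.prems(1)[THEN Ck_on_Suc_imp_Ck_on] in \<open>auto simp: Ck_on_Suc\<close>)
      show "Ck_on k S (\<lambda>x. pd i f x * g x)"
        by (rule Suc.IH) (use Suc.prems(1) Suc.prems(2)[THEN Ck_on_Suc_imp_Ck_on] in \<open>auto simp: Ck_on_Suc\<close>)
    qed
    show "f y * pd i g y + pd i f y * g y = pd i (\<lambda>x. f x * g x) y" if "y \<in> S" for y
      using Ck_on_Suc_differentiable[OF assms(1) _ that] Suc.prems by (simp add: pd_mult)
  qed
  then show ?case
    using Suc.prems by (simp add: Ck_on_Suc differentiable_on_mult)
qed

lemma Ck_on_sum:
  fixes f :: "'i \<Rightarrow> real^'n \<Rightarrow> real"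
  assumes "open S" "\<And>j. j \<in> J \<Longrightarrow> Ck_on k S (f j)"
  shows "Ck_on k S (\<lambda>x. \<Sum>j\<in>J. f j x)"
  using assms(2)
proof (induction J rule: infinite_finite_induct)
  case (insert j J)
  then show ?case by (simp add: Ck_on_add[OF assms(1)])
qed (simp_all add: Ck_on_const)

lemma Ck_on_coord: "Ck_on k S (\<lambda>x::real^'n. x $ i)"
proof (cases k)
  case 0
  then show ?thesis by (auto intro: continuous_intros)
next
  case (Suc k)
  then show ?thesis by (simp add: Ck_on_Suc differentiable_on_def pd_coord[abs_def])
qed

text \<open>By the chain rule each partial derivative of the composite is a sum of products of
  partials of components of \<open>\<nu>\<close> with \<open>pd c F\<close> composed with
  \<open>\<nu>\<close>, so an induction on \<open>k\<close> with \<open>F\<close> arbitrary closes.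
  The map enters through its components because \<open>Ck_on\<close> speaks of real-valued
  functions.\<close>

lemma Ck_on_compose:
  fixes F :: "real^'n \<Rightarrow> real" and \<nu> :: "real^'n \<Rightarrow> real^'n"
  assumes "open U" "open V" "\<nu> ` V \<subseteq> U"
    and "Ck_on k U F" "\<And>c. Ck_on k V (\<lambda>x. \<nu> x $ c)"
  shows "Ck_on k V (\<lambda>x. F (\<nu> x))"
  using assms(4,5)
proof (induction k arbitrary: F)
  case 0
  have "continuous_on V \<nu>"
    using 0 continuous_on_vec_lambda[of V "\<lambda>c x. \<nu> x $ c"] by simp
  then show ?case using 0 continuous_on_compose2[OF _ _ assms(3), of F] by simp
next
  case (Suc k)
  have \<nu>: "(\<nu> has_derivative (\<lambda>v. \<chi> c. \<Sum>i\<in>UNIV. v $ i * pd i (\<lambda>x. \<nu> x $ c) x)) (at x)" if "x \<in> V" for x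
    by (subst has_derivative_componentwise_within)
      (auto simp: Basis_eq_axis inner_axis intro!: has_derivative_pd Ck_on_Suc_differentiable[OF assms(2) Suc.prems(2) that])
  have F: "(F has_derivative (\<lambda>v. \<Sum>i\<in>UNIV. v $ i * pd i F (\<nu> x))) (at (\<nu> x))" if "x \<in> V" for x
    using that assms(3) by (intro has_derivative_pd Ck_on_Suc_differentiable[OF assms(1) Suc.prems(1)]) auto
  note D = diff_chain_at[OF \<nu> F, unfolded o_def]
  have pd: "pd i (\<lambda>x. F (\<nu> x)) x = (\<Sum>c\<in>UNIV. pd i (\<lambda>x. \<nu> x $ c) x * pd c F (\<nu> x))" if "x \<in> V" for i x
    by (subst pd_eqI[OF D[OF that that]]) simp
  have "Ck_on k V (pd i (\<lambda>x. F (\<nu> x)))" for i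
  proof (rule Ck_on_cong[OF assms(2)])
    show "Ck_on k V (\<lambda>x. \<Sum>c\<in>UNIV. pd i (\<lambda>x. \<nu> x $ c) x * pd c F (\<nu> x))"
    proof (rule Ck_on_sum[OF assms(2)], rule Ck_on_mult[OF assms(2)])
      show "Ck_on k V (pd i (\<lambda>x. \<nu> x $ c))" for c
        using Suc.prems(2)[of c] by (simp add: Ck_on_Suc)
      show "Ck_on k V (\<lambda>x. pd c F (\<nu> x))" for c
        by (rule Suc.IH) (use Suc.prems(1) Suc.prems(2)[THEN Ck_on_Suc_imp_Ck_on] in \<open>simp_all add: Ck_on_Suc\<close>)
    qed
    show "(\<Sum>c\<in>UNIV. pd i (\<lambda>x. \<nu> x $ c) x * pd c F (\<nu> x)) = pd i (\<lambda>x. F (\<nu> x)) x" if "x \<in> V" for x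
      using pd[OF that] by simp
  qed
  moreover have "(\<lambda>x. F (\<nu> x)) differentiable (at x)" if "x \<in> V" for x
    using D[OF that that] by (auto simp: differentiable_def)
  then have "(\<lambda>x. F (\<nu> x)) differentiable_on V"
    by (rule differentiable_at_imp_differentiable_on)
  ultimately show ?case by (simp add: Ck_on_Suc)
qed

lemma pd_norm:
  assumes "(x::real^'n) \<noteq> 0"
  shows "pd i norm x = x $ i / norm x"
  by (subst pd_eqI[OF has_derivative_norm[OF assms]])
    (simp add: sgn_div_norm inner_axis' divide_inverse)

lemma has_derivative_inverse_norm_power:
  assumes "(x::real^'n) \<noteq> 0"
  shows "((\<lambda>x. inverse (norm x ^ m)) has_derivative
    (\<lambda>h. h \<bullet> sgn x * - (real m * inverse (norm x ^ (m + 1))))) (at x)"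
proof -
  have "((\<lambda>r. inverse (r ^ m)) has_real_derivative - (real m * inverse (norm x ^ (m + 1)))) (at (norm x))"
  proof (rule DERIV_cong[OF DERIV_inverse'[OF DERIV_pow]])
    show "- (inverse (norm x ^ m) * (real m * norm x ^ (m - Suc 0)) * inverse (norm x ^ m))
        = - (real m * inverse (norm x ^ (m + 1)))"
      by (cases m) (use assms in \<open>simp_all add: divide_simps\<close>)
  qed (use assms in simp)
  from diff_chain_at[OF has_derivative_norm[OF assms] this[THEN has_field_derivative_imp_has_derivative]]
  show ?thesis by (simp add: o_def mult.commute)
qed

lemma pd_inverse_norm_power:
  assumes "(x::real^'n) \<noteq> 0"
  shows "pd i (\<lambda>x. inverse (norm x ^ m)) x = - (real m * x $ i * inverse (norm x ^ (m + 2)))"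
  by (subst pd_eqI[OF has_derivative_inverse_norm_power[OF assms]])
    (use assms in \<open>simp add: sgn_div_norm inner_axis' divide_inverse power2_eq_square\<close>)

text \<open>Differentiation replaces the exponent \<open>m\<close> by \<open>m + 2\<close> and adds
  a coordinate factor, so the induction on \<open>k\<close> has to run over all \<open>m\<close> at
  once.\<close>

lemma Ck_on_inverse_norm_power: "Ck_on k (- {0}) (\<lambda>x::real^'n. inverse (norm x ^ m))"
proof (induction k arbitrary: m)
  case 0
  then show ?case by (auto intro!: continuous_intros)
next
  case (Suc k)
  have op: "open (- {0::real^'n})" by (simp add: open_Compl)
  have "Ck_on k (- {0}) (pd i (\<lambda>x::real^'n. inverse (norm x ^ m)))" for i
  proof (rule Ck_on_cong[OF op])
    show "Ck_on k (- {0}) (\<lambda>x::real^'n. (- real m) * (x $ i * inverse (norm x ^ (m + 2))))"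
      by (intro Ck_on_mult op Ck_on_const Ck_on_coord Suc)
  qed (simp add: pd_inverse_norm_power)
  moreover have "(\<lambda>x. inverse (norm x ^ m)) differentiable (at x)" if "x \<in> - {0::real^'n}" for x
    using has_derivative_inverse_norm_power[of x m] that by (auto simp: differentiable_def)
  then have "(\<lambda>x::real^'n. inverse (norm x ^ m)) differentiable_on (- {0})"
    by (rule differentiable_at_imp_differentiable_on)
  ultimately show ?case by (simp add: Ck_on_Suc)
qed

lemma smooth_on_imp_Ck: "smooth_on S f \<Longrightarrow> Ck_on k S f"
  by (simp add: smooth_on_def)

lemma smooth_on_differentiable: "open S \<Longrightarrow> smooth_on S f \<Longrightarrow> x \<in> S \<Longrightarrow> f differentiable at x"
  using Ck_on_Suc_differentiable smooth_on_def by blast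

lemma smooth_on_pd: "smooth_on S f \<Longrightarrow> smooth_on S (pd i f)"
  unfolding smooth_on_def using Ck_on_Suc by blast

lemma smooth_on_continuous: "smooth_on S f \<Longrightarrow> continuous_on S f"
  using smooth_on_imp_Ck[of S f 0] by simp

lemma smooth_on_subset: "smooth_on S f \<Longrightarrow> T \<subseteq> S \<Longrightarrow> smooth_on T f"
  unfolding smooth_on_def using Ck_on_subset by blast

lemma smooth_on_cong:
  "open S \<Longrightarrow> (\<And>y. y \<in> S \<Longrightarrow> f y = g y) \<Longrightarrow> smooth_on S f \<Longrightarrow> smooth_on S g"
  unfolding smooth_on_def using Ck_on_cong by blast

lemma smooth_on_const [simp]: "smooth_on S (\<lambda>_. c)"
  by (simp add: smooth_on_def)

lemma smooth_on_coord [simp]: "smooth_on S (\<lambda>x. x $ i)"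
  by (simp add: smooth_on_def Ck_on_coord)

lemma smooth_on_add: "open S \<Longrightarrow> smooth_on S f \<Longrightarrow> smooth_on S g \<Longrightarrow> smooth_on S (\<lambda>x. f x + g x)"
  by (simp add: smooth_on_def Ck_on_add)

lemma smooth_on_mult: "open S \<Longrightarrow> smooth_on S f \<Longrightarrow> smooth_on S g \<Longrightarrow> smooth_on S (\<lambda>x. f x * g x)"
  by (simp add: smooth_on_def Ck_on_mult)

lemma smooth_on_cmult: "open S \<Longrightarrow> smooth_on S f \<Longrightarrow> smooth_on S (\<lambda>x. c * f x)"
  by (simp add: smooth_on_mult)

lemma smooth_on_diff: "open S \<Longrightarrow> smooth_on S f \<Longrightarrow> smooth_on S g \<Longrightarrow> smooth_on S (\<lambda>x. f x - g x)"
  using smooth_on_add[OF _ _ smooth_on_cmult[of S g "-1"]] by simp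

lemma smooth_on_sum:
  "open S \<Longrightarrow> (\<And>j. j \<in> J \<Longrightarrow> smooth_on S (f j)) \<Longrightarrow> smooth_on S (\<lambda>x. \<Sum>j\<in>J. f j x)"
  by (simp add: smooth_on_def Ck_on_sum)

lemma open_punctured [simp]: "open (- {0::'a::real_normed_vector})"
  by (simp add: open_Compl)

lemma norm_sq_eq_sum: "(norm x)\<^sup>2 = (\<Sum>i\<in>UNIV. x $ i * x $ i)" for x :: "real^'n"
  by (simp add: power2_norm_eq_inner inner_vec_def)

lemma smooth_on_norm: "smooth_on (- {0}) (norm :: real^'n \<Rightarrow> real)"
proof (rule smooth_on_cong[OF open_punctured])
  \<comment> \<open>|x| is the polynomial |x|^2 times 1/|x|, and both factors are known to be
    smooth.\<close>
  show "smooth_on (- {0}) (\<lambda>x::real^'n. (\<Sum>i\<in>UNIV. x $ i * x $ i) * inverse (norm x ^ 1))"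
    unfolding smooth_on_def
    by (intro allI Ck_on_mult Ck_on_sum Ck_on_coord Ck_on_inverse_norm_power open_punctured)
qed (simp flip: norm_sq_eq_sum add: power2_eq_square)

text \<open>Near \<open>p\<close> the extension is \<open>F\<close> composed with the normalisation,
  where \<open>F\<close> extends \<open>u\<close> smoothly around p/|p|. This is the bridge from
  functions on the sphere to ambient calculus.\<close>

lemma smooth_on_radial_extension:
  fixes u :: "real^'n \<Rightarrow> real"
  assumes "smooth_on_sphere u"
  shows "smooth_on (- {0}) (\<lambda>x. u (x /\<^sub>R norm x))"
  unfolding smooth_on_def
proof (intro allI Ck_on_locally open_punctured)
  fix k and p :: "real^'n" assume "p \<in> - {0}"
  define \<nu> where "\<nu> = (\<lambda>x::real^'n. x /\<^sub>R norm x)"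
  have "\<nu> p \<in> sphere 0 1"
    using \<open>p \<in> - {0}\<close> by (simp add: \<nu>_def)
  then obtain U F where U: "open U" "\<nu> p \<in> U" and F: "\<And>k. Ck_on k U F"
    and eq: "\<And>x. x \<in> U \<inter> sphere 0 1 \<Longrightarrow> F x = u x"
    using assms unfolding smooth_on_sphere_def by metis
  have "continuous_on (- {0}) \<nu>"
    unfolding \<nu>_def by (intro continuous_intros) auto
  then have opV: "open (\<nu> -` U \<inter> - {0})"
    using U(1) by (metis continuous_on_open_vimage open_punctured)
  show "\<exists>V. open V \<and> p \<in> V \<and> Ck_on k V (\<lambda>x. u (x /\<^sub>R norm x))"
  proof (intro exI conjI)
    show "Ck_on k (\<nu> -` U \<inter> - {0}) (\<lambda>x. u (x /\<^sub>R norm x))"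
    proof (rule Ck_on_cong[OF opV])
      show "F (\<nu> y) = u (y /\<^sub>R norm y)" if "y \<in> \<nu> -` U \<inter> - {0}" for y
        using that eq[of "\<nu> y"] by (simp add: \<nu>_def)
      show "Ck_on k (\<nu> -` U \<inter> - {0}) (\<lambda>y. F (\<nu> y))"
      proof (rule Ck_on_compose[OF U(1) opV _ F])
        fix c
        have "Ck_on k (- {0}) (\<lambda>x::real^'n. inverse (norm x ^ 1) * x $ c)"
          by (intro Ck_on_mult Ck_on_inverse_norm_power Ck_on_coord open_punctured)
        then show "Ck_on k (\<nu> -` U \<inter> - {0}) (\<lambda>x. \<nu> x $ c)"
          by (rule Ck_on_subset[THEN back_subst[of "Ck_on k _"]]) (auto simp: \<nu>_def)
      qed auto
    qed
  qed (use opV U \<open>p \<in> - {0}\<close> in auto)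
qed

section \<open>Symmetry of the second partial derivatives\<close>

lemma DERIV_along_axis:
  fixes f :: "real^'n \<Rightarrow> real"
  assumes "f differentiable at (p + t *\<^sub>R axis i 1)"
  shows "((\<lambda>t. f (p + t *\<^sub>R axis i 1)) has_real_derivative pd i f (p + t *\<^sub>R axis i 1)) (at t)"
proof -
  have "((\<lambda>t. p + t *\<^sub>R axis i 1) has_derivative (\<lambda>h. h *\<^sub>R axis i 1)) (at t)"
    by (auto intro!: derivative_eq_intros)
  from diff_chain_at[OF this has_derivative_pd[OF assms]]
  show ?thesis
    by (simp add: o_def has_field_derivative_def mult.assoc mult_commute_abs flip: sum_distrib_left)
qed

text \<open>The mean value theorem is used twice: in direction \<open>i\<close> for the increment of
  \<open>f\<close> along \<open>axis j 1\<close>, then in direction \<open>j\<close> for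
  \<open>pd i f\<close>. The bound \<open>2 * h < r\<close> keeps the whole square inside the
  ball.\<close>

lemma double_difference_eq_pd:
  fixes f :: "real^'n \<Rightarrow> real"
  assumes S: "open S" "smooth_on S f" and r: "ball x r \<subseteq> S" "0 < h" "2 * h < r"
  shows "\<exists>y\<in>ball x r. f (x + h *\<^sub>R axis i 1 + h *\<^sub>R axis j 1) - f (x + h *\<^sub>R axis i 1)
       - f (x + h *\<^sub>R axis j 1) + f x = h\<^sup>2 * pd j (pd i f) y"
proof -
  have in_ball: "x + s *\<^sub>R axis i 1 + t *\<^sub>R axis j 1 \<in> ball x r" if "\<bar>s\<bar> \<le> h" "\<bar>t\<bar> \<le> h" for s t
  proof -
    have "norm (s *\<^sub>R axis i 1 + t *\<^sub>R axis j 1 :: real^'n) \<le> \<bar>s\<bar> + \<bar>t\<bar>"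
      by (rule order_trans[OF norm_triangle_ineq]) simp
    then have "dist (x + (s *\<^sub>R axis i 1 + t *\<^sub>R axis j 1)) x < r"
      using that r by (simp add: dist_norm)
    then show ?thesis
      by (simp add: dist_commute add.assoc)
  qed
  have diff: "f differentiable at y" "pd i f differentiable at y" if "y \<in> ball x r" for y
    using smooth_on_differentiable[OF S(1)] S(2) smooth_on_pd[OF S(2)] that r(1) by blast+
  let ?g = "\<lambda>s. f (x + h *\<^sub>R axis j 1 + s *\<^sub>R axis i 1) - f (x + s *\<^sub>R axis i 1)"
  have "\<exists>z. 0 < z \<and> z < h \<and> ?g h - ?g 0 =
      (h - 0) * (pd i f (x + h *\<^sub>R axis j 1 + z *\<^sub>R axis i 1) - pd i f (x + z *\<^sub>R axis i 1))"
  proof (rule MVT2[OF r(2)])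
    fix s assume "0 \<le> s" "s \<le> h"
    then show "DERIV ?g s :> pd i f (x + h *\<^sub>R axis j 1 + s *\<^sub>R axis i 1) - pd i f (x + s *\<^sub>R axis i 1)"
      using in_ball[of s h] in_ball[of s 0] r(2)
      by (intro DERIV_diff DERIV_along_axis diff) (simp_all add: algebra_simps)
  qed
  then obtain z where z: "0 < z" "z < h" "?g h - ?g 0 =
      h * (pd i f (x + h *\<^sub>R axis j 1 + z *\<^sub>R axis i 1) - pd i f (x + z *\<^sub>R axis i 1))"
    by auto
  let ?k = "\<lambda>t. pd i f (x + z *\<^sub>R axis i 1 + t *\<^sub>R axis j 1)"
  have "\<exists>w. 0 < w \<and> w < h \<and> ?k h - ?k 0 = (h - 0) * pd j (pd i f) (x + z *\<^sub>R axis i 1 + w *\<^sub>R axis j 1)"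
  proof (rule MVT2[OF r(2)])
    fix t assume "0 \<le> t" "t \<le> h"
    then show "DERIV ?k t :> pd j (pd i f) (x + z *\<^sub>R axis i 1 + t *\<^sub>R axis j 1)"
      using in_ball[of z t] z(1,2) by (intro DERIV_along_axis diff) simp
  qed
  then obtain w where w: "0 < w" "w < h"
    "?k h - ?k 0 = h * pd j (pd i f) (x + z *\<^sub>R axis i 1 + w *\<^sub>R axis j 1)"
    by auto
  show ?thesis
  proof
    show "x + z *\<^sub>R axis i 1 + w *\<^sub>R axis j 1 \<in> ball x r"
      using in_ball z w by auto
    have "x + h *\<^sub>R axis j 1 + z *\<^sub>R axis i 1 = x + z *\<^sub>R axis i 1 + h *\<^sub>R axis j 1"
      "x + h *\<^sub>R axis j 1 + h *\<^sub>R axis i 1 = x + h *\<^sub>R axis i 1 + h *\<^sub>R axis j 1"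
      by (simp_all add: add_ac)
    with z(3) w(3) show "f (x + h *\<^sub>R axis i 1 + h *\<^sub>R axis j 1) - f (x + h *\<^sub>R axis i 1)
       - f (x + h *\<^sub>R axis j 1) + f x = h\<^sup>2 * pd j (pd i f) (x + z *\<^sub>R axis i 1 + w *\<^sub>R axis j 1)"
      by (simp add: power2_eq_square)
  qed
qed

text \<open>The double difference is unchanged when \<open>i\<close> and \<open>j\<close> are
  exchanged. Over a square of side \<open>r/3\<close> it therefore equals both mixed derivatives up
  to the same factor, each taken at some point of the ball, and continuity at \<open>x\<close> does
  the rest.\<close>

lemma pd_commute:
  fixes f :: "real^'n \<Rightarrow> real"
  assumes S: "open S" "smooth_on S f" "x \<in> S"
  shows "pd i (pd j f) x = pd j (pd i f) x"
proof -
  have "\<bar>pd i (pd j f) x - pd j (pd i f) x\<bar> \<le> e" if "e > 0" for e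
  proof -
    have cont: "isCont (pd k (pd l f)) x" for k l
      using smooth_on_continuous[OF smooth_on_pd[OF smooth_on_pd[OF S(2)]], of k l] S(1,3)
      by (simp add: continuous_on_eq_continuous_at)
    have nbh: "\<exists>d>0. \<forall>y\<in>ball x d. \<bar>pd k (pd l f) y - pd k (pd l f) x\<bar> < e / 2" for k l
      using cont[of k l] \<open>e > 0\<close> unfolding continuous_at_eps_delta
      by (metis dist_commute dist_real_def half_gt_zero mem_ball)
    obtain d1 where d1: "d1 > 0" "\<And>y. y \<in> ball x d1 \<Longrightarrow> \<bar>pd i (pd j f) y - pd i (pd j f) x\<bar> < e / 2"
      using nbh by blast
    obtain d2 where d2: "d2 > 0" "\<And>y. y \<in> ball x d2 \<Longrightarrow> \<bar>pd j (pd i f) y - pd j (pd i f) x\<bar> < e / 2"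
      using nbh by blast
    obtain d3 where d3: "d3 > 0" "ball x d3 \<subseteq> S"
      using S(1,3) openE by blast
    define r where "r = min d1 (min d2 d3)"
    have r: "r > 0" "ball x r \<subseteq> S"
      using d1 d2 d3 by (auto simp: r_def)
    then have h: "0 < r / 3" "2 * (r / 3) < r"
      by auto
    obtain y where y: "y \<in> ball x r"
      "f (x + (r/3) *\<^sub>R axis i 1 + (r/3) *\<^sub>R axis j 1) - f (x + (r/3) *\<^sub>R axis i 1)
       - f (x + (r/3) *\<^sub>R axis j 1) + f x = (r/3)\<^sup>2 * pd j (pd i f) y"
      using double_difference_eq_pd[OF S(1,2) r(2) h] by metis
    obtain z where z: "z \<in> ball x r"
      "f (x + (r/3) *\<^sub>R axis j 1 + (r/3) *\<^sub>R axis i 1) - f (x + (r/3) *\<^sub>R axis j 1)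
       - f (x + (r/3) *\<^sub>R axis i 1) + f x = (r/3)\<^sup>2 * pd i (pd j f) z"
      using double_difference_eq_pd[OF S(1,2) r(2) h] by metis
    have "(r/3)\<^sup>2 * pd j (pd i f) y = (r/3)\<^sup>2 * pd i (pd j f) z"
      unfolding y(2)[symmetric] z(2)[symmetric] by (simp add: add_ac)
    then have "pd j (pd i f) y = pd i (pd j f) z"
      using h(1) by simp
    moreover have "y \<in> ball x d2" "z \<in> ball x d1"
      using y(1) z(1) by (auto simp: r_def)
    ultimately show ?thesis
      using d1(2)[of z] d2(2)[of y] by linarith
  qed
  then have "\<bar>pd i (pd j f) x - pd j (pd i f) x\<bar> \<le> 0"
    by (rule field_le_epsilon[of _ 0, simplified])
  then show ?thesis by simp
qed

text \<open>Euler's relation, the infinitesimal form of homogeneity of degree \<open>m\<close>.\<close>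

definition euler :: "real \<Rightarrow> (real^'n \<Rightarrow> real) \<Rightarrow> bool" where
  "euler m f \<longleftrightarrow> (\<forall>x. x \<noteq> 0 \<longrightarrow> (\<Sum>i\<in>UNIV. x $ i * pd i f x) = m * f x)"

lemma euler_mult:
  fixes f g :: "real^'n \<Rightarrow> real"
  assumes "euler m f" "euler l g" "smooth_on (- {0}) f" "smooth_on (- {0}) g"
  shows "euler (m + l) (\<lambda>x. f x * g x)"
  unfolding euler_def
proof (intro allI impI)
  fix x :: "real^'n" assume x: "x \<noteq> 0"
  then have D: "f differentiable at x" "g differentiable at x"
    using smooth_on_differentiable[OF open_punctured] assms(3,4) by auto
  have "(\<Sum>i\<in>UNIV. x $ i * pd i (\<lambda>x. f x * g x) x) =
      f x * (\<Sum>i\<in>UNIV. x $ i * pd i g x) + (\<Sum>i\<in>UNIV. x $ i * pd i f x) * g x"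
    by (simp add: pd_mult[OF D] sum.distrib sum_distrib_left sum_distrib_right algebra_simps)
  then show "(\<Sum>i\<in>UNIV. x $ i * pd i (\<lambda>x. f x * g x) x) = (m + l) * (f x * g x)"
    using assms(1,2) x by (simp add: euler_def algebra_simps)
qed

text \<open>Both sides of the homogeneity relation are differentiated in \<open>t\<close> at 1, an
  interior point of the range where the relation holds.\<close>

lemma homogeneous_imp_euler:
  fixes f :: "real^'n \<Rightarrow> real"
  assumes "smooth_on (- {0}) f" "\<And>t x. t > 0 \<Longrightarrow> x \<noteq> 0 \<Longrightarrow> f (t *\<^sub>R x) = t ^ m * f x"
  shows "euler (real m) f"
  unfolding euler_def
proof (intro allI impI)
  fix x :: "real^'n" assume x: "x \<noteq> 0"
  have lin: "((\<lambda>t. t *\<^sub>R x) has_derivative (\<lambda>h. h *\<^sub>R x)) (at 1)"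
    by (auto intro!: derivative_eq_intros)
  have "(f has_derivative (\<lambda>v. \<Sum>i\<in>UNIV. v $ i * pd i f x)) (at (1 *\<^sub>R x))"
    using smooth_on_differentiable[OF open_punctured assms(1)] x by (simp add: has_derivative_pd)
  from diff_chain_at[OF lin this] have D1: "((\<lambda>t. f (t *\<^sub>R x)) has_real_derivative (\<Sum>i\<in>UNIV. x $ i * pd i f x)) (at 1)"
    by (simp add: o_def has_field_derivative_def mult.assoc mult_commute_abs flip: sum_distrib_left)
  have "((\<lambda>t. t ^ m * f x) has_real_derivative real m * f x) (at 1)"
    by (auto intro!: derivative_eq_intros)
  then have "((\<lambda>t. f (t *\<^sub>R x)) has_real_derivative real m * f x) (at 1)"
    by (rule has_field_derivative_transform_within_open[of _ _ _ "{0<..}"])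
      (use assms(2) x in \<open>auto\<close>)
  then show "(\<Sum>i\<in>UNIV. x $ i * pd i f x) = real m * f x"
    using D1 DERIV_unique by blast
qed

text \<open>Apply \<open>pd j\<close> to Euler's relation and exchange the order of the derivatives.
  The degree is a real number since it drops below zero: second derivatives of a 1-homogeneous
  function have degree -1.\<close>

lemma euler_pd:
  fixes f :: "real^'n \<Rightarrow> real"
  assumes "smooth_on (- {0}) f" "euler m f"
  shows "euler (m - 1) (pd j f)"
  unfolding euler_def
proof (intro allI impI)
  fix x :: "real^'n" assume x: "x \<noteq> 0"
  have D: "f differentiable at x" "pd i f differentiable at x" for i
    using smooth_on_differentiable[OF open_punctured] assms(1) smooth_on_pd[OF assms(1)] x by auto
  have "pd j (\<lambda>x. \<Sum>i\<in>UNIV. x $ i * pd i f x) x = pd j (\<lambda>x. m * f x) x"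
    by (rule pd_cong[OF open_punctured]) (use assms(2) x in \<open>auto simp: euler_def\<close>)
  moreover have "pd j (\<lambda>x. \<Sum>i\<in>UNIV. x $ i * pd i f x) x =
      (\<Sum>i\<in>UNIV. x $ i * pd j (pd i f) x) + pd j f x"
    using D by (simp add: pd_sum pd_mult differentiable_mult sum.distrib if_distrib[of "\<lambda>x. x * _"] cong: if_cong)
  moreover have "pd j (pd i f) x = pd i (pd j f) x" for i
    using pd_commute[OF open_punctured assms(1)] x by auto
  ultimately show "(\<Sum>i\<in>UNIV. x $ i * pd i (pd j f) x) = (m - 1) * pd j f x"
    using D by (simp add: pd_cmult algebra_simps)
qed

subsection \<open>The geometry of the sphere in ambient coordinates\<close>

definition radial_ext :: "(real^'n \<Rightarrow> real) \<Rightarrow> real^'n \<Rightarrow> real" where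
  "radial_ext u x = u (x /\<^sub>R norm x)"

text \<open>The 1-homogeneous extension. If \<open>u\<close> is the support function of a convex
  body restricted to the sphere, this is the support function itself. Its ambient Hessian encodes
  A_u (\<open>A_endo_eq_hessian_matrix\<close>), which trades covariant for ordinary
  derivatives.\<close>

definition cone_ext :: "(real^'n \<Rightarrow> real) \<Rightarrow> real^'n \<Rightarrow> real" where
  "cone_ext u x = norm x * radial_ext u x"

definition hessian_matrix :: "(real^'n \<Rightarrow> real) \<Rightarrow> real^'n \<Rightarrow> real^'n^'n" where
  "hessian_matrix f x = (\<chi> i j. pd i (pd j f) x)"

lemma smooth_radial_ext: "smooth_on_sphere u \<Longrightarrow> smooth_on (- {0}) (radial_ext u)"
  using smooth_on_radial_extension[of u] by (simp add: radial_ext_def[abs_def])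

lemma smooth_cone_ext: "smooth_on_sphere u \<Longrightarrow> smooth_on (- {0}) (cone_ext u)"
  unfolding cone_ext_def[abs_def]
  by (intro smooth_on_mult smooth_on_norm smooth_radial_ext open_punctured)

lemma radial_ext_sphere: "norm p = 1 \<Longrightarrow> radial_ext u p = u p"
  by (simp add: radial_ext_def)

lemma cone_ext_sphere: "norm p = 1 \<Longrightarrow> cone_ext u p = u p"
  by (simp add: cone_ext_def radial_ext_def)

lemma radial_ext_scale: "t > 0 \<Longrightarrow> radial_ext u (t *\<^sub>R x) = radial_ext u x"
  by (simp add: radial_ext_def mult.commute[of "inverse t"] mult.assoc)

lemma euler_radial_ext: "smooth_on_sphere u \<Longrightarrow> euler 0 (radial_ext u)"
  using homogeneous_imp_euler[OF smooth_radial_ext, of u 0] by (simp add: radial_ext_scale)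

lemma euler_cone_ext: "smooth_on_sphere u \<Longrightarrow> euler 1 (cone_ext u)"
  using homogeneous_imp_euler[OF smooth_cone_ext, of u 1]
  by (simp add: cone_ext_def radial_ext_scale)

lemma pd_scale:
  fixes f :: "real^'n \<Rightarrow> real"
  assumes "f differentiable at (c *\<^sub>R x)"
  shows "pd i (\<lambda>x. f (c *\<^sub>R x)) x = c * pd i f (c *\<^sub>R x)"
proof -
  have "((\<lambda>x::real^'n. c *\<^sub>R x) has_derivative (\<lambda>x. c *\<^sub>R x)) (at x)"
    by (auto intro!: derivative_eq_intros)
  from pd_eqI[OF diff_chain_at[OF this has_derivative_pd[OF assms], unfolded o_def]]
  show ?thesis by (simp add: mult.assoc flip: sum_distrib_left)
qed

text \<open>The gradient of a 0-homogeneous function has degree -1. The lemma gives an ambient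
  formula for \<open>sphere_grad u\<close> at x/|x|, the field that \<open>sphere_deriv\<close>
  differentiates in the Hessian.\<close>

lemma pd_radial_ext_normalize:
  assumes "smooth_on_sphere u" "x \<noteq> 0"
  shows "pd i (radial_ext u) (x /\<^sub>R norm x) = norm x * pd i (radial_ext u) x"
proof -
  let ?c = "inverse (norm x)"
  have "?c > 0" using assms(2) by simp
  have "radial_ext u differentiable at (?c *\<^sub>R x)"
    using smooth_on_differentiable[OF open_punctured smooth_radial_ext[OF assms(1)]] assms(2) by simp
  from pd_scale[OF this, of i] radial_ext_scale[OF \<open>?c > 0\<close>, of u]
  have "pd i (radial_ext u) x = ?c * pd i (radial_ext u) (?c *\<^sub>R x)"
    by simp
  then show ?thesis using assms(2) by (simp add: field_simps)
qed

lemma sphere_grad_eq: "sphere_grad u p $ i = pd i (radial_ext u) p"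
  by (simp add: sphere_grad_def sphere_deriv_def pd_def radial_ext_def[abs_def])

text \<open>The field being differentiated is |x| times the ambient gradient of
  \<open>radial_ext u\<close>. The first summand comes from the factor |x| and vanishes on tangent
  vectors.\<close>

lemma sphere_deriv_sphere_grad:
  fixes u :: "real^'n \<Rightarrow> real"
  assumes u: "smooth_on_sphere u" and p: "norm p = 1"
  shows "sphere_deriv (sphere_grad u) p v $ i =
    (v \<bullet> p) * pd i (radial_ext u) p + (\<Sum>j\<in>UNIV. v $ j * pd j (pd i (radial_ext u)) p)"
proof -
  let ?r = "radial_ext u"
  have p0: "p \<noteq> 0" using p by auto
  have D: "norm differentiable at p" "pd i ?r differentiable at p" for i
    using smooth_on_differentiable[OF open_punctured] smooth_on_norm
      smooth_on_pd[OF smooth_radial_ext[OF u]] p0 by auto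
  have comp: "((\<lambda>x. sphere_grad u (x /\<^sub>R norm x) $ i) has_derivative
      (\<lambda>v. \<Sum>j\<in>UNIV. v $ j * pd j (\<lambda>x. norm x * pd i ?r x) p)) (at p)" for i
  proof (rule has_derivative_transform_within_open[OF has_derivative_pd open_punctured])
    show "(\<lambda>x. norm x * pd i ?r x) differentiable at p"
      using D by (intro differentiable_mult)
  qed (use p0 in \<open>auto simp: sphere_grad_eq pd_radial_ext_normalize[OF u]\<close>)
  have "((\<lambda>x. sphere_grad u (x /\<^sub>R norm x)) has_derivative
      (\<lambda>v. \<chi> i. \<Sum>j\<in>UNIV. v $ j * pd j (\<lambda>x. norm x * pd i ?r x) p)) (at p)"
    by (subst has_derivative_componentwise_within) (auto simp: Basis_eq_axis inner_axis intro: comp)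
  then have "sphere_deriv (sphere_grad u) p v $ i = (\<Sum>j\<in>UNIV. v $ j * pd j (\<lambda>x. norm x * pd i ?r x) p)"
    unfolding sphere_deriv_def by (subst frechet_derivative_at[symmetric]) auto
  also have "\<dots> = (\<Sum>j\<in>UNIV. (v $ j * p $ j) * pd i ?r p + v $ j * pd j (pd i ?r) p)"
    by (intro sum.cong refl) (simp add: pd_mult[OF D] pd_norm[OF p0] p algebra_simps)
  also have "\<dots> = (v \<bullet> p) * pd i ?r p + (\<Sum>j\<in>UNIV. v $ j * pd j (pd i ?r) p)"
    by (simp add: sum.distrib inner_vec_def sum_distrib_right)
  finally show ?thesis .
qed

text \<open>This matrix is the projection onto the tangent space, as it should be: |x| is
  \<open>cone_ext\<close> of the constant 1, for which A_u is the identity.\<close>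

lemma pd_pd_norm:
  fixes p :: "real^'n"
  assumes "norm p = 1"
  shows "pd i (pd j norm) p = (if i = j then 1 else 0) - p $ i * p $ j"
proof -
  have p0: "p \<noteq> 0" using assms by auto
  have D: "(\<lambda>x::real^'n. inverse (norm x ^ 1)) differentiable at p"
    using has_derivative_inverse_norm_power[OF p0, of 1] by (auto simp: differentiable_def)
  have "pd i (pd j norm) p = pd i (\<lambda>x. x $ j * inverse (norm x ^ 1)) p"
    by (rule pd_cong[OF open_punctured]) (use p0 in \<open>auto simp: pd_norm divide_inverse\<close>)
  also have "\<dots> = (if i = j then 1 else 0) - p $ i * p $ j"
    by (subst pd_mult[OF differentiable_coord D], subst pd_inverse_norm_power[OF p0])
      (simp add: assms)
  finally show ?thesis .
qed

lemma hessian_matrix_cone_ext: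
  fixes u :: "real^'n \<Rightarrow> real"
  assumes u: "smooth_on_sphere u" and p: "norm p = 1"
  shows "hessian_matrix (cone_ext u) p $ i $ j =
     ((if i = j then 1 else 0) - p $ i * p $ j) * u p + p $ j * pd i (radial_ext u) p
     + p $ i * pd j (radial_ext u) p + pd i (pd j (radial_ext u)) p"
proof -
  let ?r = "radial_ext u"
  have p0: "p \<noteq> 0" using p by auto
  have D: "norm differentiable at x" "pd i norm differentiable at x"
    "?r differentiable at x" "pd i ?r differentiable at x" if "x \<noteq> 0" for i and x :: "real^'n"
    using smooth_on_differentiable[OF open_punctured] smooth_on_norm smooth_radial_ext[OF u]
      smooth_on_pd[OF smooth_radial_ext[OF u]] smooth_on_pd[OF smooth_on_norm] that by auto
  have "pd i (pd j (cone_ext u)) p = pd i (\<lambda>x. norm x * pd j ?r x + pd j norm x * ?r x) p"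
    by (rule pd_cong[OF open_punctured]) (use p0 in \<open>auto simp: cone_ext_def[abs_def] pd_mult D\<close>)
  also have "\<dots> = norm p * pd i (pd j ?r) p + pd i norm p * pd j ?r p
      + (pd j norm p * pd i ?r p + pd i (pd j norm) p * ?r p)"
    by (simp add: pd_add pd_mult D p0 differentiable_mult)
  finally show ?thesis
    by (simp add: hessian_matrix_def pd_pd_norm p pd_norm[OF p0] radial_ext_sphere)
qed

lemma hessian_matrix_symmetric:
  assumes "smooth_on (- {0}) f" "x \<noteq> 0"
  shows "hessian_matrix f x $ i $ j = hessian_matrix f x $ j $ i"
  using pd_commute[OF open_punctured assms(1)] assms(2) by (simp add: hessian_matrix_def)

text \<open>The first partials of a 1-homogeneous function have degree 0, and Euler's relation for
  them puts the radial direction into the kernel of the symmetric Hessian.\<close>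

lemma hessian_matrix_cone_ext_radial:
  assumes "smooth_on_sphere u" "p \<noteq> 0"
  shows "hessian_matrix (cone_ext u) p *v p = 0"
proof -
  have "euler 0 (pd j (cone_ext u))" for j
    using euler_pd[OF smooth_cone_ext euler_cone_ext, OF assms(1) assms(1)] by simp
  then have "(\<Sum>i\<in>UNIV. p $ i * hessian_matrix (cone_ext u) p $ i $ j) = 0" for j
    using assms(2) by (simp add: euler_def hessian_matrix_def)
  then have "(\<Sum>i\<in>UNIV. hessian_matrix (cone_ext u) p $ j $ i * p $ i) = 0" for j
    by (subst hessian_matrix_symmetric[OF smooth_cone_ext[OF assms(1)] assms(2)]) (simp add: mult.commute)
  then show ?thesis by (simp add: vec_eq_iff matrix_vector_mult_def)
qed

text \<open>The projection in \<open>cov_deriv\<close> removes the component along \<open>p\<close>,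
  and Euler's relation for the first partials of \<open>radial_ext u\<close> identifies it as minus
  the derivative of \<open>radial_ext u\<close> along \<open>v\<close>. This correction is one of
  the two cross terms that the factor |x| creates in the Hessian of \<open>cone_ext u\<close>; the
  other vanishes since \<open>v\<close> is orthogonal to \<open>p\<close>.\<close>

lemma A_endo_eq_hessian_matrix:
  fixes u :: "real^'n \<Rightarrow> real"
  assumes u: "smooth_on_sphere u" and p: "norm p = 1" and v: "v \<in> tangent_space p"
  shows "A_endo u p v = hessian_matrix (cone_ext u) p *v v"
proof -
  let ?r = "radial_ext u" and ?D = "sphere_deriv (sphere_grad u) p v"
  have p0: "p \<noteq> 0" using p by auto
  have vp: "v \<bullet> p = 0" "(\<Sum>j\<in>UNIV. p $ j * v $ j) = 0"
    using v by (simp_all add: tangent_space_def inner_vec_def mult.commute)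
  have D: "?D $ i = (\<Sum>j\<in>UNIV. v $ j * pd j (pd i ?r) p)" for i
    using sphere_deriv_sphere_grad[OF u p] vp by simp
  have eul: "(\<Sum>i\<in>UNIV. p $ i * pd i (pd j ?r) p) = - pd j ?r p" for j
    using euler_pd[OF smooth_radial_ext euler_radial_ext, OF u u] p0 by (simp add: euler_def)
  have comm: "pd i (pd j ?r) p = pd j (pd i ?r) p" for i j
    using pd_commute[OF open_punctured smooth_radial_ext[OF u], of p] p0 by simp
  have "?D \<bullet> p = (\<Sum>i\<in>UNIV. \<Sum>j\<in>UNIV. v $ j * (p $ i * pd i (pd j ?r) p))"
    unfolding inner_vec_def D sum_distrib_right inner_real_def
  proof (intro sum.cong refl)
    show "v $ j * pd j (pd i ?r) p * p $ i = v $ j * (p $ i * pd i (pd j ?r) p)" for i j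
      unfolding comm[of i j] by (simp only: mult_ac)
  qed
  also have "\<dots> = (\<Sum>j\<in>UNIV. v $ j * (\<Sum>i\<in>UNIV. p $ i * pd i (pd j ?r) p))"
    unfolding sum_distrib_left by (rule sum.swap)
  also have "\<dots> = - (\<Sum>j\<in>UNIV. v $ j * pd j ?r p)"
    unfolding eul mult_minus_right sum_negf ..
  finally have Dp: "?D \<bullet> p = - (\<Sum>j\<in>UNIV. v $ j * pd j ?r p)" .
  have "A_endo u p v $ i = (hessian_matrix (cone_ext u) p *v v) $ i" for i
  proof -
    have "hessian_matrix (cone_ext u) p $ i $ j * v $ j =
        (if i = j then u p * v $ j else 0) - (p $ j * v $ j) * (p $ i * u p)
         + (p $ j * v $ j) * pd i ?r p + p $ i * (v $ j * pd j ?r p) + v $ j * pd j (pd i ?r) p" for j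
      unfolding hessian_matrix_cone_ext[OF u p] comm[of i j] by (simp add: algebra_simps)
    then have "(hessian_matrix (cone_ext u) p *v v) $ i =
      (\<Sum>j\<in>UNIV. (if i = j then u p * v $ j else 0) - (p $ j * v $ j) * (p $ i * u p)
         + (p $ j * v $ j) * pd i ?r p + p $ i * (v $ j * pd j ?r p) + v $ j * pd j (pd i ?r) p)"
      by (simp add: matrix_vector_mult_def)
    also have "\<dots> = u p * v $ i + p $ i * (\<Sum>j\<in>UNIV. v $ j * pd j ?r p) + (\<Sum>j\<in>UNIV. v $ j * pd j (pd i ?r) p)"
      by (simp add: sum.distrib sum_subtractf vp flip: sum_distrib_left sum_distrib_right)
    also have "\<dots> = A_endo u p v $ i"
      by (simp add: A_endo_def cov_deriv_def tangent_proj_def D Dp)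
    finally show ?thesis ..
  qed
  then show ?thesis by (simp add: vec_eq_iff)
qed

subsection \<open>The determinant on the tangent space\<close>

text \<open>Conjugation by \<open>f\<close> is a sign-preserving bijection between the permutations
  of \<open>K\<close> and those of \<open>B\<close>. It mediates between \<open>det_on\<close>,
  indexed by a set of vectors, and \<open>det\<close>, indexed by a type.\<close>

lemma sum_permutes_reindex:
  fixes g :: "'b \<Rightarrow> 'b \<Rightarrow> real"
  assumes f: "bij_betw f K B" and "finite K"
  shows "(\<Sum>\<pi>\<in>{\<pi>. \<pi> permutes B}. of_int (sign \<pi>) * (\<Prod>b\<in>B. g b (\<pi> b))) =
    (\<Sum>\<pi>\<in>{\<pi>. \<pi> permutes K}. of_int (sign \<pi>) * (\<Prod>k\<in>K. g (f k) (f (\<pi> k))))"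
proof -
  have inj: "inj_on f K" using f by (simp add: bij_betw_def)
  note f' = bij_betw_inv_into[OF f]
  show ?thesis
  proof (rule sum.reindex_bij_witness[of _ "map_permutation K f" "map_permutation B (inv_into K f)"])
    fix \<pi> assume "\<pi> \<in> {\<pi>. \<pi> permutes B}"
    then have \<pi>: "\<pi> permutes B" by simp
    show "map_permutation K f (map_permutation B (inv_into K f) \<pi>) = \<pi>"
      by (rule map_permutation_compose_inv[OF f' \<pi>]) (simp add: bij_betw_inv_into_right[OF f])
    let ?\<sigma> = "map_permutation B (inv_into K f) \<pi>"
    have \<sigma>: "?\<sigma> permutes K"
      by (rule map_permutation_permutes[OF f' \<pi>])
    then show "?\<sigma> \<in> {\<pi>. \<pi> permutes K}" by simp
    have "sign ?\<sigma> = sign \<pi>"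
      using \<pi> f' \<open>finite K\<close> bij_betw_finite[OF f] by (intro sign_map_permutation) (auto simp: bij_betw_def)
    moreover have "f (?\<sigma> k) = \<pi> (f k)" if "k \<in> K" for k
    proof -
      have "?\<sigma> (inv_into K f (f k)) = inv_into K f (\<pi> (f k))"
        using f f' that by (intro map_permutation_apply) (auto simp: bij_betw_def)
      then show ?thesis
        using that f permutes_in_image[OF \<pi>, of "f k"]
        by (simp add: bij_betw_inv_into_left[OF f] bij_betw_inv_into_right[OF f] bij_betw_apply)
    qed
    then have "(\<Prod>k\<in>K. g (f k) (f (?\<sigma> k))) = (\<Prod>b\<in>B. g b (\<pi> b))"
      using prod.reindex_bij_betw[OF f, of "\<lambda>b. g b (\<pi> b)"] by simp
    ultimately show "real_of_int (sign ?\<sigma>) * (\<Prod>k\<in>K. g (f k) (f (?\<sigma> k))) =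
        real_of_int (sign \<pi>) * (\<Prod>b\<in>B. g b (\<pi> b))"
      by simp
  next
    fix \<pi> assume "\<pi> \<in> {\<pi>. \<pi> permutes K}"
    then have \<pi>: "\<pi> permutes K" by simp
    show "map_permutation B (inv_into K f) (map_permutation K f \<pi>) = \<pi>"
      by (rule map_permutation_compose_inv[OF f \<pi>]) (simp add: bij_betw_inv_into_left[OF f])
    show "map_permutation K f \<pi> \<in> {\<pi>. \<pi> permutes B}"
      using map_permutation_permutes[OF f \<pi>] by simp
  qed
qed

lemma ex_orthonormal_basis_of: "subspace S \<Longrightarrow> \<exists>B. orthonormal_basis_of S B"
  by (rule orthonormal_basis_subspace[of S]) (auto simp: orthonormal_basis_of_def)

text \<open>In an orthonormal basis made of \<open>p\<close> and a basis of the tangent space,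
  \<open>A\<close> is block diagonal with entry 1 at \<open>p\<close>: the column because
  \<open>A\<close> fixes \<open>p\<close>, the row by symmetry. The Leibniz sum for the whole space
  thus reduces to the permutations that fix the index of \<open>p\<close>.\<close>

lemma det_on_tangent_space:
  fixes A :: "real^'n^'n"
  assumes p: "norm p = 1" and L: "\<And>v. v \<in> tangent_space p \<Longrightarrow> L v = A *v v"
    and Ap: "A *v p = p" and sym: "transpose A = A"
  shows "det_on (tangent_space p) L = det A"
proof -
  let ?T = "tangent_space p"
  have sub: "subspace ?T"
    by (auto simp: subspace_def tangent_space_def inner_left_distrib)
  define B where "B = (SOME B. orthonormal_basis_of ?T B)"
  have "orthonormal_basis_of ?T B"
    unfolding B_def by (rule someI_ex) (rule ex_orthonormal_basis_of[OF sub])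
  then have B: "B \<subseteq> ?T" "pairwise orthogonal B" "\<And>b. b \<in> B \<Longrightarrow> norm b = 1" "span B = ?T"
    by (auto simp: orthonormal_basis_of_def)
  have pB: "p \<notin> B"
    using B(1) p by (auto simp: tangent_space_def norm_eq_1)
  have orth: "pairwise orthogonal (insert p B)"
    using B(1,2) by (auto simp: pairwise_insert orthogonal_def tangent_space_def inner_commute)
  have "0 \<notin> insert p B"
    using p B(3)[of 0] by auto
  then have ind: "independent (insert p B)"
    using pairwise_orthogonal_independent[OF orth] by simp
  have span: "span (insert p B) = UNIV"
  proof -
    have "x \<in> span (insert p B)" for x
    proof -
      have "x - (x \<bullet> p) *\<^sub>R p \<in> span B"
        using p by (simp add: B(4) tangent_space_def inner_diff_left norm_eq_1)
      then show ?thesis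
        using span_breakdown_eq by blast
    qed
    then show ?thesis by auto
  qed
  have fin: "finite (insert p B)"
    using ind by (rule independent_imp_finite)
  have "card (insert p B) = CARD('n)"
    using dim_eq_card[OF _ ind, of UNIV] span by simp
  \<comment> \<open>Indexing the basis by \<open>'n\<close> makes the matrix of \<open>A\<close> in
    this basis a value of type \<open>real^'n^'n\<close>, to which \<open>det\<close>
    applies.\<close>
  then obtain f :: "'n \<Rightarrow> real^'n" where f: "bij_betw f UNIV (insert p B)"
    using finite_same_card_bij[OF finite[of UNIV] fin] by auto
  obtain i0 where i0: "f i0 = p"
    using f by (metis bij_betw_imp_surj_on imageE insertI1)
  define K where "K = UNIV - {i0}"
  have inj: "inj f" using f by (simp add: bij_betw_def)
  have fK: "bij_betw f K B"
    unfolding bij_betw_def K_def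
  proof
    show "inj_on f (UNIV - {i0})" by (rule inj_on_subset[OF inj]) simp
    have "f ` (UNIV - {i0}) = insert p B - {p}"
      using f by (simp add: image_set_diff[OF inj] i0 bij_betw_def)
    then show "f ` (UNIV - {i0}) = B" using pB by simp
  qed
  \<comment> \<open>The rows are the basis vectors, so conjugation by this orthogonal matrix gives
    the matrix of \<open>A\<close> in the new basis and keeps the determinant.\<close>
  define O' :: "real^'n^'n" where "O' = (\<chi> i. f i)"
  have fn: "norm (f i) = 1" for i
    using f p B(3) by (metis UNIV_I bij_betw_apply insert_iff)
  have "orthogonal_matrix O'"
    unfolding orthogonal_matrix_orthonormal_rows
  proof (intro conjI allI impI)
    fix i j :: 'n assume "i \<noteq> j"
    then have "f i \<noteq> f j" using inj by (simp add: inj_eq)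
    moreover have "f i \<in> insert p B" "f j \<in> insert p B"
      using bij_betw_apply[OF f] by blast+
    ultimately have "orthogonal (f i) (f j)"
      using orth unfolding pairwise_def by blast
    then show "orthogonal (row i O') (row j O')"
      by (simp add: O'_def row_def vec_lambda_eta)
  qed (simp add: O'_def row_def fn vec_lambda_eta)
  then have "det O' = 1 \<or> det O' = - 1"
    by (rule det_orthogonal_matrix)
  then have detO: "det (O' ** A ** transpose O') = det A"
    by (auto simp: det_mul)
  have entry: "(O' ** A ** transpose O') $ i $ j = f i \<bullet> (A *v f j)" for i j
  proof -
    have "(O' ** A ** transpose O') $ i $ j = (\<Sum>l\<in>UNIV. (\<Sum>k\<in>UNIV. f i $ k * A $ k $ l) * f j $ l)"
      by (simp add: matrix_matrix_mult_def transpose_def O'_def)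
    also have "\<dots> = (\<Sum>k\<in>UNIV. f i $ k * (\<Sum>l\<in>UNIV. A $ k $ l * f j $ l))"
      unfolding sum_distrib_left sum_distrib_right by (subst sum.swap) (simp only: mult.assoc)
    finally show ?thesis
      by (simp add: inner_vec_def matrix_vector_mult_def)
  qed
  have "det A = (\<Sum>\<pi>\<in>{\<pi>. \<pi> permutes UNIV}. of_int (sign \<pi>) * (\<Prod>i\<in>UNIV. f i \<bullet> (A *v f (\<pi> i))))"
    by (subst detO[symmetric], subst det_def) (simp only: entry)
  also have "\<dots> = (\<Sum>\<pi>\<in>{\<pi>. \<pi> permutes K}. of_int (sign \<pi>) * (\<Prod>i\<in>UNIV. f i \<bullet> (A *v f (\<pi> i))))"
  proof (rule sum.mono_neutral_right)
    show "{\<pi>. \<pi> permutes K} \<subseteq> {\<pi>. \<pi> permutes UNIV}"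
      using permutes_subset by blast
    show "\<forall>\<pi>\<in>{\<pi>. \<pi> permutes UNIV} - {\<pi>. \<pi> permutes K}.
       real_of_int (sign \<pi>) * (\<Prod>i\<in>UNIV. f i \<bullet> (A *v f (\<pi> i))) = 0"
    proof
      fix \<pi> assume "\<pi> \<in> {\<pi>. \<pi> permutes UNIV} - {\<pi>. \<pi> permutes K}"
      then have \<pi>: "\<pi> permutes UNIV" "\<not> \<pi> permutes K" by auto
      \<comment> \<open>A permutation fixing \<open>i0\<close> would permute \<open>K\<close>. As
        \<open>i0\<close> is moved, the factor at \<open>i0\<close> pairs \<open>p\<close> with
        \<open>A\<close> applied to an element of \<open>B\<close>, and this is zero because
        \<open>A\<close> is symmetric and fixes \<open>p\<close>.\<close>
      have "\<pi> i0 \<noteq> i0"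
      proof
        assume "\<pi> i0 = i0"
        then have "\<pi> permutes K"
          by (intro permutes_superset[OF \<pi>(1)]) (auto simp: K_def)
        then show False using \<pi>(2) by simp
      qed
      then have "f (\<pi> i0) \<in> B"
        using fK by (simp add: K_def bij_betw_apply)
      then have "p \<bullet> f (\<pi> i0) = 0"
        using B(1) by (auto simp: tangent_space_def inner_commute)
      then have "f i0 \<bullet> (A *v f (\<pi> i0)) = 0"
        using dot_lmul_matrix[of p A "f (\<pi> i0)"] Ap sym
        by (simp add: i0 flip: transpose_matrix_vector)
      then have "(\<Prod>i\<in>UNIV. f i \<bullet> (A *v f (\<pi> i))) = 0"
        by (intro prod_zero) auto
      then show "real_of_int (sign \<pi>) * (\<Prod>i\<in>UNIV. f i \<bullet> (A *v f (\<pi> i))) = 0"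
        by simp
    qed
  qed (simp add: finite_permutations)
  also have "\<dots> = (\<Sum>\<pi>\<in>{\<pi>. \<pi> permutes K}. of_int (sign \<pi>) * (\<Prod>i\<in>K. f i \<bullet> (A *v f (\<pi> i))))"
  proof (intro sum.cong refl arg_cong2[where f = "(*)"])
    fix \<pi> assume "\<pi> \<in> {\<pi>. \<pi> permutes K}"
    then have "\<pi> i0 = i0"
      by (auto simp: K_def permutes_def)
    then have "f i0 \<bullet> (A *v f (\<pi> i0)) = 1"
      using p by (simp add: i0 Ap norm_eq_1)
    then show "(\<Prod>i\<in>UNIV. f i \<bullet> (A *v f (\<pi> i))) = (\<Prod>i\<in>K. f i \<bullet> (A *v f (\<pi> i)))"
      unfolding K_def by (subst prod.remove[of UNIV i0]) auto
  qed
  also have "\<dots> = (\<Sum>\<pi>\<in>{\<pi>. \<pi> permutes B}. of_int (sign \<pi>) * (\<Prod>b\<in>B. b \<bullet> (A *v \<pi> b)))"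
    by (rule sum_permutes_reindex[OF fK, symmetric]) simp
  also have "\<dots> = (\<Sum>\<pi>\<in>{\<pi>. \<pi> permutes B}. of_int (sign \<pi>) * (\<Prod>b\<in>B. b \<bullet> L (\<pi> b)))"
  proof (intro sum.cong refl arg_cong2[where f = "(*)"] prod.cong arg_cong2[where f = inner])
    fix \<pi> b assume "\<pi> \<in> {\<pi>. \<pi> permutes B}" "b \<in> B"
    then have "\<pi> b \<in> ?T"
      using B(1) by (auto simp: permutes_in_image)
    then show "A *v \<pi> b = L (\<pi> b)"
      using L by simp
  qed
  finally show ?thesis
    by (simp add: det_on_def Let_def B_def)
qed

text \<open>The product of Kronecker deltas kills every permutation that moves a point outside
  \<open>X\<close>. Such products arise when a determinant is differentiated at the identity: the
  rows left undifferentiated are rows of the identity matrix.\<close>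

lemma sum_permutes_fixing:
  fixes g :: "('n::finite \<Rightarrow> 'n) \<Rightarrow> real"
  shows "(\<Sum>\<pi>\<in>{\<pi>. \<pi> permutes UNIV}. g \<pi> * (\<Prod>k\<in>UNIV - X. if k = \<pi> k then 1 else 0)) =
    (\<Sum>\<pi>\<in>{\<pi>. \<pi> permutes X}. g \<pi>)"
proof -
  have "(\<Sum>\<pi>\<in>{\<pi>. \<pi> permutes UNIV}. g \<pi> * (\<Prod>k\<in>UNIV - X. if k = \<pi> k then 1 else 0)) =
    (\<Sum>\<pi>\<in>{\<pi>. \<pi> permutes X}. g \<pi> * (\<Prod>k\<in>UNIV - X. if k = \<pi> k then 1 else 0))"
  proof (rule sum.mono_neutral_right)
    show "{\<pi>. \<pi> permutes X} \<subseteq> {\<pi>. \<pi> permutes UNIV}"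
      using permutes_subset by blast
    show "\<forall>\<pi>\<in>{\<pi>. \<pi> permutes UNIV} - {\<pi>. \<pi> permutes X}.
       g \<pi> * (\<Prod>k\<in>UNIV - X. if k = \<pi> k then 1 else 0) = 0"
    proof
      fix \<pi> assume "\<pi> \<in> {\<pi>. \<pi> permutes UNIV} - {\<pi>. \<pi> permutes X}"
      then have \<pi>: "\<pi> permutes UNIV" "\<not> \<pi> permutes X" by auto
      obtain k where k: "k \<in> UNIV - X" "\<pi> k \<noteq> k"
        using \<pi>(2) permutes_superset[OF \<pi>(1), of X] by blast
      then have "(\<Prod>k\<in>UNIV - X. if k = \<pi> k then 1 else 0 :: real) = 0"
        by (intro prod_zero bexI[of _ k]) auto
      then show "g \<pi> * (\<Prod>k\<in>UNIV - X. if k = \<pi> k then 1 else 0) = 0"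
        by simp
    qed
  qed (simp add: finite_permutations)
  also have "\<dots> = (\<Sum>\<pi>\<in>{\<pi>. \<pi> permutes X}. g \<pi>)"
  proof (intro sum.cong refl)
    fix \<pi> assume "\<pi> \<in> {\<pi>. \<pi> permutes X}"
    then have "k = \<pi> k" if "k \<in> UNIV - X" for k
      using that by (auto simp: permutes_not_in)
    then have "(\<Prod>k\<in>UNIV - X. if k = \<pi> k then 1 else 0 :: real) = 1"
      by (intro prod.neutral) auto
    then show "g \<pi> * (\<Prod>k\<in>UNIV - X. if k = \<pi> k then 1 else 0) = g \<pi>"
      by simp
  qed
  finally show ?thesis .
qed

section \<open>The determinant of I + sB as a polynomial in s\<close>

definition pencil :: "real^'n^'n \<Rightarrow> 'n \<Rightarrow> 'n \<Rightarrow> real poly" where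
  "pencil B i j = [:if i = j then 1 else 0, B $ i $ j:]"

text \<open>Kept as a formal polynomial so that derivatives in s are algebraic and a mean over the
  sphere can be taken coefficient by coefficient.\<close>

definition det_pencil :: "real^'n^'n \<Rightarrow> real poly" where
  "det_pencil B = (\<Sum>\<pi>\<in>{\<pi>. \<pi> permutes UNIV}. of_int (sign \<pi>) * (\<Prod>i\<in>UNIV. pencil B i (\<pi> i)))"

lemma poly_det_pencil: "poly (det_pencil B) s = det (mat 1 + s *\<^sub>R B)"
  unfolding det_def det_pencil_def poly_sum
  by (intro sum.cong refl)
    (simp add: poly_prod pencil_def mat_def of_int_poly)

lemma pderiv_pencil: "pderiv (pencil B i j) = [:B $ i $ j:]"
  by (simp add: pencil_def pderiv_pCons)

lemma poly_pencil_0: "poly (pencil B i j) 0 = (if i = j then 1 else 0)"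
  by (simp add: pencil_def)

lemma poly_pderiv_sum: "pderiv (\<Sum>i\<in>I. f i) = (\<Sum>i\<in>I. pderiv (f i))" for f :: "'i \<Rightarrow> real poly"
  using higher_pderiv_sum[of 1 f I] by simp

lemma pderiv_of_int_mult: "pderiv (of_int c * p) = of_int c * pderiv p" for p :: "real poly"
  by (simp add: of_int_poly pderiv_smult)

lemma pderiv_det_pencil:
  "pderiv (det_pencil B) = (\<Sum>i\<in>UNIV. \<Sum>\<pi>\<in>{\<pi>. \<pi> permutes UNIV}.
     of_int (sign \<pi>) * ((\<Prod>k\<in>UNIV - {i}. pencil B k (\<pi> k)) * [:B $ i $ \<pi> i:]))"
proof -
  have "pderiv (det_pencil B) = (\<Sum>\<pi>\<in>{\<pi>. \<pi> permutes UNIV}.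
     of_int (sign \<pi>) * (\<Sum>i\<in>UNIV. (\<Prod>k\<in>UNIV - {i}. pencil B k (\<pi> k)) * [:B $ i $ \<pi> i:]))"
    unfolding det_pencil_def poly_pderiv_sum pderiv_of_int_mult pderiv_prod pderiv_pencil ..
  then show ?thesis
    unfolding sum_distrib_left by (subst sum.swap)
qed

text \<open>With row \<open>i\<close> differentiated, the identity rows elsewhere leave only the
  identity permutation.\<close>

lemma poly_pderiv_det_pencil_0: "poly (pderiv (det_pencil B)) 0 = (\<Sum>i\<in>UNIV. B $ i $ i)"
proof -
  have "poly (pderiv (det_pencil B)) 0 = (\<Sum>i\<in>UNIV. \<Sum>\<pi>\<in>{\<pi>. \<pi> permutes UNIV}.
     (of_int (sign \<pi>) * B $ i $ \<pi> i) * (\<Prod>k\<in>UNIV - {i}. if k = \<pi> k then 1 else 0))"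
    by (simp add: pderiv_det_pencil poly_sum poly_prod poly_pencil_0 of_int_poly mult_ac)
  also have "\<dots> = (\<Sum>i\<in>UNIV. B $ i $ i)"
    unfolding sum_permutes_fixing by simp
  finally show ?thesis .
qed

text \<open>With rows \<open>i\<close> and \<open>j\<close> differentiated, only the identity and
  the transposition of \<open>i\<close> and \<open>j\<close> survive. Each ordered pair contributes
  a principal 2x2 minor.\<close>

lemma poly_pderiv2_det_pencil_0:
  fixes B :: "real^'n^'n"
  shows "poly (pderiv (pderiv (det_pencil B))) 0 =
    (\<Sum>i\<in>UNIV. \<Sum>j\<in>UNIV. B $ i $ i * B $ j $ j - B $ i $ j * B $ j $ i)"
proof -
  have "pderiv (pderiv (det_pencil B)) = (\<Sum>i\<in>UNIV. \<Sum>\<pi>\<in>{\<pi>. \<pi> permutes UNIV}.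
     of_int (sign \<pi>) * (\<Sum>j\<in>UNIV - {i}. (\<Prod>k\<in>UNIV - {i} - {j}. pencil B k (\<pi> k)) *
        [:B $ j $ \<pi> j:] * [:B $ i $ \<pi> i:]))"
    unfolding pderiv_det_pencil poly_pderiv_sum pderiv_of_int_mult pderiv_mult pderiv_prod pderiv_pencil
    by (simp add: pderiv_pCons sum_distrib_left sum_distrib_right mult_ac of_int_poly[of "sign _"])
  then have "poly (pderiv (pderiv (det_pencil B))) 0 =
     (\<Sum>i\<in>UNIV. \<Sum>\<pi>\<in>{\<pi>. \<pi> permutes UNIV}. \<Sum>j\<in>UNIV - {i}.
       (of_int (sign \<pi>) * B $ i $ \<pi> i * B $ j $ \<pi> j) *
       (\<Prod>k\<in>UNIV - {i, j}. if k = \<pi> k then 1 else 0))"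
    by (simp add: poly_sum poly_prod poly_pencil_0 of_int_poly sum_distrib_left mult_ac Diff_insert2[symmetric])
  also have "\<dots> = (\<Sum>i\<in>UNIV. \<Sum>j\<in>UNIV - {i}. \<Sum>\<pi>\<in>{\<pi>. \<pi> permutes UNIV}.
       (of_int (sign \<pi>) * B $ i $ \<pi> i * B $ j $ \<pi> j) *
       (\<Prod>k\<in>UNIV - {i, j}. if k = \<pi> k then 1 else 0))"
    by (intro sum.cong refl sum.swap)
  also have "\<dots> = (\<Sum>i\<in>UNIV. \<Sum>j\<in>UNIV - {i}. B $ i $ i * B $ j $ j - B $ i $ j * B $ j $ i)"
  proof (intro sum.cong refl)
    fix i j :: 'n assume "j \<in> UNIV - {i}"
    then have "id \<noteq> Transposition.transpose i j" "i \<noteq> j"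
      by (auto simp: fun_eq_iff Transposition.transpose_def)
    moreover have "{\<pi>. \<pi> permutes {i, j}} = {id, Transposition.transpose i j}"
      by (auto simp: permutes_doubleton_iff)
    ultimately show "(\<Sum>\<pi>\<in>{\<pi>. \<pi> permutes UNIV}.
       (of_int (sign \<pi>) * B $ i $ \<pi> i * B $ j $ \<pi> j) *
       (\<Prod>k\<in>UNIV - {i, j}. if k = \<pi> k then 1 else 0)) = B $ i $ i * B $ j $ j - B $ i $ j * B $ j $ i"
      unfolding sum_permutes_fixing by (simp add: sign_swap_id)
  qed
  \<comment> \<open>The summands with \<open>j = i\<close> are zero, so the range of
    \<open>j\<close> can be completed.\<close>
  also have "\<dots> = (\<Sum>i\<in>UNIV. \<Sum>j\<in>UNIV. B $ i $ i * B $ j $ j - B $ i $ j * B $ j $ i)"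
    by (intro sum.cong refl sum.mono_neutral_left) auto
  finally show ?thesis .
qed

lemma continuous_on_coeff_sum:
  fixes P :: "'i \<Rightarrow> 'a::topological_space \<Rightarrow> real poly"
  assumes "\<And>i k. i \<in> I \<Longrightarrow> continuous_on S (\<lambda>x. coeff (P i x) k)"
  shows "continuous_on S (\<lambda>x. coeff (\<Sum>i\<in>I. P i x) k)"
  unfolding coeff_sum using assms by (intro continuous_on_sum)

lemma continuous_on_coeff_mult:
  fixes P Q :: "'a::topological_space \<Rightarrow> real poly"
  assumes "\<And>k. continuous_on S (\<lambda>x. coeff (P x) k)" "\<And>k. continuous_on S (\<lambda>x. coeff (Q x) k)"
  shows "continuous_on S (\<lambda>x. coeff (P x * Q x) k)"
  unfolding coeff_mult using assms by (intro continuous_on_sum continuous_on_mult)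

lemma continuous_on_coeff_prod:
  fixes P :: "'i \<Rightarrow> 'a::topological_space \<Rightarrow> real poly"
  assumes "\<And>i k. i \<in> I \<Longrightarrow> continuous_on S (\<lambda>x. coeff (P i x) k)"
  shows "continuous_on S (\<lambda>x. coeff (\<Prod>i\<in>I. P i x) k)"
  using assms
proof (induction I arbitrary: k rule: infinite_finite_induct)
  case (insert i I)
  then show ?case
    by (simp add: continuous_on_coeff_mult)
qed auto

lemma continuous_on_coeff_linear:
  fixes a b :: "'a::topological_space \<Rightarrow> real"
  assumes "continuous_on S a" "continuous_on S b"
  shows "continuous_on S (\<lambda>x. coeff [:a x, b x:] k)"
proof -
  consider "k = 0" | "k = 1" | m where "k = Suc (Suc m)"
    by (metis One_nat_def not0_implies_Suc)
  then show ?thesis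
    using assms by cases (simp_all add: coeff_pCons)
qed

text \<open>Applied to the Hessian of \<open>cone_ext \<eta>\<close> as a function of the point,
  this makes the coefficients integrable over the sphere.\<close>

lemma continuous_on_coeff_det_pencil:
  fixes B :: "'a::topological_space \<Rightarrow> real^'n^'n"
  assumes "\<And>i j. continuous_on S (\<lambda>x. B x $ i $ j)"
  shows "continuous_on S (\<lambda>x. coeff (det_pencil (B x)) k)"
  unfolding det_pencil_def pencil_def
  by (intro continuous_on_coeff_sum continuous_on_coeff_mult continuous_on_coeff_prod
      continuous_on_coeff_linear assms continuous_on_const)

lemma degree_pencil: "degree (pencil B i j) \<le> 1"
  by (simp add: pencil_def)

text \<open>The bound is uniform in \<open>B\<close>, hence in the point of the sphere, so means are
  formed over one finite range of coefficients.\<close>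

lemma degree_det_pencil: "degree (det_pencil B) \<le> CARD('n)" for B :: "real^'n^'n"
  unfolding det_pencil_def
proof (rule degree_sum_le)
  fix \<pi> :: "'n \<Rightarrow> 'n"
  have "degree (of_int (sign \<pi>) * (\<Prod>i\<in>UNIV. pencil B i (\<pi> i))) \<le> degree (\<Prod>i\<in>UNIV. pencil B i (\<pi> i))"
    by (simp add: of_int_poly)
  also have "\<dots> \<le> (\<Sum>i\<in>UNIV. degree (pencil B i (\<pi> i)))"
    using degree_prod_sum_le[of UNIV "\<lambda>i. pencil B i (\<pi> i)"] by (simp add: o_def)
  also have "\<dots> \<le> (\<Sum>i\<in>(UNIV::'n set). 1)"
    by (intro sum_mono degree_pencil)
  finally show "degree (of_int (sign \<pi>) * (\<Prod>i\<in>UNIV. pencil B i (\<pi> i))) \<le> CARD('n)"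
    by simp
qed (simp add: finite_permutations)

subsection \<open>Invariance of the surface measure and integration by parts\<close>

lemma nn_integral_lborel_translate:
  fixes f :: "'a::euclidean_space \<Rightarrow> ennreal"
  assumes [measurable]: "f \<in> borel_measurable borel"
  shows "(\<integral>\<^sup>+x. f (x + c) \<partial>lborel) = (\<integral>\<^sup>+x. f x \<partial>lborel)"
proof -
  have "(\<integral>\<^sup>+x. f x \<partial>lborel) = (\<integral>\<^sup>+x. f x \<partial>distr lborel borel ((+) c))"
    by (simp add: lborel_distr_plus)
  also have "\<dots> = (\<integral>\<^sup>+x. f (x + c) \<partial>lborel)"
    by (subst nn_integral_distr) (auto simp: add.commute)
  finally show ?thesis ..
qed

text \<open>Integrate \<open>(x, y) \<mapsto> 1\<^sub>B(y) 1\<^sub>E(T x + y)\<close> in both orders, where \<open>B\<close> is the unit ball, which \<open>T\<close> preserves.\<close>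

lemma lborel_distr_orthogonal:
  fixes T :: "'a::euclidean_space \<Rightarrow> 'a"
  assumes T: "orthogonal_transformation T"
  shows "distr lborel borel T = lborel"
proof (rule measure_eqI)
  fix E :: "'a set" assume "E \<in> sets (distr lborel borel T)"
  then have [measurable]: "E \<in> sets borel" by simp
  have lin: "linear T"
    using T by (rule orthogonal_transformation_linear)
  have T_meas [measurable]: "T \<in> borel_measurable borel"
    by (intro borel_measurable_continuous_onI linear_continuous_on linear_conv_bounded_linear[THEN iffD1] lin)
  have [measurable]: "T -` E \<in> sets borel"
    by (rule measurable_sets_borel[OF T_meas \<open>E \<in> sets borel\<close>])
  \<comment> \<open>The right inverse moves shifts to the other side of \<open>T\<close>: T x + y =
    T (x + T' y) and |y - T x| = |x - T' y|. Both inner integrals then become translates in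
    \<open>x\<close>.\<close>
  obtain T' where T': "\<And>x. T (T' x) = x"
    using orthogonal_transformation_surj[OF T] by (metis surj_f_inv_f)
  let ?B = "ball 0 1 :: 'a set"
  let ?b = "indicator ?B :: 'a \<Rightarrow> ennreal" and ?e = "indicator E :: 'a \<Rightarrow> ennreal"
  have b_meas [measurable]: "?b \<in> borel_measurable borel" and e_meas [measurable]: "?e \<in> borel_measurable borel"
    by (auto intro: borel_measurable_indicator)
  have "emeasure lborel (T -` E) * emeasure lborel ?B = (\<integral>\<^sup>+y. ?b y * (\<integral>\<^sup>+x. ?e (T x) \<partial>lborel) \<partial>lborel)"
  proof -
    have "(\<integral>\<^sup>+x. ?e (T x) \<partial>lborel) = emeasure lborel (T -` E)"
      by (simp flip: indicator_vimage)
    moreover have "(\<integral>\<^sup>+y. ?b y * emeasure lborel (T -` E) \<partial>lborel) = emeasure lborel ?B * emeasure lborel (T -` E)"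
      by (subst nn_integral_multc) (auto simp: b_meas)
    ultimately show ?thesis by (simp add: mult.commute)
  qed
  also have "\<dots> = (\<integral>\<^sup>+y. (\<integral>\<^sup>+x. ?b y * ?e (T x + y) \<partial>lborel) \<partial>lborel)"
  proof (rule nn_integral_cong)
    fix y :: 'a
    have "(\<integral>\<^sup>+x. ?e (T x) \<partial>lborel) = (\<integral>\<^sup>+x. ?e (T (x + T' y)) \<partial>lborel)"
      by (rule nn_integral_lborel_translate[symmetric]) measurable
    then show "?b y * (\<integral>\<^sup>+x. ?e (T x) \<partial>lborel) = (\<integral>\<^sup>+x. ?b y * ?e (T x + y) \<partial>lborel)"
      by (simp add: linear_add[OF lin] T' nn_integral_cmult measurable_compose[OF _ e_meas])
  qed
  also have "\<dots> = (\<integral>\<^sup>+x. (\<integral>\<^sup>+y. ?b y * ?e (T x + y) \<partial>lborel) \<partial>lborel)"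
    by (rule lborel_pair.Fubini') measurable
  also have "\<dots> = (\<integral>\<^sup>+x. (\<integral>\<^sup>+y. ?b (y - T x) * ?e y \<partial>lborel) \<partial>lborel)"
  proof (rule nn_integral_cong)
    fix x :: 'a
    have "(\<integral>\<^sup>+y. ?b (y - T x) * ?e y \<partial>lborel) = (\<integral>\<^sup>+y. ?b (y + T x - T x) * ?e (y + T x) \<partial>lborel)"
      by (rule nn_integral_lborel_translate[of "\<lambda>y. ?b (y - T x) * ?e y" "T x", symmetric]) measurable
    then show "(\<integral>\<^sup>+y. ?b y * ?e (T x + y) \<partial>lborel) = (\<integral>\<^sup>+y. ?b (y - T x) * ?e y \<partial>lborel)"
      by (simp add: add.commute)
  qed
  also have "\<dots> = (\<integral>\<^sup>+y. (\<integral>\<^sup>+x. ?b (y - T x) * ?e y \<partial>lborel) \<partial>lborel)"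
    by (rule lborel_pair.Fubini'[symmetric]) measurable
  also have "\<dots> = (\<integral>\<^sup>+y. emeasure lborel ?B * ?e y \<partial>lborel)"
  proof (rule nn_integral_cong)
    fix y :: 'a
    have "?b (y - T x) = ?b (x + - T' y)" for x
    proof -
      have "norm (y - T x) = norm (T (T' y - x))"
        by (simp add: linear_diff[OF lin] T')
      also have "\<dots> = norm (x + - T' y)"
        by (simp add: orthogonal_transformation_norm[OF T] norm_minus_commute)
      finally show ?thesis by (simp add: indicator_def)
    qed
    then have "(\<integral>\<^sup>+x. ?b (y - T x) * ?e y \<partial>lborel) = (\<integral>\<^sup>+x. ?b (x + - T' y) \<partial>lborel) * ?e y"
      by (simp add: nn_integral_multc)
    also have "(\<integral>\<^sup>+x. ?b (x + - T' y) \<partial>lborel) = emeasure lborel ?B"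
      by (subst nn_integral_lborel_translate) auto
    finally show "(\<integral>\<^sup>+x. ?b (y - T x) * ?e y \<partial>lborel) = emeasure lborel ?B * ?e y" .
  qed
  also have "\<dots> = emeasure lborel E * emeasure lborel ?B"
    by (subst nn_integral_cmult) (auto simp: mult.commute e_meas)
  finally have "emeasure lborel (T -` E) * emeasure lborel ?B = emeasure lborel E * emeasure lborel ?B" .
  moreover have "emeasure lborel ?B \<noteq> 0" "emeasure lborel ?B \<noteq> \<infinity>"
    using emeasure_lborel_ball_finite[of "0::'a" 1] content_ball_pos[of 1 "0::'a"]
    by (auto simp: measure_def)
  ultimately have "emeasure lborel (T -` E) = emeasure lborel E"
    using ennreal_mult_cancel_left[of "emeasure lborel ?B" "emeasure lborel (T -` E)" "emeasure lborel E"]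
    by (auto simp: mult.commute)
  then show "emeasure (distr lborel borel T) E = emeasure lborel E"
    by (simp add: emeasure_distr)
qed simp

text \<open>Dominated convergence along sequences: the mean value estimate bounds every difference
  quotient by \<open>C\<close>, and constants are integrable for a finite measure.\<close>

lemma has_real_derivative_integral:
  fixes f f' :: "real \<Rightarrow> 'a \<Rightarrow> real"
  assumes "finite_measure M" and e: "e > 0"
    and int: "\<And>s. \<bar>s - s0\<bar> < e \<Longrightarrow> integrable M (f s)"
    and meas: "f' s0 \<in> borel_measurable M"
    and D: "\<And>s x. \<bar>s - s0\<bar> < e \<Longrightarrow> x \<in> space M \<Longrightarrow> ((\<lambda>s. f s x) has_real_derivative f' s x) (at s)"
    and C: "\<And>s x. \<bar>s - s0\<bar> < e \<Longrightarrow> x \<in> space M \<Longrightarrow> \<bar>f' s x\<bar> \<le> C"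
  shows "((\<lambda>s. LINT x|M. f s x) has_real_derivative (LINT x|M. f' s0 x)) (at s0)"
proof -
  interpret finite_measure M by fact
  have "((\<lambda>h. ((LINT x|M. f (s0 + h) x) - (LINT x|M. f s0 x)) / h) \<longlongrightarrow> (LINT x|M. f' s0 x)) (at 0)"
    unfolding tendsto_at_iff_sequentially
  proof (intro allI impI)
    fix X :: "nat \<Rightarrow> real" assume X: "\<forall>i. X i \<in> UNIV - {0}" "X \<longlonglongrightarrow> 0"
    then have X0: "X n \<noteq> 0" for n by auto
    \<comment> \<open>The value 0 for large \<open>X n\<close> makes every term measurable and
      bounded, since \<open>f\<close> is controlled only within distance \<open>e\<close> of
      \<open>s0\<close>; eventually this case does not occur.\<close>
    define q where "q = (\<lambda>n x. if \<bar>X n\<bar> < e then (f (s0 + X n) x - f s0 x) / X n else 0)"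
    have small: "\<forall>\<^sub>F n in sequentially. \<bar>X n\<bar> < e"
      using tendstoD[OF X(2) e] by (simp add: dist_real_def)
    have "(\<lambda>n. LINT x|M. q n x) \<longlonglongrightarrow> (LINT x|M. f' s0 x)"
    proof (rule integral_dominated_convergence[where w = "\<lambda>_. C"])
      show "q n \<in> borel_measurable M" for n
        unfolding q_def using int[of s0] int[of "s0 + X n"] e by (cases "\<bar>X n\<bar> < e") auto
      show "AE x in M. (\<lambda>n. q n x) \<longlonglongrightarrow> f' s0 x"
      proof (rule AE_I2)
        fix x assume "x \<in> space M"
        then have "((\<lambda>h. (f (s0 + h) x - f s0 x) / h) \<longlongrightarrow> f' s0 x) (at 0)"
          using D[of s0 x] e by (simp add: DERIV_def)
        then have "((\<lambda>h. (f (s0 + h) x - f s0 x) / h) \<circ> X) \<longlonglongrightarrow> f' s0 x"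
          using X unfolding tendsto_at_iff_sequentially by blast
        then show "(\<lambda>n. q n x) \<longlonglongrightarrow> f' s0 x"
          by (rule Lim_transform_eventually) (use small in \<open>auto simp: q_def elim!: eventually_mono\<close>)
      qed
      show "AE x in M. norm (q n x) \<le> C" for n
      proof (rule AE_I2)
        fix x assume x: "x \<in> space M"
        have C0: "0 \<le> C" using C[OF _ x, of s0] e by fastforce
        show "norm (q n x) \<le> C"
        proof (cases "\<bar>X n\<bar> < e")
          case True
          have "norm (f (s0 + X n) x - f s0 x) \<le> C * norm (s0 + X n - s0)"
          proof (rule field_differentiable_bound)
            show "convex (ball s0 e)" by simp
            show "((\<lambda>s. f s x) has_real_derivative f' z x) (at z within ball s0 e)" if "z \<in> ball s0 e" for z
              by (rule has_field_derivative_at_within[OF D[OF _ x]])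
                (use that in \<open>simp add: dist_real_def abs_minus_commute\<close>)
            show "norm (f' z x) \<le> C" if "z \<in> ball s0 e" for z
              using that C[OF _ x, of z] by (simp add: dist_real_def abs_minus_commute)
          qed (use True e in \<open>auto simp: dist_real_def\<close>)
          then show ?thesis
            using True X0[of n] by (simp add: q_def field_simps)
        qed (simp add: q_def C0)
      qed
    qed (use meas in auto)
    then show "((\<lambda>h. ((LINT x|M. f (s0 + h) x) - (LINT x|M. f s0 x)) / h) \<circ> X) \<longlonglongrightarrow> (LINT x|M. f' s0 x)"
    proof (rule Lim_transform_eventually)
      show "\<forall>\<^sub>F n in sequentially. (LINT x|M. q n x) =
          ((\<lambda>h. ((LINT x|M. f (s0 + h) x) - (LINT x|M. f s0 x)) / h) \<circ> X) n"
        using small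
      proof eventually_elim
        case (elim n)
        then show ?case
          using int[of s0] int[of "s0 + X n"] e by (simp add: q_def)
      qed
    qed
  qed
  then show ?thesis by (simp add: DERIV_def)
qed

section \<open>The surface measure: finiteness, positivity, invariance under orthogonal maps\<close>

abbreviation usphere :: "(real^'n) set" where
  "usphere \<equiv> sphere 0 1"

lemma space_sphere_measure [simp]: "space (sphere_measure :: (real^'n) measure) = usphere"
  by (simp add: sphere_measure_def space_restrict_space)

lemma sets_sphere_measure: "sets (sphere_measure :: (real^'n) measure) = sets (restrict_space borel usphere)"
  by (simp add: sphere_measure_def)

lemma borel_measurable_sphere_measure:
  fixes f :: "real^'n \<Rightarrow> real"
  assumes "continuous_on usphere f"
  shows "f \<in> borel_measurable sphere_measure"
  using borel_measurable_continuous_on_restrict[OF assms]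
  by (simp cong: measurable_cong_sets add: sets_sphere_measure)

lemma normalize_measurable:
  "(\<lambda>x. x /\<^sub>R norm x) \<in> restrict_space lborel (ball 0 1 - {0}) \<rightarrow>\<^sub>M restrict_space borel (usphere :: (real^'n) set)"
proof (rule measurable_restrict_space2)
  show "(\<lambda>x::real^'n. x /\<^sub>R norm x) \<in> borel_measurable (restrict_space lborel (ball 0 1 - {0}))"
    by (rule measurable_restrict_space1) measurable
qed (auto simp: space_restrict_space)

lemma finite_sphere_measure: "finite_measure (sphere_measure :: (real^'n) measure)"
proof -
  let ?M = "restrict_space lborel (ball 0 1 - {0}) :: (real^'n) measure"
  have "emeasure (density ?M (\<lambda>_. of_nat CARD('n))) (space ?M) = of_nat CARD('n) * emeasure ?M (space ?M)"
    by (rule emeasure_density_const[OF sets.top])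
  also have "\<dots> \<noteq> \<infinity>"
  proof -
    have "emeasure ?M (space ?M) = emeasure lborel (ball 0 1 - {0 :: real^'n})"
      by (simp add: emeasure_restrict_space space_restrict_space)
    also have "\<dots> \<le> emeasure lborel (ball (0 :: real^'n) 1)"
      by (rule emeasure_mono) auto
    finally show ?thesis
      using emeasure_lborel_ball_finite[of "0 :: real^'n" 1]
      by (auto simp: ennreal_mult_eq_top_iff top_unique ennreal_of_nat_eq_real_of_nat)
  qed
  finally have "finite_measure (density ?M (\<lambda>_. of_nat CARD('n)))"
    by (intro finite_measureI) simp
  then show ?thesis
    unfolding sphere_measure_def
    by (rule finite_measure.finite_measure_distr) (use normalize_measurable in simp)
qed

lemma integral_sphere_measure:
  fixes f :: "real^'n \<Rightarrow> real"
  assumes "continuous_on usphere f"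
  shows "(LINT p|sphere_measure. f p) =
    real CARD('n) * (LINT x|lborel. indicator (ball 0 1 - {0}) x * f (x /\<^sub>R norm x))"
proof -
  let ?M = "restrict_space lborel (ball 0 1 - {0}) :: (real^'n) measure"
  have f: "f \<in> borel_measurable (restrict_space borel usphere)"
    using borel_measurable_continuous_on_restrict[OF assms] .
  have fn: "(\<lambda>x. f (x /\<^sub>R norm x)) \<in> borel_measurable ?M"
    using measurable_compose[OF normalize_measurable f] .
  have "(LINT p|sphere_measure. f p) = (LINT x|density ?M (\<lambda>_. of_nat CARD('n)). f (x /\<^sub>R norm x))"
    unfolding sphere_measure_def
    by (rule integral_distr) (use normalize_measurable f in simp_all)
  also have "\<dots> = (LINT x|?M. real CARD('n) * f (x /\<^sub>R norm x))"
    using integral_density[OF fn, of "\<lambda>_. real CARD('n)"] by (simp add: ennreal_of_nat_eq_real_of_nat)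
  also have "\<dots> = real CARD('n) * (LINT x|?M. f (x /\<^sub>R norm x))"
    by simp
  also have "(LINT x|?M. f (x /\<^sub>R norm x)) =
      (LINT x|lborel. indicator (ball 0 1 - {0}) x *\<^sub>R f (x /\<^sub>R norm x))"
    by (rule integral_restrict_space) simp
  finally show ?thesis by simp
qed

lemma integrable_sphere_measure:
  fixes f :: "real^'n \<Rightarrow> real"
  assumes "continuous_on usphere f"
  shows "integrable sphere_measure f"
proof -
  interpret finite_measure "sphere_measure :: (real^'n) measure"
    by (rule finite_sphere_measure)
  have "bounded (f ` usphere)"
    by (intro compact_imp_bounded compact_continuous_image assms compact_sphere)
  then obtain C where "\<And>x. x \<in> usphere \<Longrightarrow> norm (f x) \<le> C"
    unfolding bounded_iff by blast
  then show ?thesis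
    by (intro integrable_const_bound[of _ C] borel_measurable_sphere_measure assms AE_I2) simp
qed

lemma integral_sphere_cong:
  fixes f g :: "real^'n \<Rightarrow> real"
  assumes "\<And>p. norm p = 1 \<Longrightarrow> f p = g p"
  shows "(LINT p|sphere_measure. f p) = (LINT p|sphere_measure. g p)"
  by (rule Bochner_Integration.integral_cong) (use assms in simp_all)

lemma measure_sphere_measure_pos: "measure sphere_measure (usphere :: (real^'n) set) > 0"
proof -
  interpret finite_measure "sphere_measure :: (real^'n) measure"
    by (rule finite_sphere_measure)
  have "measure sphere_measure (usphere :: (real^'n) set) = (LINT p::real^'n|sphere_measure. 1)"
    using lebesgue_integral_const[of sphere_measure "1::real"] by simp
  also have "\<dots> = real CARD('n) * (LINT x|lborel. indicator (ball 0 1 - {0 :: real^'n}) x)"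
    by (subst integral_sphere_measure) auto
  also have "(LINT x|lborel. indicator (ball 0 1 - {0 :: real^'n}) x) = measure lborel (ball 0 1 - {0 :: real^'n})"
    by simp
  also have "\<dots> = measure lborel (ball (0 :: real^'n) 1)"
    by (rule measure_Diff_null_set) auto
  finally show ?thesis
    using content_ball_pos[of 1 "0 :: real^'n"] by simp
qed

text \<open>An orthogonal map preserves the punctured ball and commutes with normalisation, so the
  claim is invariance of Lebesgue measure on the cone over the sphere.\<close>

lemma integral_sphere_orthogonal:
  fixes f :: "real^'n \<Rightarrow> real" and T :: "real^'n \<Rightarrow> real^'n"
  assumes T: "orthogonal_transformation T" and f: "continuous_on usphere f"
  shows "(LINT p|sphere_measure. f (T p)) = (LINT p|sphere_measure. f p)"
proof -
  have lin: "linear T"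
    using T by (rule orthogonal_transformation_linear)
  have nT: "norm (T x) = norm x" for x
    using T by (rule orthogonal_transformation_norm)
  have T0: "T x = 0 \<longleftrightarrow> x = 0" for x
    by (metis nT norm_eq_zero)
  have contT: "continuous_on A T" for A
    by (intro linear_continuous_on linear_conv_bounded_linear[THEN iffD1] lin)
  let ?h = "\<lambda>x. indicator (ball 0 1 - {0}) x * f (x /\<^sub>R norm x)"
  have "?h (T x) = indicator (ball 0 1 - {0}) x * f (T (x /\<^sub>R norm x))" for x
    by (simp add: linear_scale[OF lin] indicator_def T0 nT)
  moreover have "continuous_on usphere (\<lambda>p. f (T p))"
    by (rule continuous_on_compose2[OF f contT]) (auto simp: nT)
  ultimately have "(LINT p|sphere_measure. f (T p)) = real CARD('n) * (LINT x|lborel. ?h (T x))"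
    by (simp add: integral_sphere_measure)
  also have "(LINT x|lborel. ?h (T x)) = (LINT x|distr lborel borel T. ?h x)"
  proof (rule integral_distr[symmetric])
    show "T \<in> lborel \<rightarrow>\<^sub>M borel"
      using borel_measurable_continuous_onI[OF contT] by simp
    have "(\<lambda>x. f (x /\<^sub>R norm x)) \<in> borel_measurable (restrict_space lborel (ball 0 1 - {0}))"
      using measurable_compose[OF normalize_measurable borel_measurable_continuous_on_restrict[OF f]] .
    then show "?h \<in> borel_measurable borel"
      by (subst (asm) borel_measurable_restrict_space_iff) simp_all
  qed
  finally show ?thesis
    by (simp add: lborel_distr_orthogonal[OF T] integral_sphere_measure[OF f])
qed

section \<open>Rotations in coordinate planes and integration by parts\<close>

definition rotation :: "'n \<Rightarrow> 'n \<Rightarrow> real \<Rightarrow> real^'n \<Rightarrow> real^'n" where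
  "rotation i j t x = (\<chi> k. if k = i then cos t * x $ i - sin t * x $ j
     else if k = j then sin t * x $ i + cos t * x $ j else x $ k)"

lemma orthogonal_rotation:
  assumes "i \<noteq> j"
  shows "orthogonal_transformation (rotation i j t :: real^'n \<Rightarrow> real^'n)"
  unfolding orthogonal_transformation
proof
  show "linear (rotation i j t :: real^'n \<Rightarrow> real^'n)"
    by (rule linearI) (simp_all add: rotation_def vec_eq_iff algebra_simps)
  have split: "sum g UNIV = g i + (g j + sum g (UNIV - {i} - {j}))" for g :: "'n \<Rightarrow> real"
    using assms by (subst sum.remove[of UNIV i], simp, simp, subst sum.remove[of _ j]) auto
  have "(norm (rotation i j t x))\<^sup>2 = (norm x)\<^sup>2" for x :: "real^'n"
  proof -
    have "(cos t * x $ i - sin t * x $ j) * (cos t * x $ i - sin t * x $ j)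
      + (sin t * x $ i + cos t * x $ j) * (sin t * x $ i + cos t * x $ j)
      = ((sin t)\<^sup>2 + (cos t)\<^sup>2) * (x $ i * x $ i + x $ j * x $ j)"
      by algebra
    then show ?thesis
      unfolding norm_sq_eq_sum split
      using assms by (simp add: rotation_def)
  qed
  then show "\<forall>x. norm (rotation i j t x) = norm (x :: real^'n)"
    by (simp add: power2_eq_iff_nonneg)
qed

lemma rotation_0: "rotation i j 0 x = x"
  by (simp add: rotation_def vec_eq_iff)

text \<open>The angular momentum operator, which generates \<open>rotation i j\<close>. It
  differentiates along the sphere, whereas a single \<open>pd i\<close> does not.\<close>

definition rot_deriv :: "'n::finite \<Rightarrow> 'n \<Rightarrow> (real^'n \<Rightarrow> real) \<Rightarrow> real^'n \<Rightarrow> real" where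
  "rot_deriv i j f x = x $ i * pd j f x - x $ j * pd i f x"

lemma has_derivative_along_rotation:
  fixes f :: "real^'n \<Rightarrow> real"
  assumes "i \<noteq> j" "f differentiable at (rotation i j t x)"
  shows "((\<lambda>t. f (rotation i j t x)) has_real_derivative rot_deriv i j f (rotation i j t x)) (at t)"
proof -
  \<comment> \<open>The generator applied to the rotated point. This gives the derivative as
    \<open>rot_deriv\<close> at every \<open>t\<close>, as differentiation under the integral
    requires.\<close>
  let ?v = "\<chi> k. if k = i then - rotation i j t x $ j else if k = j then rotation i j t x $ i else 0"
  have "((\<lambda>t. rotation i j t x) has_derivative (\<lambda>h. h *\<^sub>R ?v)) (at t)"
  proof (subst has_derivative_componentwise_within, rule ballI)
    fix b :: "real^'n" assume "b \<in> Basis"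
    then obtain k where b: "b = axis k 1" by (auto simp: Basis_eq_axis)
    have D: "((\<lambda>t. cos t * x $ i - sin t * x $ j) has_real_derivative - (sin t * x $ i + cos t * x $ j)) (at t)"
      "((\<lambda>t. sin t * x $ i + cos t * x $ j) has_real_derivative cos t * x $ i - sin t * x $ j) (at t)"
      by (rule derivative_eq_intros refl | simp)+
    have "((\<lambda>t. rotation i j t x $ k) has_real_derivative ?v $ k) (at t)"
    proof (cases "k = i \<or> k = j")
      case True
      then show ?thesis using D assms(1) by (auto simp: rotation_def)
    qed (simp add: rotation_def)
    then have "((\<lambda>t. rotation i j t x $ k) has_derivative (\<lambda>h. h *\<^sub>R ?v $ k)) (at t)"
      unfolding has_field_derivative_def by (rule has_derivative_eq_rhs) (simp add: fun_eq_iff)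
    then show "((\<lambda>t. rotation i j t x \<bullet> b) has_derivative (\<lambda>h. (h *\<^sub>R ?v) \<bullet> b)) (at t)"
      by (simp only: b inner_axis vector_scaleR_component inner_real_def mult_1_right)
  qed
  from diff_chain_at[OF this has_derivative_pd[OF assms(2)]]
  have "((\<lambda>t. f (rotation i j t x)) has_real_derivative
      (\<Sum>k\<in>UNIV. ?v $ k * pd k f (rotation i j t x))) (at t)"
    by (simp add: o_def has_field_derivative_def mult.assoc mult_commute_abs flip: sum_distrib_left)
  moreover have "(\<Sum>k\<in>UNIV. ?v $ k * pd k f (rotation i j t x)) = rot_deriv i j f (rotation i j t x)"
  proof -
    have "(\<Sum>k\<in>UNIV. ?v $ k * pd k f (rotation i j t x)) =
      (\<Sum>k\<in>UNIV. (if k = i then - rotation i j t x $ j * pd i f (rotation i j t x) else 0)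
        + (if k = j then rotation i j t x $ i * pd j f (rotation i j t x) else 0))"
      by (intro sum.cong refl) (use assms(1) in auto)
    then show ?thesis by (simp add: sum.distrib rot_deriv_def)
  qed
  ultimately show ?thesis by simp
qed

lemma smooth_on_imp_continuous_on_sphere: "smooth_on (- {0}) f \<Longrightarrow> continuous_on usphere f"
  using smooth_on_continuous continuous_on_subset[of "- {0}" f usphere] by fastforce

lemma smooth_on_rot_deriv: "smooth_on (- {0}) f \<Longrightarrow> smooth_on (- {0}) (rot_deriv i j f)"
  unfolding rot_deriv_def[abs_def]
  by (intro smooth_on_diff smooth_on_mult smooth_on_pd smooth_on_coord open_punctured)

text \<open>The integral of \<open>f\<close> composed with a rotation is constant in the angle. One
  bound \<open>C\<close> dominates the derivatives for all angles because rotations preserve the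
  sphere.\<close>

lemma integral_rot_deriv_eq_0:
  fixes f :: "real^'n \<Rightarrow> real"
  assumes f: "smooth_on (- {0}) f"
  shows "(LINT p|sphere_measure. rot_deriv i j f p) = 0"
proof (cases "i = j")
  case False
  note orth = orthogonal_rotation[OF False]
  have norm_rot: "norm (rotation i j t p) = norm p" for t p
    using orth by (rule orthogonal_transformation_norm)
  have contf: "continuous_on usphere f" and conta: "continuous_on usphere (rot_deriv i j f)"
    using f smooth_on_rot_deriv smooth_on_imp_continuous_on_sphere by blast+
  have contr: "continuous_on A (rotation i j t)" for A t
    using orth by (intro linear_continuous_on linear_conv_bounded_linear[THEN iffD1] orthogonal_transformation_linear)
  have "bounded (rot_deriv i j f ` usphere)"
    by (intro compact_imp_bounded compact_continuous_image conta compact_sphere)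
  then obtain C where C: "\<And>x. x \<in> usphere \<Longrightarrow> norm (rot_deriv i j f x) \<le> C"
    unfolding bounded_iff by blast
  have "((\<lambda>t. LINT p|sphere_measure. f (rotation i j t p)) has_real_derivative
      (LINT p|sphere_measure. rot_deriv i j f (rotation i j 0 p))) (at 0)"
  proof (rule has_real_derivative_integral[where e = 1 and C = C])
    show "integrable sphere_measure (\<lambda>p. f (rotation i j s p))" for s
      by (intro integrable_sphere_measure continuous_on_compose2[OF contf contr]) (auto simp: norm_rot)
    show "(\<lambda>p. rot_deriv i j f (rotation i j 0 p)) \<in> borel_measurable sphere_measure"
      using borel_measurable_sphere_measure[OF conta] by (simp add: rotation_0)
    show "((\<lambda>s. f (rotation i j s p)) has_real_derivative rot_deriv i j f (rotation i j s p)) (at s)"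
      if "p \<in> space sphere_measure" for s p
    proof (rule has_derivative_along_rotation[OF False])
      have "rotation i j s p \<noteq> 0"
        using that norm_rot[of s p] by auto
      then show "f differentiable at (rotation i j s p)"
        using smooth_on_differentiable[OF open_punctured f] by simp
    qed
    show "\<bar>rot_deriv i j f (rotation i j s p)\<bar> \<le> C" if "p \<in> space sphere_measure" for s p
      using that C[of "rotation i j s p"] norm_rot[of s p] by simp
  qed (simp_all add: finite_sphere_measure)
  moreover have "(\<lambda>t. LINT p|sphere_measure. f (rotation i j t p)) = (\<lambda>t. LINT p|sphere_measure. f p)"
    using integral_sphere_orthogonal[OF orth contf] by simp
  ultimately show ?thesis
    using DERIV_unique[OF _ DERIV_const] by (simp add: rotation_0)
qed (simp add: rot_deriv_def)

text \<open>The \<open>i\<close>-th ambient component of the gradient along the sphere; meaningful only where \<open>norm x = 1\<close>.\<close>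

definition tangential_pd :: "'n::finite \<Rightarrow> (real^'n \<Rightarrow> real) \<Rightarrow> real^'n \<Rightarrow> real" where
  "tangential_pd i f x = pd i f x - x $ i * (\<Sum>j\<in>UNIV. x $ j * pd j f x)"

lemma smooth_on_tangential_pd: "smooth_on (- {0}) f \<Longrightarrow> smooth_on (- {0}) (tangential_pd i f)"
  unfolding tangential_pd_def[abs_def]
  by (intro smooth_on_diff smooth_on_mult smooth_on_sum smooth_on_pd smooth_on_coord open_punctured)

text \<open>Sum over \<open>j\<close> the vanishing integrals of \<open>rot_deriv j i\<close>
  applied to x_j f: on the unit sphere the integrands add up to \<open>tangential_pd i f\<close>
  minus \<open>CARD('n) - 1\<close> times x_i f. That factor is the mean curvature n of the
  sphere.\<close>

lemma integral_tangential_pd: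
  fixes f :: "real^'n \<Rightarrow> real"
  assumes f: "smooth_on (- {0}) f"
  shows "(LINT p|sphere_measure. tangential_pd i f p) = (real CARD('n) - 1) * (LINT p|sphere_measure. p $ i * f p)"
proof -
  have xf: "smooth_on (- {0}) (\<lambda>x. x $ k * f x)" for k
    by (intro smooth_on_mult smooth_on_coord f open_punctured)
  have c1: "continuous_on usphere (rot_deriv j i (\<lambda>x. x $ j * f x))" for j
    by (rule smooth_on_imp_continuous_on_sphere[OF smooth_on_rot_deriv[OF xf]])
  have c2: "continuous_on usphere (\<lambda>p. p $ i * f p)"
    by (rule smooth_on_imp_continuous_on_sphere[OF xf])
  have "tangential_pd i f p = (\<Sum>j\<in>UNIV. rot_deriv j i (\<lambda>x. x $ j * f x) p) + (real CARD('n) - 1) * (p $ i * f p)"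
    if "norm p = 1" for p
  proof -
    have "p \<noteq> 0" using that by auto
    then have D: "f differentiable at p"
      using smooth_on_differentiable[OF open_punctured f] by simp
    have p2: "(\<Sum>j\<in>UNIV. p $ j * p $ j) = 1"
      using norm_sq_eq_sum[of p] that by simp
    have "rot_deriv j i (\<lambda>x. x $ j * f x) p =
        (p $ j * p $ j) * pd i f p + (if j = i then p $ i * f p else 0)
        - p $ i * (p $ j * pd j f p) - p $ i * f p" for j
      unfolding rot_deriv_def pd_mult[OF differentiable_coord D] by (auto simp: algebra_simps)
    then have "(\<Sum>j\<in>UNIV. rot_deriv j i (\<lambda>x. x $ j * f x) p) =
        (\<Sum>j\<in>UNIV. p $ j * p $ j) * pd i f p + p $ i * f p
        - p $ i * (\<Sum>j\<in>UNIV. p $ j * pd j f p) - real CARD('n) * (p $ i * f p)"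
      by (simp add: sum.distrib sum_subtractf sum_distrib_left sum_distrib_right)
    then show ?thesis
      by (simp add: tangential_pd_def p2 algebra_simps)
  qed
  then have "(LINT p|sphere_measure. tangential_pd i f p) = (LINT p|sphere_measure.
      (\<Sum>j\<in>UNIV. rot_deriv j i (\<lambda>x. x $ j * f x) p) + (real CARD('n) - 1) * (p $ i * f p))"
    by (rule integral_sphere_cong)
  also have "\<dots> = (\<Sum>j\<in>UNIV. (LINT p|sphere_measure. rot_deriv j i (\<lambda>x. x $ j * f x) p))
      + (real CARD('n) - 1) * (LINT p|sphere_measure. p $ i * f p)"
    using c1 c2
    by (subst Bochner_Integration.integral_add)
      (auto intro!: integrable_sphere_measure Bochner_Integration.integrable_sum Bochner_Integration.integral_sum)
  finally show ?thesis
    by (simp add: integral_rot_deriv_eq_0[OF xf])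
qed

subsection \<open>Spherical harmonics and the spectral gap\<close>

definition sphere_inner :: "(real^'n \<Rightarrow> real) \<Rightarrow> (real^'n \<Rightarrow> real) \<Rightarrow> real" where
  "sphere_inner f g = (LINT p|sphere_measure. f p * g p)"

text \<open>Summing over ambient components gives the integral of the inner product of the
  tangential gradients without a frame of the tangent bundle.\<close>

definition dirichlet :: "(real^'n \<Rightarrow> real) \<Rightarrow> (real^'n \<Rightarrow> real) \<Rightarrow> real" where
  "dirichlet f g = (\<Sum>i\<in>UNIV. sphere_inner (tangential_pd i f) (tangential_pd i g))"

lemma sphere_inner_commute: "sphere_inner f g = sphere_inner g f"
  by (simp add: sphere_inner_def mult.commute)

lemma sphere_inner_cong: "(\<And>p. norm p = 1 \<Longrightarrow> f p = f' p) \<Longrightarrow> (\<And>p. norm p = 1 \<Longrightarrow> g p = g' p) \<Longrightarrow> sphere_inner f g = sphere_inner f' g'"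
  unfolding sphere_inner_def by (rule integral_sphere_cong) simp

lemma integrable_sphere_mult:
  "continuous_on usphere f \<Longrightarrow> continuous_on usphere g \<Longrightarrow> integrable sphere_measure (\<lambda>p::real^'n. f p * g p :: real)"
  by (intro integrable_sphere_measure continuous_on_mult)

lemma sphere_inner_add_right:
  "continuous_on usphere f \<Longrightarrow> continuous_on usphere g \<Longrightarrow> continuous_on usphere h \<Longrightarrow>
    sphere_inner f (\<lambda>p. g p + h p) = sphere_inner f g + sphere_inner f h"
  by (simp add: sphere_inner_def distrib_left integrable_sphere_mult)

lemma sphere_inner_cmult_right: "sphere_inner f (\<lambda>p. c * g p) = c * sphere_inner f g"
  by (simp add: sphere_inner_def mult.left_commute)

lemma sphere_inner_diff_right:
  "continuous_on usphere f \<Longrightarrow> continuous_on usphere g \<Longrightarrow> continuous_on usphere h \<Longrightarrow>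
    sphere_inner f (\<lambda>p. g p - h p) = sphere_inner f g - sphere_inner f h"
  by (simp add: sphere_inner_def right_diff_distrib integrable_sphere_mult)

lemma sphere_inner_sum_right:
  "continuous_on usphere f \<Longrightarrow> (\<And>k. k \<in> A \<Longrightarrow> continuous_on usphere (g k)) \<Longrightarrow>
    sphere_inner f (\<lambda>p. \<Sum>k\<in>A. g k p) = (\<Sum>k\<in>A. sphere_inner f (g k))"
  unfolding sphere_inner_def sum_distrib_left
  by (rule Bochner_Integration.integral_sum) (simp add: integrable_sphere_mult)

lemma sphere_inner_diff_diff:
  assumes "continuous_on usphere f" "continuous_on usphere g"
  shows "sphere_inner (\<lambda>p. f p - g p) (\<lambda>p. f p - g p) = sphere_inner f f - 2 * sphere_inner f g + sphere_inner g g"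
proof -
  have c: "continuous_on usphere (\<lambda>p. f p - g p)"
    using assms by (rule continuous_on_diff)
  show ?thesis
    unfolding sphere_inner_diff_right[OF c assms] sphere_inner_commute[of "\<lambda>p. f p - g p"]
      sphere_inner_diff_right[OF assms(1) assms] sphere_inner_diff_right[OF assms(2) assms]
    by (simp add: sphere_inner_commute[of g f])
qed

lemma sphere_inner_nonneg: "sphere_inner f f \<ge> 0"
  unfolding sphere_inner_def by (rule Bochner_Integration.integral_nonneg) simp

lemma tangential_pd_mult:
  assumes "f differentiable at x" "g differentiable at x"
  shows "tangential_pd i (\<lambda>x. f x * g x) x = f x * tangential_pd i g x + tangential_pd i f x * g x"
  by (simp add: tangential_pd_def pd_mult[OF assms] sum.distrib sum_distrib_left sum_distrib_right algebra_simps)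

lemma tangential_pd_cmult:
  assumes "f differentiable at x"
  shows "tangential_pd i (\<lambda>x. c * f x) x = c * tangential_pd i f x"
  by (simp add: tangential_pd_def pd_cmult[OF assms] sum_distrib_left algebra_simps)

lemma tangential_pd_diff:
  assumes "f differentiable at x" "g differentiable at x"
  shows "tangential_pd i (\<lambda>x. f x - g x) x = tangential_pd i f x - tangential_pd i g x"
  by (simp add: tangential_pd_def pd_diff[OF assms] sum_subtractf algebra_simps)

lemma tangential_pd_sum:
  assumes "\<And>k. k \<in> A \<Longrightarrow> f k differentiable at x"
  shows "tangential_pd i (\<lambda>x. \<Sum>k\<in>A. f k x) x = (\<Sum>k\<in>A. tangential_pd i (f k) x)"
  by (simp add: tangential_pd_def pd_sum[OF assms] sum_subtractf sum_distrib_left sum.swap[of _ A])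

text \<open>The vector of all \<open>tangential_pd i f\<close> is tangent, so in a pairing with it
  the radial part of an ambient gradient drops out.\<close>

lemma sum_coord_tangential_pd:
  assumes "norm x = 1"
  shows "(\<Sum>i\<in>UNIV. x $ i * tangential_pd i f x) = 0"
proof -
  have "(\<Sum>i\<in>UNIV. x $ i * tangential_pd i f x) =
      (\<Sum>i\<in>UNIV. x $ i * pd i f x) - (\<Sum>i\<in>UNIV. x $ i * x $ i) * (\<Sum>j\<in>UNIV. x $ j * pd j f x)"
    by (simp add: tangential_pd_def right_diff_distrib sum_subtractf sum_distrib_right mult.assoc)
  then show ?thesis
    using norm_sq_eq_sum[of x] assms by simp
qed

lemma dirichlet_commute: "dirichlet f g = dirichlet g f"
  by (simp add: dirichlet_def sphere_inner_commute)

lemma continuous_on_sphere_tangential_pd: "smooth_on (- {0}) f \<Longrightarrow> continuous_on usphere (tangential_pd i f)"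
  by (intro smooth_on_imp_continuous_on_sphere smooth_on_tangential_pd)

lemma dirichlet_sum_right:
  fixes f :: "real^'n \<Rightarrow> real"
  assumes "smooth_on (- {0}) f" "\<And>k. k \<in> A \<Longrightarrow> smooth_on (- {0}) (g k)"
  shows "dirichlet f (\<lambda>p. \<Sum>k\<in>A. c k * g k p) = (\<Sum>k\<in>A. c k * dirichlet f (g k))"
proof -
  have "sphere_inner (tangential_pd i f) (tangential_pd i (\<lambda>p. \<Sum>k\<in>A. c k * g k p)) = (\<Sum>k\<in>A. c k * sphere_inner (tangential_pd i f) (tangential_pd i (g k)))" for i
  proof -
    have "tangential_pd i (\<lambda>p. \<Sum>k\<in>A. c k * g k p) p = (\<Sum>k\<in>A. c k * tangential_pd i (g k) p)" if "norm p = 1" for p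
    proof -
      have "p \<noteq> 0" using that by auto
      then have D: "g k differentiable at p" if "k \<in> A" for k
        using smooth_on_differentiable[OF open_punctured assms(2)[OF that]] by simp
      then show ?thesis
        by (subst tangential_pd_sum) (auto simp: tangential_pd_cmult intro!: differentiable_mult)
    qed
    then have "sphere_inner (tangential_pd i f) (tangential_pd i (\<lambda>p. \<Sum>k\<in>A. c k * g k p)) = sphere_inner (tangential_pd i f) (\<lambda>p. \<Sum>k\<in>A. c k * tangential_pd i (g k) p)"
      by (intro sphere_inner_cong) auto
    also have "\<dots> = (\<Sum>k\<in>A. sphere_inner (tangential_pd i f) (\<lambda>p. c k * tangential_pd i (g k) p))"
      by (rule sphere_inner_sum_right) (auto intro!: continuous_on_sphere_tangential_pd assms continuous_on_mult continuous_on_const)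
    finally show ?thesis by (simp only: sphere_inner_cmult_right)
  qed
  then show ?thesis
    by (simp add: dirichlet_def sum_distrib_left sum.swap[of _ A])
qed

lemma dirichlet_diff_diff:
  fixes f g :: "real^'n \<Rightarrow> real"
  assumes "smooth_on (- {0}) f" "smooth_on (- {0}) g"
  shows "dirichlet (\<lambda>p. f p - g p) (\<lambda>p. f p - g p) = dirichlet f f - 2 * dirichlet f g + dirichlet g g"
proof -
  have "sphere_inner (tangential_pd i (\<lambda>p. f p - g p)) (tangential_pd i (\<lambda>p. f p - g p)) =
      sphere_inner (tangential_pd i f) (tangential_pd i f) - 2 * sphere_inner (tangential_pd i f) (tangential_pd i g) + sphere_inner (tangential_pd i g) (tangential_pd i g)" for i
  proof -
    have "tangential_pd i (\<lambda>p. f p - g p) p = tangential_pd i f p - tangential_pd i g p" if "norm p = 1" for p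
    proof -
      have "p \<in> - {0}" using that by auto
      then show ?thesis
        using smooth_on_differentiable[OF open_punctured] assms by (intro tangential_pd_diff) auto
    qed
    then have "sphere_inner (tangential_pd i (\<lambda>p. f p - g p)) (tangential_pd i (\<lambda>p. f p - g p)) =
        sphere_inner (\<lambda>p. tangential_pd i f p - tangential_pd i g p) (\<lambda>p. tangential_pd i f p - tangential_pd i g p)"
      by (intro sphere_inner_cong) auto
    then show ?thesis
      by (simp add: sphere_inner_diff_diff continuous_on_sphere_tangential_pd assms)
  qed
  then show ?thesis
    by (simp add: dirichlet_def sum.distrib sum_subtractf sum_distrib_left)
qed

section \<open>Solid harmonics: eigenvalues, low degrees, products with coordinates\<close>

definition laplacian :: "(real^'n \<Rightarrow> real) \<Rightarrow> real^'n \<Rightarrow> real" where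
  "laplacian f x = (\<Sum>i\<in>UNIV. pd i (pd i f) x)"

text \<open>These are the homogeneous harmonic polynomials, described analytically. Smoothness at
  the origin is what identifies degree 0 with the constants and degree 1 with the linear
  forms.\<close>

definition solid_harmonic :: "nat \<Rightarrow> (real^'n \<Rightarrow> real) \<Rightarrow> bool" where
  "solid_harmonic k h \<longleftrightarrow> smooth_on UNIV h \<and> (\<forall>t>0. \<forall>x. h (t *\<^sub>R x) = t ^ k * h x) \<and> (\<forall>x. x \<noteq> 0 \<longrightarrow> laplacian h x = 0)"

lemma solid_harmonic_smooth: "solid_harmonic k h \<Longrightarrow> smooth_on (- {0}) h"
  unfolding solid_harmonic_def using smooth_on_subset by blast

lemma solid_harmonic_continuous: "solid_harmonic k h \<Longrightarrow> continuous_on usphere h"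
  by (intro smooth_on_imp_continuous_on_sphere solid_harmonic_smooth)

lemma solid_harmonic_euler: "solid_harmonic k h \<Longrightarrow> euler (real k) h"
  by (intro homogeneous_imp_euler solid_harmonic_smooth) (auto simp: solid_harmonic_def)

text \<open>Weak form of the statement that \<open>h\<close> restricts to an eigenfunction of the Laplacian on the sphere.\<close>

lemma dirichlet_solid_harmonic:
  fixes f :: "real^'n \<Rightarrow> real"
  assumes f: "smooth_on (- {0}) f" and h: "solid_harmonic k h"
  shows "dirichlet f h = real k * (real k + real CARD('n) - 2) * sphere_inner f h"
proof -
  have sh: "smooth_on (- {0}) h" using h by (rule solid_harmonic_smooth)
  note eh = solid_harmonic_euler[OF h]
  have G: "smooth_on (- {0}) (\<lambda>x. f x * pd i h x)" for i
    by (intro smooth_on_mult f smooth_on_pd sh open_punctured)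
  \<comment> \<open>Integration by parts is applied to the field f grad h. Its tangential divergence
    is the pairing of the gradients minus k(k-1) f h, its radial component is k f h, and k(k-1) +
    k(\<open>CARD('n)\<close> - 1) is the eigenvalue.\<close>
  have pw: "(\<Sum>i\<in>UNIV. tangential_pd i (\<lambda>x. f x * pd i h x) p) =
      (\<Sum>i\<in>UNIV. tangential_pd i f p * tangential_pd i h p) - real k * (real k - 1) * (f p * h p)"
    and pw2: "(\<Sum>i\<in>UNIV. p $ i * (f p * pd i h p)) = real k * (f p * h p)" if "norm p = 1" for p
  proof -
    have p0: "p \<noteq> 0" using that by auto
    have D: "f differentiable at p" "pd i h differentiable at p" for i
      using smooth_on_differentiable[OF open_punctured] f smooth_on_pd[OF sh] p0 by auto
    have e: "(\<Sum>i\<in>UNIV. p $ i * pd i h p) = real k * h p"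
      using eh p0 by (simp add: euler_def)
    have e': "(\<Sum>j\<in>UNIV. p $ j * pd j (pd i h) p) = (real k - 1) * pd i h p" for i
      using euler_pd[OF sh eh, of i] p0 by (simp add: euler_def)
    have "(\<Sum>i\<in>UNIV. tangential_pd i (pd i h) p) = laplacian h p - (real k - 1) * (\<Sum>i\<in>UNIV. p $ i * pd i h p)"
      by (simp add: tangential_pd_def e' laplacian_def sum_subtractf sum.distrib sum_distrib_left algebra_simps)
    then have s1: "(\<Sum>i\<in>UNIV. tangential_pd i (pd i h) p) = - ((real k - 1) * (real k * h p))"
      using h p0 by (simp add: solid_harmonic_def e)
    have s2: "(\<Sum>i\<in>UNIV. tangential_pd i f p * pd i h p) = (\<Sum>i\<in>UNIV. tangential_pd i f p * tangential_pd i h p)"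
    proof -
      have "(\<Sum>i\<in>UNIV. tangential_pd i f p * pd i h p) =
          (\<Sum>i\<in>UNIV. tangential_pd i f p * tangential_pd i h p + (p $ i * tangential_pd i f p) * (real k * h p))"
        by (intro sum.cong refl) (simp add: tangential_pd_def[of _ h] e algebra_simps)
      then show ?thesis
        by (simp add: sum.distrib sum_coord_tangential_pd[OF that] flip: sum_distrib_right)
    qed
    have "(\<Sum>i\<in>UNIV. tangential_pd i (\<lambda>x. f x * pd i h x) p) =
        f p * (\<Sum>i\<in>UNIV. tangential_pd i (pd i h) p) + (\<Sum>i\<in>UNIV. tangential_pd i f p * pd i h p)"
      by (simp add: tangential_pd_mult D sum.distrib sum_distrib_left)
    then show "(\<Sum>i\<in>UNIV. tangential_pd i (\<lambda>x. f x * pd i h x) p) =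
      (\<Sum>i\<in>UNIV. tangential_pd i f p * tangential_pd i h p) - real k * (real k - 1) * (f p * h p)"
      unfolding s1 s2 by (simp add: algebra_simps)
    have "(\<Sum>i\<in>UNIV. p $ i * (f p * pd i h p)) = f p * (\<Sum>i\<in>UNIV. p $ i * pd i h p)"
      by (simp add: sum_distrib_left mult_ac)
    then show "(\<Sum>i\<in>UNIV. p $ i * (f p * pd i h p)) = real k * (f p * h p)"
      by (simp add: e)
  qed
  have cf: "continuous_on usphere f" "continuous_on usphere h"
    using f sh by (auto intro: smooth_on_imp_continuous_on_sphere)
  have ctg: "continuous_on usphere (tangential_pd i (\<lambda>x. f x * pd i h x))" for i
    by (rule continuous_on_sphere_tangential_pd[OF G])
  have cG: "continuous_on usphere (\<lambda>x. x $ i * (f x * pd i h x))" for i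
    by (rule smooth_on_imp_continuous_on_sphere) (intro smooth_on_mult smooth_on_coord G open_punctured)
  have "dirichlet f h = (LINT p|sphere_measure. (\<Sum>i\<in>UNIV. tangential_pd i f p * tangential_pd i h p))"
    unfolding dirichlet_def sphere_inner_def
    by (subst Bochner_Integration.integral_sum)
      (auto intro!: integrable_sphere_mult continuous_on_sphere_tangential_pd f sh)
  also have "\<dots> = (LINT p|sphere_measure. (\<Sum>i\<in>UNIV. tangential_pd i (\<lambda>x. f x * pd i h x) p)
      + real k * (real k - 1) * (f p * h p))"
    by (rule integral_sphere_cong) (simp add: pw)
  also have "\<dots> = (\<Sum>i\<in>UNIV. (LINT p|sphere_measure. tangential_pd i (\<lambda>x. f x * pd i h x) p))
      + real k * (real k - 1) * sphere_inner f h"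
    unfolding sphere_inner_def using ctg cf
    by (subst Bochner_Integration.integral_add)
      (auto intro!: integrable_sphere_measure continuous_on_mult Bochner_Integration.integrable_sum
        Bochner_Integration.integral_sum)
  also have "(\<Sum>i\<in>UNIV. (LINT p|sphere_measure. tangential_pd i (\<lambda>x. f x * pd i h x) p)) =
      (real CARD('n) - 1) * (\<Sum>i\<in>UNIV. (LINT p|sphere_measure. p $ i * (f p * pd i h p)))"
    by (simp add: integral_tangential_pd[OF G] sum_distrib_left)
  also have "(\<Sum>i\<in>UNIV. (LINT p|sphere_measure. p $ i * (f p * pd i h p))) =
      (LINT p|sphere_measure. (\<Sum>i\<in>UNIV. p $ i * (f p * pd i h p)))"
    by (subst Bochner_Integration.integral_sum) (auto intro!: integrable_sphere_measure cG)
  also have "\<dots> = (LINT p|sphere_measure. real k * (f p * h p))"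
    by (rule integral_sphere_cong) (rule pw2)
  also have "\<dots> = real k * sphere_inner f h"
    by (simp add: sphere_inner_def)
  finally show ?thesis by (simp add: algebra_simps)
qed

lemma laplacian_mult:
  fixes f g :: "real^'n \<Rightarrow> real"
  assumes f: "smooth_on (- {0}) f" and g: "smooth_on (- {0}) g" and x: "x \<noteq> 0"
  shows "laplacian (\<lambda>x. f x * g x) x = f x * laplacian g x + 2 * (\<Sum>j\<in>UNIV. pd j f x * pd j g x) + laplacian f x * g x"
proof -
  have D: "f differentiable at y" "g differentiable at y" "pd i f differentiable at y" "pd i g differentiable at y"
    if "y \<noteq> 0" for i y
    using smooth_on_differentiable[OF open_punctured] f g smooth_on_pd[OF f] smooth_on_pd[OF g] that by auto
  have "pd j (pd j (\<lambda>x. f x * g x)) x = f x * pd j (pd j g) x + 2 * (pd j f x * pd j g x) + pd j (pd j f) x * g x" for j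
  proof -
    have "pd j (pd j (\<lambda>x. f x * g x)) x = pd j (\<lambda>x. f x * pd j g x + pd j f x * g x) x"
      by (rule pd_cong[OF open_punctured]) (use x in \<open>auto simp: pd_mult D\<close>)
    also have "\<dots> = f x * pd j (pd j g) x + pd j f x * pd j g x + (pd j f x * pd j g x + pd j (pd j f) x * g x)"
      by (simp add: pd_add pd_mult D x differentiable_mult)
    finally show ?thesis by simp
  qed
  then show ?thesis
    by (simp add: laplacian_def sum.distrib sum_distrib_left sum_distrib_right)
qed

lemma laplacian_diff_cmult:
  fixes f g :: "real^'n \<Rightarrow> real"
  assumes f: "smooth_on (- {0}) f" and g: "smooth_on (- {0}) g" and x: "x \<noteq> 0"
  shows "laplacian (\<lambda>x. f x - c * g x) x = laplacian f x - c * laplacian g x"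
proof -
  have D: "f differentiable at y" "g differentiable at y" "pd i f differentiable at y" "pd i g differentiable at y"
    if "y \<noteq> 0" for i y
    using smooth_on_differentiable[OF open_punctured] f g smooth_on_pd[OF f] smooth_on_pd[OF g] that by auto
  have "pd j (pd j (\<lambda>x. f x - c * g x)) x = pd j (pd j f) x - c * pd j (pd j g) x" for j
  proof -
    have "pd j (pd j (\<lambda>x. f x - c * g x)) x = pd j (\<lambda>x. pd j f x - c * pd j g x) x"
      by (rule pd_cong[OF open_punctured]) (use x in \<open>auto simp: pd_diff pd_cmult D differentiable_mult\<close>)
    then show ?thesis
      by (simp add: pd_diff pd_cmult D x differentiable_mult)
  qed
  then show ?thesis
    by (simp add: laplacian_def sum_subtractf sum_distrib_left)
qed

lemma laplacian_pd:
  fixes f :: "real^'n \<Rightarrow> real"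
  assumes f: "smooth_on (- {0}) f" and x: "x \<noteq> 0"
  shows "laplacian (pd i f) x = pd i (laplacian f) x"
proof -
  have D: "pd j (pd k f) differentiable at x" for j k
    using smooth_on_differentiable[OF open_punctured smooth_on_pd[OF smooth_on_pd[OF f]]] x by auto
  have "pd j (pd j (pd i f)) x = pd i (pd j (pd j f)) x" for j
  proof -
    have "pd j (pd j (pd i f)) x = pd j (pd i (pd j f)) x"
      by (rule pd_cong[OF open_punctured]) (use x pd_commute[OF open_punctured f] in auto)
    also have "\<dots> = pd i (pd j (pd j f)) x"
      using pd_commute[OF open_punctured smooth_on_pd[OF f]] x by auto
    finally show ?thesis .
  qed
  then show ?thesis
    by (simp add: laplacian_def[abs_def] pd_sum D)
qed

lemma solid_harmonic_zero: "solid_harmonic k (\<lambda>_. 0)"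
  by (simp add: solid_harmonic_def laplacian_def pd_const[abs_def])

lemma solid_harmonic_one: "solid_harmonic 0 (\<lambda>_. 1)"
  by (simp add: solid_harmonic_def laplacian_def pd_const[abs_def])

lemma solid_harmonic_add:
  assumes "solid_harmonic k f" "solid_harmonic k g"
  shows "solid_harmonic k (\<lambda>x. f x + g x)"
proof -
  have "laplacian (\<lambda>x. f x - (-1) * g x) x = 0" if "x \<noteq> 0" for x
    using laplacian_diff_cmult[OF assms[THEN solid_harmonic_smooth] that, of "-1"] assms that by (simp add: solid_harmonic_def)
  then show ?thesis
    using assms by (simp add: solid_harmonic_def smooth_on_add distrib_left)
qed

lemma solid_harmonic_cmult:
  fixes h :: "real^'n \<Rightarrow> real"
  assumes "solid_harmonic k h"
  shows "solid_harmonic k (\<lambda>x. c * h x)"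
proof -
  have "laplacian (\<lambda>x. 0 - (- c) * h x) x = 0" if "x \<noteq> 0" for x
    using laplacian_diff_cmult[OF smooth_on_const solid_harmonic_smooth[OF assms] that, of 0 "- c"] assms that
    by (simp add: solid_harmonic_def laplacian_def pd_const[abs_def])
  then show ?thesis
    using assms by (simp add: solid_harmonic_def smooth_on_cmult)
qed

lemma filterlim_scaleR_at_right_0:
  fixes h :: "real^'n \<Rightarrow> real"
  assumes "smooth_on UNIV h"
  shows "((\<lambda>t. h (t *\<^sub>R x)) \<longlongrightarrow> h 0) (at_right 0)"
proof -
  have "isCont h (0 *\<^sub>R x)"
    using smooth_on_continuous[OF assms] by (simp add: continuous_on_eq_continuous_at)
  moreover have "((\<lambda>t. t *\<^sub>R x) \<longlongrightarrow> 0 *\<^sub>R x) (at_right 0)"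
    by (intro tendsto_intros)
  ultimately have "((\<lambda>t. h (t *\<^sub>R x)) \<longlongrightarrow> h (0 *\<^sub>R x)) (at_right 0)"
    by (rule isCont_tendsto_compose)
  then show ?thesis by simp
qed

text \<open>A function of degree 0 is constant along open rays, and all rays end at the origin,
  where it is continuous.\<close>

lemma solid_harmonic_0_const:
  fixes h :: "real^'n \<Rightarrow> real"
  assumes "solid_harmonic 0 h"
  shows "h x = h 0"
proof -
  have "((\<lambda>t. h x) \<longlongrightarrow> h 0) (at_right (0::real))"
    by (rule Lim_transform_eventually[OF filterlim_scaleR_at_right_0[of h x]])
      (use assms in \<open>auto simp: solid_harmonic_def eventually_at_right_less intro: eventually_at_rightI[of 0 1]\<close>)
  then show ?thesis
    by (simp add: tendsto_const_iff)
qed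

text \<open>The quotient of \<open>h\<close> at \<open>t\<close> times \<open>x\<close> by
  \<open>t\<close> equals \<open>h x\<close> for positive \<open>t\<close> and tends to the
  derivative at the origin in direction \<open>x\<close>. Hence orthogonality to the coordinates
  gives orthogonality to degree 1.\<close>

lemma solid_harmonic_1_linear:
  fixes h :: "real^'n \<Rightarrow> real"
  assumes "solid_harmonic 1 h"
  shows "h x = (\<Sum>i\<in>UNIV. pd i h 0 * x $ i)"
proof -
  have sm: "smooth_on UNIV h" and hom: "\<And>t. t > 0 \<Longrightarrow> h (t *\<^sub>R x) = t * h x"
    using assms by (auto simp: solid_harmonic_def)
  have ev: "\<forall>\<^sub>F t in at_right (0::real). h (t *\<^sub>R x) = t * h x"
    by (rule eventually_at_rightI[of 0 1]) (use hom in auto)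
  have "((\<lambda>t. t * h x) \<longlongrightarrow> h 0) (at_right (0::real))"
    by (rule Lim_transform_eventually[OF filterlim_scaleR_at_right_0[OF sm] ev])
  moreover have "((\<lambda>t. t * h x) \<longlongrightarrow> 0 * h x) (at_right (0::real))"
    by (intro tendsto_intros)
  ultimately have h0: "h 0 = 0"
    using tendsto_unique[of "at_right (0::real)"] by fastforce
  have lin: "((\<lambda>t. t *\<^sub>R x) has_derivative (\<lambda>s. s *\<^sub>R x)) (at 0)"
    by (auto intro!: derivative_eq_intros)
  have "(h has_derivative (\<lambda>v. \<Sum>i\<in>UNIV. v $ i * pd i h 0)) (at (0 *\<^sub>R x))"
    using smooth_on_differentiable[OF open_UNIV sm] by (simp add: has_derivative_pd)
  from diff_chain_at[OF lin this]
  have "((\<lambda>t. h (t *\<^sub>R x)) has_derivative (\<lambda>s. s * (\<Sum>i\<in>UNIV. pd i h 0 * x $ i))) (at 0)"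
    by (simp add: o_def mult_ac sum_distrib_left)
  then have "((\<lambda>t. h (t *\<^sub>R x)) has_real_derivative (\<Sum>i\<in>UNIV. pd i h 0 * x $ i)) (at 0)"
    by (simp add: has_field_derivative_def mult_commute_abs)
  then have "((\<lambda>t. h (t *\<^sub>R x) / t) \<longlongrightarrow> (\<Sum>i\<in>UNIV. pd i h 0 * x $ i)) (at 0)"
    by (simp add: DERIV_def h0)
  then have "((\<lambda>t. h (t *\<^sub>R x) / t) \<longlongrightarrow> (\<Sum>i\<in>UNIV. pd i h 0 * x $ i)) (at_right 0)"
    by (rule tendsto_within_subset) auto
  moreover have "((\<lambda>t. h (t *\<^sub>R x) / t) \<longlongrightarrow> h x) (at_right 0)"
    by (rule Lim_transform_eventually[OF tendsto_const])
      (rule eventually_at_rightI[of 0 1], use hom in auto)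
  ultimately show ?thesis
    using tendsto_unique[of "at_right (0::real)"] by fastforce
qed


text \<open>The Laplacian commutes with \<open>pd i\<close>, and differentiation lowers the degree.
  For \<open>k = 0\<close> the truncated degree \<open>k - 1\<close> is still correct, since the
  derivative of a constant is zero.\<close>

lemma solid_harmonic_pd:
  fixes h :: "real^'n \<Rightarrow> real"
  assumes h: "solid_harmonic k h"
  shows "solid_harmonic (k - 1) (pd i h)"
proof -
  have sm: "smooth_on UNIV h" using h by (simp add: solid_harmonic_def)
  have D: "h differentiable at x" for x
    using smooth_on_differentiable[OF open_UNIV sm] by simp
  have hom: "pd i h (t *\<^sub>R x) = t ^ (k - 1) * pd i h x" if "t > 0" for t x
  proof (cases k)
    case 0
    then have "h = (\<lambda>x. h 0)"
      using solid_harmonic_0_const[of h] h by auto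
    then have "pd i h y = 0" for y
      using pd_const[of i "h 0"] by metis
    then show ?thesis by simp
  next
    case (Suc l)
    have "t * pd i h (t *\<^sub>R x) = pd i (\<lambda>x. h (t *\<^sub>R x)) x"
      by (simp add: pd_scale D)
    also have "(\<lambda>x. h (t *\<^sub>R x)) = (\<lambda>x. t ^ k * h x)"
      using h that by (auto simp: solid_harmonic_def)
    also have "pd i (\<lambda>x. t ^ k * h x) x = t * (t ^ (k - 1) * pd i h x)"
      by (simp add: pd_cmult D Suc)
    finally show ?thesis using that by simp
  qed
  have "laplacian (pd i h) x = 0" if "x \<noteq> 0" for x
  proof -
    have "laplacian (pd i h) x = pd i (laplacian h) x"
      by (rule laplacian_pd[OF solid_harmonic_smooth[OF h] that])
    also have "\<dots> = pd i (\<lambda>_. 0) x"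
      by (rule pd_cong[OF open_punctured]) (use h that in \<open>auto simp: solid_harmonic_def\<close>)
    finally show ?thesis by simp
  qed
  then show ?thesis
    using hom smooth_on_pd[OF sm] by (auto simp: solid_harmonic_def)
qed

lemma pd_coord_abs: "pd i (\<lambda>x::real^'n. x $ j) = (\<lambda>_. if i = j then 1 else 0)"
  by (rule ext) simp

text \<open>The constant \<open>c\<close> in the proof makes \<open>x\<^sub>i h - c |x|\<^sup>2 \<partial>\<^sub>i h\<close> harmonic.\<close>

lemma coord_mult_solid_harmonic:
  fixes h :: "real^'n \<Rightarrow> real"
  assumes h: "solid_harmonic k h"
  shows "\<exists>g1 g2. solid_harmonic (k + 1) g1 \<and> solid_harmonic (k - 1) g2 \<and> (\<forall>x. norm x = 1 \<longrightarrow> x $ i * h x = g1 x + g2 x)"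
proof -
  define q where "q = (\<lambda>x::real^'n. \<Sum>j\<in>UNIV. x $ j * x $ j)"
  define c where "c = 1 / (real CARD('n) + 2 * real k - 2)"
  define g1 where "g1 = (\<lambda>x. x $ i * h x - c * (q x * pd i h x))"
  have sm: "smooth_on UNIV h" using h by (simp add: solid_harmonic_def)
  have sq: "smooth_on S q" if "open S" for S
    unfolding q_def by (intro smooth_on_sum smooth_on_mult smooth_on_coord that)
  have pq: "pd j q = (\<lambda>x. 2 * x $ j)" for j
  proof
    fix x :: "real^'n"
    have "pd j q x = (\<Sum>k\<in>UNIV. x $ k * (if j = k then 1 else 0) + (if j = k then 1 else 0) * x $ k)"
      unfolding q_def by (subst pd_sum) (auto simp: pd_mult intro!: differentiable_mult)
    also have "\<dots> = (\<Sum>k\<in>UNIV. if j = k then 2 * x $ k else 0)"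
      by (intro sum.cong) auto
    finally show "pd j q x = 2 * x $ j" by simp
  qed
  have lq: "laplacian q x = 2 * real CARD('n)" for x
    by (simp add: laplacian_def pq pd_cmult)
  have lx: "laplacian (\<lambda>x. x $ i) x = 0" for x :: "real^'n"
    by (simp add: laplacian_def pd_coord_abs)
  have hp: "solid_harmonic (k - 1) (pd i h)" using h by (rule solid_harmonic_pd)
  \<comment> \<open>For \<open>k = 0\<close> the degree \<open>k - 1\<close> is truncated, and the
    denominator of \<open>c\<close> is zero when \<open>CARD('n) = 2\<close>; both are harmless
    because the term with \<open>pd i h\<close> vanishes.\<close>
  have k0: "pd i h x = 0" if "k = 0" for x
  proof -
    have "h = (\<lambda>x. h 0)"
      using solid_harmonic_0_const[of h] h that by auto
    then show ?thesis using pd_const[of i "h 0"] by metis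
  qed
  have "solid_harmonic (k + 1) g1"
    unfolding solid_harmonic_def
  proof (intro conjI allI impI)
    show "smooth_on UNIV g1"
      unfolding g1_def
      by (intro smooth_on_diff smooth_on_cmult smooth_on_mult smooth_on_coord sq sm smooth_on_pd open_UNIV)
    show "g1 (t *\<^sub>R x) = t ^ (k + 1) * g1 x" if "t > 0" for t x
    proof -
      have "q (t *\<^sub>R x) = t\<^sup>2 * q x"
        by (simp add: q_def sum_distrib_left power2_eq_square mult_ac)
      moreover have "h (t *\<^sub>R x) = t ^ k * h x" "pd i h (t *\<^sub>R x) = t ^ (k - 1) * pd i h x"
        using h hp that by (auto simp: solid_harmonic_def)
      ultimately have g1t: "g1 (t *\<^sub>R x) = t * x $ i * (t ^ k * h x) - c * (t\<^sup>2 * q x * (t ^ (k - 1) * pd i h x))"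
        by (simp add: g1_def)
      have "t\<^sup>2 * (t ^ (k - 1) * pd i h x) = t ^ (k + 1) * pd i h x"
        using k0 by (cases k) (auto simp: power2_eq_square)
      then have E: "t\<^sup>2 * q x * (t ^ (k - 1) * pd i h x) = t ^ (k + 1) * (q x * pd i h x)"
        by (metis mult.assoc mult.left_commute)
      show ?thesis
        unfolding g1t E by (simp add: g1_def algebra_simps)
    qed
    show "laplacian g1 x = 0" if x: "x \<noteq> 0" for x
    proof -
      have "laplacian (\<lambda>x. x $ i * h x) x = 2 * (\<Sum>j\<in>UNIV. (if j = i then 1 else 0) * pd j h x)"
        using h x by (subst laplacian_mult[OF smooth_on_coord solid_harmonic_smooth[OF h] x]) (simp add: lx solid_harmonic_def)
      also have "(\<Sum>j\<in>UNIV. (if j = i then 1 else 0) * pd j h x) = pd i h x"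
        by (simp add: if_distrib[of "\<lambda>y. y * _"] cong: if_cong)
      finally have l1: "laplacian (\<lambda>x. x $ i * h x) x = 2 * pd i h x" .
      have "(\<Sum>j\<in>UNIV. x $ j * pd j (pd i h) x) = (real k - 1) * pd i h x"
        using euler_pd[OF solid_harmonic_smooth[OF h] solid_harmonic_euler[OF h], of i] x by (simp add: euler_def)
      then have "laplacian (\<lambda>x. q x * pd i h x) x = 2 * (2 * ((real k - 1) * pd i h x)) + 2 * real CARD('n) * pd i h x"
        using hp x
        by (subst laplacian_mult[OF sq[OF open_punctured] solid_harmonic_smooth[OF hp] x])
          (simp add: lq pq solid_harmonic_def mult.assoc flip: sum_distrib_left)
      then have l2: "laplacian (\<lambda>x. q x * pd i h x) x = 2 * (real CARD('n) + 2 * real k - 2) * pd i h x"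
        by (simp add: algebra_simps)
      have "laplacian g1 x = 2 * pd i h x - c * (2 * (real CARD('n) + 2 * real k - 2) * pd i h x)"
        unfolding g1_def l1[symmetric] l2[symmetric]
        by (rule laplacian_diff_cmult[OF _ _ x])
          (intro smooth_on_mult smooth_on_coord solid_harmonic_smooth[OF h] sq solid_harmonic_smooth[OF hp] open_punctured)+
      also have "\<dots> = 0"
      proof (cases "k = 0")
        case False
        have "real CARD('n) \<ge> 1" "real k \<ge> 1"
          using False by (auto simp: Suc_le_eq)
        then have "real CARD('n) + 2 * real k - 2 > 0" by linarith
        then show ?thesis by (simp add: c_def field_simps)
      qed (simp add: k0)
      finally show ?thesis .
    qed
  qed
  moreover have "x $ i * h x = g1 x + c * pd i h x" if "norm x = 1" for x
    using that norm_sq_eq_sum[of x] by (simp add: g1_def q_def)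
  ultimately show ?thesis
    using solid_harmonic_cmult[OF hp, of c] by blast
qed

section \<open>Polynomials restrict to finite sums of solid harmonics\<close>

definition harmonic_sum :: "(real^'n \<Rightarrow> real) \<Rightarrow> bool" where
  "harmonic_sum g \<longleftrightarrow> (\<exists>H K. (\<forall>k. solid_harmonic k (H k)) \<and> (\<forall>k\<ge>K. H k = (\<lambda>_. 0)) \<and>
     (\<forall>x. norm x = 1 \<longrightarrow> g x = (\<Sum>k<K. H k x)))"

text \<open>Two decompositions are added after both are brought to the longer range; for this
  \<open>harmonic_sum\<close> carries a full sequence that is zero from \<open>K\<close> on.\<close>

lemma sum_lessThan_extend:
  fixes H :: "nat \<Rightarrow> 'a \<Rightarrow> real"
  assumes "\<forall>k\<ge>K. H k = (\<lambda>_. 0)" "K \<le> L"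
  shows "(\<Sum>k<L. H k x) = (\<Sum>k<K. H k x)"
  by (rule sum.mono_neutral_right) (use assms in auto)

lemma harmonic_sum_cong: "harmonic_sum f \<Longrightarrow> (\<And>x. norm x = 1 \<Longrightarrow> f x = g x) \<Longrightarrow> harmonic_sum g"
  unfolding harmonic_sum_def by metis

lemma harmonic_sum_solid_harmonic:
  assumes "solid_harmonic k h"
  shows "harmonic_sum h"
  unfolding harmonic_sum_def
proof (intro exI conjI allI impI)
  let ?H = "\<lambda>j. if j = k then h else (\<lambda>_. 0)"
  show "solid_harmonic j (?H j)" for j
    by (cases "j = k") (simp_all add: assms solid_harmonic_zero)
  show "?H j = (\<lambda>_. 0)" if "Suc k \<le> j" for j
    using that by simp
  show "h x = (\<Sum>j<Suc k. ?H j x)" for x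
    by (simp add: if_distrib[of "\<lambda>f. f x"] cong: if_cong)
qed

lemma harmonic_sum_add:
  assumes "harmonic_sum f" "harmonic_sum g"
  shows "harmonic_sum (\<lambda>x. f x + g x)"
proof -
  obtain H K where H: "\<And>k. solid_harmonic k (H k)" "\<forall>k\<ge>K. H k = (\<lambda>_. 0)" "\<And>x. norm x = 1 \<Longrightarrow> f x = (\<Sum>k<K. H k x)"
    using assms(1) unfolding harmonic_sum_def by blast
  obtain H' K' where H': "\<And>k. solid_harmonic k (H' k)" "\<forall>k\<ge>K'. H' k = (\<lambda>_. 0)" "\<And>x. norm x = 1 \<Longrightarrow> g x = (\<Sum>k<K'. H' k x)"
    using assms(2) unfolding harmonic_sum_def by blast
  show ?thesis
    unfolding harmonic_sum_def
  proof (intro exI conjI allI impI)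
    show "solid_harmonic k (\<lambda>x. H k x + H' k x)" for k
      by (intro solid_harmonic_add H H')
    show "(\<lambda>x. H k x + H' k x) = (\<lambda>_. 0)" if "max K K' \<le> k" for k
      using that H(2) H'(2) by simp
    show "f x + g x = (\<Sum>k<max K K'. H k x + H' k x)" if "norm x = 1" for x
      using sum_lessThan_extend[OF H(2), of "max K K'" x] sum_lessThan_extend[OF H'(2), of "max K K'" x]
        H(3)[OF that] H'(3)[OF that] by (simp add: sum.distrib)
  qed
qed

lemma harmonic_sum_cmult:
  fixes f :: "real^'n \<Rightarrow> real"
  assumes "harmonic_sum f"
  shows "harmonic_sum (\<lambda>x. c * f x)"
proof -
  obtain H K where H: "\<And>k. solid_harmonic k (H k)" "\<forall>k\<ge>K. H k = (\<lambda>_. 0)" "\<And>x. norm x = 1 \<Longrightarrow> f x = (\<Sum>k<K. H k x)"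
    using assms unfolding harmonic_sum_def by blast
  show ?thesis
    unfolding harmonic_sum_def
  proof (intro exI conjI allI impI)
    show "solid_harmonic k (\<lambda>x. c * H k x)" for k
      by (intro solid_harmonic_cmult H)
    show "(\<lambda>x. c * H k x) = (\<lambda>_. 0)" if "K \<le> k" for k
      using that H(2) by simp
    show "c * f x = (\<Sum>k<K. c * H k x)" if "norm x = 1" for x
      using H(3)[OF that] by (simp add: sum_distrib_left)
  qed
qed

lemma harmonic_sum_sum:
  fixes f :: "'i \<Rightarrow> real^'n \<Rightarrow> real"
  assumes "\<And>i. i \<in> A \<Longrightarrow> harmonic_sum (f i)"
  shows "harmonic_sum (\<lambda>x. \<Sum>i\<in>A. f i x)"
  using assms
proof (induction A rule: infinite_finite_induct)
  case (insert a A)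
  then show ?case using harmonic_sum_add[of "f a" "\<lambda>x. \<Sum>i\<in>A. f i x"] by simp
qed (use harmonic_sum_solid_harmonic[OF solid_harmonic_zero] in auto)

lemma harmonic_sum_coord_mult:
  fixes f :: "real^'n \<Rightarrow> real"
  assumes "harmonic_sum f"
  shows "harmonic_sum (\<lambda>x. x $ i * f x)"
proof -
  obtain H K where H: "\<And>k. solid_harmonic k (H k)" "\<And>x. norm x = 1 \<Longrightarrow> f x = (\<Sum>k<K. H k x)"
    using assms unfolding harmonic_sum_def by blast
  have "harmonic_sum (\<lambda>x. x $ i * H k x)" for k
  proof -
    obtain g1 g2 where g: "solid_harmonic (k + 1) g1" "solid_harmonic (k - 1) g2" "\<And>x. norm x = 1 \<Longrightarrow> x $ i * H k x = g1 x + g2 x"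
      using coord_mult_solid_harmonic[OF H(1)[of k], of i] by blast
    show ?thesis
      by (rule harmonic_sum_cong[OF harmonic_sum_add[OF harmonic_sum_solid_harmonic[OF g(1)] harmonic_sum_solid_harmonic[OF g(2)]]])
        (simp add: g(3))
  qed
  then have "harmonic_sum (\<lambda>x. \<Sum>k<K. x $ i * H k x)"
    by (intro harmonic_sum_sum)
  then show ?thesis
    by (rule harmonic_sum_cong) (simp add: H(2) sum_distrib_left)
qed

lemma harmonic_sum_real_polynomial_mult:
  fixes p g :: "real^'n \<Rightarrow> real"
  assumes "real_polynomial_function p" "harmonic_sum g"
  shows "harmonic_sum (\<lambda>x. p x * g x)"
  using assms
proof (induction p arbitrary: g rule: real_polynomial_function.induct)
  case (linear f)
  have fx: "f x = (\<Sum>i\<in>UNIV. f (axis i 1) * x $ i)" for x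
  proof -
    have "f x = f (\<Sum>i\<in>UNIV. x $ i *\<^sub>R axis i 1)"
      using basis_expansion[of x] by (simp add: scalar_mult_eq_scaleR)
    also have "\<dots> = (\<Sum>i\<in>UNIV. x $ i *\<^sub>R f (axis i 1))"
      using linear(1) by (simp add: linear_sum linear_scale bounded_linear.linear)
    finally show ?thesis by (simp add: mult.commute)
  qed
  have "harmonic_sum (\<lambda>x. \<Sum>i\<in>UNIV. f (axis i 1) * (x $ i * g x))"
    by (intro harmonic_sum_sum harmonic_sum_cmult harmonic_sum_coord_mult linear)
  then show ?case
  proof (rule harmonic_sum_cong)
    show "(\<Sum>i\<in>UNIV. f (axis i 1) * (x $ i * g x)) = f x * g x" for x
      unfolding fx[of x] sum_distrib_right mult.assoc ..
  qed
next
  case (const c)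
  then show ?case by (rule harmonic_sum_cmult)
next
  case (add f1 f2)
  then show ?case by (simp add: distrib_right harmonic_sum_add)
next
  case (mult f1 f2)
  then show ?case using mult.IH(1)[OF mult.IH(2)[OF mult.prems]] by (simp add: mult.assoc)
qed

lemma harmonic_sum_real_polynomial: "real_polynomial_function p \<Longrightarrow> harmonic_sum p" for p :: "real^'n \<Rightarrow> real"
  using harmonic_sum_real_polynomial_mult[OF _ harmonic_sum_solid_harmonic[OF solid_harmonic_one], of p] by simp

text \<open>The Dirichlet form is symmetric and the eigenvalues differ. From
  \<open>CARD('n) \<ge> 2\<close> they are strictly increasing in the degree; on the two-point
  sphere degrees 0 and 1 would share the eigenvalue 0.\<close>

lemma sphere_inner_harm_orthogonal:
  fixes g h :: "real^'n \<Rightarrow> real"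
  assumes N: "CARD('n) \<ge> 2" and g: "solid_harmonic j g" and h: "solid_harmonic k h" and "j \<noteq> k"
  shows "sphere_inner g h = 0"
proof -
  let ?\<mu> = "\<lambda>k. real k * (real k + real CARD('n) - 2)"
  have mono: "?\<mu> a < ?\<mu> b" if "a < b" for a b :: nat
    using that N by (intro mult_strict_mono') auto
  have "?\<mu> k * sphere_inner g h = ?\<mu> j * sphere_inner g h"
    using dirichlet_solid_harmonic[OF solid_harmonic_smooth[OF g] h]
      dirichlet_solid_harmonic[OF solid_harmonic_smooth[OF h] g]
      dirichlet_commute[of g h] sphere_inner_commute[of g h] by metis
  moreover have "?\<mu> k \<noteq> ?\<mu> j"
    using mono[of j k] mono[of k j] \<open>j \<noteq> k\<close> by (metis less_irrefl nat_neq_iff)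
  ultimately show ?thesis by simp
qed

theorem spectral_gap:
  fixes f :: "real^'n \<Rightarrow> real"
  assumes N: "CARD('n) \<ge> 2" and f: "smooth_on (- {0}) f"
    and f0: "(LINT p|sphere_measure. f p) = 0" and f1: "\<And>i. (LINT p|sphere_measure. f p * p $ i) = 0"
  shows "dirichlet f f \<ge> 2 * real CARD('n) * sphere_inner f f"
proof -
  let ?L = "2 * real CARD('n)" and ?\<mu> = "\<lambda>k. real k * (real k + real CARD('n) - 2)"
  let ?\<omega> = "measure sphere_measure (usphere :: (real^'n) set)"
  interpret finite_measure "sphere_measure :: (real^'n) measure"
    by (rule finite_sphere_measure)
  \<comment> \<open>Equality holds for \<open>k = 2\<close>, and both factors grow with
    \<open>k\<close>.\<close>
  have \<mu>: "?\<mu> k \<ge> ?L" if "k \<ge> 2" for k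
  proof -
    have "2 * real CARD('n) \<le> real k * (real k + real CARD('n) - 2)"
      using that N by (intro mult_mono) auto
    then show ?thesis .
  qed
  have L0: "?L > 0" using N by simp
  have cancel: "a / m * (m * s) = a * s" if "m > 0" for a m s :: real
    using that by simp
  have cf: "continuous_on usphere f"
    using f by (rule smooth_on_imp_continuous_on_sphere)
  have approx: "dirichlet f f \<ge> ?L * (sphere_inner f f - e\<^sup>2 * ?\<omega>)" if e: "e > 0" for e
  proof -
    obtain p where p: "real_polynomial_function p" "\<And>x. x \<in> usphere \<Longrightarrow> \<bar>f x - p x\<bar> < e"
      using Stone_Weierstrass_real_polynomial_function[OF compact_sphere cf e] by blast
    obtain H K0 where H: "\<And>k. solid_harmonic k (H k)" "\<forall>k\<ge>K0. H k = (\<lambda>_. 0)"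
      and pH0: "\<And>x. norm x = 1 \<Longrightarrow> p x = (\<Sum>k<K0. H k x)"
      using harmonic_sum_real_polynomial[OF p(1)] unfolding harmonic_sum_def by blast
    \<comment> \<open>Two more indices guarantee that 0 and 1 lie below \<open>K\<close>, even if
      \<open>K0\<close> is 0, so that \<open>Q\<close> can be split off.\<close>
    define K where "K = Suc (Suc K0)"
    define A where "A = {2..<K}"
    define P where "P = (\<lambda>x. \<Sum>k\<in>A. H k x)"
    define Q where "Q = (\<lambda>x. H 0 x + H 1 x)"
    \<comment> \<open>In the pairing with \<open>f\<close> the denominators cancel against
      \<open>dirichlet_solid_harmonic\<close>; in the energy of \<open>\<phi>\<close> one
      denominator cancels and the other weight is estimated by 1.\<close>
    define \<phi> where "\<phi> = (\<lambda>x. \<Sum>k\<in>A. (?L / ?\<mu> k) * H k x)"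
    have pPQ: "p x = P x + Q x" if "norm x = 1" for x
    proof -
      have "p x = (\<Sum>k<K. H k x)"
        using pH0[OF that] sum_lessThan_extend[OF H(2), of K x] by (simp add: K_def)
      also have "{..<K} = insert 0 (insert 1 A)"
        by (auto simp: K_def A_def)
      finally show ?thesis by (simp add: A_def P_def Q_def)
    qed
    have sH: "smooth_on (- {0}) (H k)" and cH: "continuous_on usphere (H k)" for k
      using H(1) solid_harmonic_smooth solid_harmonic_continuous by blast+
    have c\<phi>: "smooth_on (- {0}) \<phi>"
      unfolding \<phi>_def by (intro smooth_on_sum smooth_on_cmult sH open_punctured)
    have cP: "continuous_on usphere P" and cQ: "continuous_on usphere Q"
      unfolding P_def Q_def by (intro continuous_on_sum continuous_on_add cH)+
    have fP: "sphere_inner f P = (\<Sum>k\<in>A. sphere_inner f (H k))"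
      unfolding P_def by (intro sphere_inner_sum_right cf cH)
    have PP: "sphere_inner P P = (\<Sum>k\<in>A. sphere_inner (H k) (H k))"
    proof -
      have "sphere_inner P P = (\<Sum>k\<in>A. sphere_inner P (H k))"
        by (subst (2) P_def) (intro sphere_inner_sum_right cP cH)
      also have "\<dots> = (\<Sum>k\<in>A. sphere_inner (H k) (H k))"
      proof (intro sum.cong refl)
        fix k assume k: "k \<in> A"
        have "sphere_inner P (H k) = (\<Sum>j\<in>A. sphere_inner (H k) (H j))"
          by (subst sphere_inner_commute, unfold P_def, intro sphere_inner_sum_right cH)
        also have "\<dots> = (\<Sum>j\<in>A. if j = k then sphere_inner (H k) (H k) else 0)"
          by (intro sum.cong refl) (auto simp: sphere_inner_harm_orthogonal[OF N H(1) H(1)])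
        finally show "sphere_inner P (H k) = sphere_inner (H k) (H k)"
          using k by (simp add: A_def)
      qed
      finally show ?thesis .
    qed
    have "dirichlet f \<phi> = (\<Sum>k\<in>A. (?L / ?\<mu> k) * (?\<mu> k * sphere_inner f (H k)))"
      unfolding \<phi>_def by (subst dirichlet_sum_right[OF f sH]) (simp only: dirichlet_solid_harmonic[OF f H(1)])
    also have "\<dots> = ?L * sphere_inner f P"
      unfolding fP sum_distrib_left
    proof (intro sum.cong refl)
      fix k assume "k \<in> A"
      then have "?\<mu> k > 0" using \<mu>[of k] less_le_trans[OF L0 \<mu>[of k]] by (auto simp: A_def)
      then show "?L / ?\<mu> k * (?\<mu> k * sphere_inner f (H k)) = ?L * sphere_inner f (H k)" by (rule cancel)
    qed
    finally have f\<phi>: "dirichlet f \<phi> = ?L * sphere_inner f P" .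
    have "dirichlet \<phi> \<phi> = (\<Sum>k\<in>A. (?L / ?\<mu> k) * dirichlet \<phi> (H k))"
      by (subst (2) \<phi>_def) (rule dirichlet_sum_right[OF c\<phi> sH])
    also have "\<dots> \<le> (\<Sum>k\<in>A. ?L * sphere_inner (H k) (H k))"
    proof (rule sum_mono)
      fix k assume k: "k \<in> A"
      then have \<mu>k: "?\<mu> k \<ge> ?L" "?\<mu> k > 0" using \<mu>[of k] less_le_trans[OF L0 \<mu>[of k]] by (auto simp: A_def)
      have "sphere_inner \<phi> (H k) = (\<Sum>j\<in>A. (?L / ?\<mu> j) * sphere_inner (H k) (H j))"
        unfolding sphere_inner_cmult_right[symmetric]
        by (subst sphere_inner_commute, unfold \<phi>_def, intro sphere_inner_sum_right cH continuous_on_mult continuous_on_const)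
      also have "\<dots> = (\<Sum>j\<in>A. if j = k then (?L / ?\<mu> k) * sphere_inner (H k) (H k) else 0)"
        by (intro sum.cong refl) (auto simp: sphere_inner_harm_orthogonal[OF N H(1) H(1)])
      also have "\<dots> = (?L / ?\<mu> k) * sphere_inner (H k) (H k)"
        using k by (simp add: A_def)
      finally have s: "sphere_inner \<phi> (H k) = (?L / ?\<mu> k) * sphere_inner (H k) (H k)" .
      have "(?L / ?\<mu> k) * dirichlet \<phi> (H k) = ?L * ((?L / ?\<mu> k) * sphere_inner (H k) (H k))"
        unfolding dirichlet_solid_harmonic[OF c\<phi> H(1)] s by (simp only: cancel[OF \<mu>k(2)])
      also have "\<dots> \<le> ?L * (1 * sphere_inner (H k) (H k))"
        using L0 divide_le_eq_1_pos[OF \<mu>k(2), THEN iffD2, OF \<mu>k(1)]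
        by (intro mult_left_mono mult_right_mono sphere_inner_nonneg) simp_all
      finally show "(?L / ?\<mu> k) * dirichlet \<phi> (H k) \<le> ?L * sphere_inner (H k) (H k)" by simp
    qed
    also have "\<dots> = ?L * sphere_inner P P"
      by (simp add: PP sum_distrib_left)
    finally have \<phi>\<phi>: "dirichlet \<phi> \<phi> \<le> ?L * sphere_inner P P" .
    have "0 \<le> dirichlet (\<lambda>x. f x - \<phi> x) (\<lambda>x. f x - \<phi> x)"
      unfolding dirichlet_def by (intro sum_nonneg sphere_inner_nonneg)
    \<comment> \<open>The bracket is the squared norm of \<open>f\<close> minus the squared norm of
      \<open>f - P\<close>, so only the L2 distance from \<open>f\<close> to \<open>P\<close>
      remains to be bounded.\<close>
    then have main: "dirichlet f f \<ge> ?L * (2 * sphere_inner f P - sphere_inner P P)"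
      using \<phi>\<phi> unfolding dirichlet_diff_diff[OF f c\<phi>] f\<phi> by (simp add: algebra_simps)
    have fH0: "sphere_inner f (H 0) = 0"
    proof -
      have "sphere_inner f (H 0) = (LINT p|sphere_measure. f p * H 0 0)"
        unfolding sphere_inner_def using solid_harmonic_0_const[OF H(1)] by metis
      then show ?thesis using f0 by simp
    qed
    have fH1: "sphere_inner f (H 1) = 0"
    proof -
      have "sphere_inner f (H 1) = sphere_inner f (\<lambda>x. \<Sum>i\<in>UNIV. pd i (H 1) 0 * x $ i)"
        using solid_harmonic_1_linear[OF H(1)[of 1]] by (intro sphere_inner_cong) auto
      also have "\<dots> = (\<Sum>i\<in>UNIV. pd i (H 1) 0 * sphere_inner f (\<lambda>x. x $ i))"
        by (subst sphere_inner_sum_right) (auto intro!: cf continuous_intros simp: sphere_inner_cmult_right)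
      also have "\<dots> = 0"
        using f1 by (simp add: sphere_inner_def)
      finally show ?thesis .
    qed
    have PH: "sphere_inner P (H j) = 0" if "j < 2" for j
    proof -
      have "sphere_inner P (H j) = (\<Sum>k\<in>A. sphere_inner (H j) (H k))"
        by (subst sphere_inner_commute, unfold P_def, intro sphere_inner_sum_right cH)
      also have "\<dots> = 0"
        by (intro sum.neutral) (use that in \<open>auto simp: A_def intro!: sphere_inner_harm_orthogonal[OF N H(1) H(1)]\<close>)
      finally show ?thesis .
    qed
    have "sphere_inner f Q = 0" "sphere_inner P Q = 0"
      unfolding Q_def using fH0 fH1 PH
      by (simp_all add: sphere_inner_add_right[OF cf cH cH] sphere_inner_add_right[OF cP cH cH])
    then have fmP: "sphere_inner (\<lambda>x. f x - P x) Q = 0"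
      unfolding sphere_inner_commute[of _ Q] sphere_inner_diff_right[OF cQ cf cP] by (simp add: sphere_inner_commute[of Q])
    have cfP: "continuous_on usphere (\<lambda>x. f x - P x)"
      by (intro continuous_on_diff cf cP)
    \<comment> \<open>Both \<open>f\<close> and \<open>P\<close> are orthogonal to the low degrees
      collected in \<open>Q\<close>, so subtracting \<open>Q\<close> can only increase the norm of
      \<open>f - P\<close>. It produces \<open>f - p\<close>, which is uniformly smaller than
      \<open>e\<close>.\<close>
    have "sphere_inner (\<lambda>x. f x - P x) (\<lambda>x. f x - P x) \<le>
        sphere_inner (\<lambda>x. (f x - P x) - Q x) (\<lambda>x. (f x - P x) - Q x)"
      unfolding sphere_inner_diff_diff[OF cfP cQ] fmP using sphere_inner_nonneg[of Q] by simp
    also have "\<dots> \<le> (LINT p::real^'n|sphere_measure. e\<^sup>2)"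
      unfolding sphere_inner_def
    proof (rule integral_mono)
      show "integrable sphere_measure (\<lambda>x. (f x - P x - Q x) * (f x - P x - Q x))"
        by (intro integrable_sphere_mult continuous_on_diff cfP cQ)
      fix x :: "real^'n" assume x: "x \<in> space sphere_measure"
      then have "\<bar>f x - P x - Q x\<bar> \<le> e"
        using p(2)[of x] pPQ[of x] by simp
      then show "(f x - P x - Q x) * (f x - P x - Q x) \<le> e\<^sup>2"
        unfolding power2_eq_square[symmetric] using e by (intro abs_le_square_iff[THEN iffD1]) simp
    qed simp
    also have "\<dots> = e\<^sup>2 * ?\<omega>"
      by simp
    finally have "sphere_inner f f - 2 * sphere_inner f P + sphere_inner P P \<le> e\<^sup>2 * ?\<omega>"
      unfolding sphere_inner_diff_diff[OF cf cP] .
    then have "?L * (sphere_inner f f - e\<^sup>2 * ?\<omega>) \<le> ?L * (2 * sphere_inner f P - sphere_inner P P)"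
      using L0 by (intro mult_left_mono) auto
    with main show ?thesis by linarith
  qed
  have "((\<lambda>e. ?L * (sphere_inner f f - e\<^sup>2 * ?\<omega>)) \<longlongrightarrow> ?L * (sphere_inner f f - 0\<^sup>2 * ?\<omega>)) (at_right 0)"
    by (intro tendsto_intros)
  then have "?L * (sphere_inner f f - 0\<^sup>2 * ?\<omega>) \<le> dirichlet f f"
    by (rule tendsto_upperbound)
      (auto intro!: eventually_at_rightI[of 0 1] approx)
  then show ?thesis by simp
qed

subsection \<open>The second variation\<close>

lemma smooth_on_sphere_affine:
  fixes \<eta> :: "real^'n \<Rightarrow> real"
  assumes "smooth_on_sphere \<eta>"
  shows "smooth_on_sphere (\<lambda>p. 1 + s * \<eta> p)"
  unfolding smooth_on_sphere_def
proof
  fix p :: "real^'n" assume "p \<in> sphere 0 1"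
  then obtain U F where U: "open U" "p \<in> U" "\<And>k. Ck_on k U F" "\<And>x. x \<in> U \<inter> sphere 0 1 \<Longrightarrow> F x = \<eta> x"
    using assms unfolding smooth_on_sphere_def by metis
  have "Ck_on k U (\<lambda>x. 1 + s * F x)" for k
    by (rule Ck_on_add[OF U(1) Ck_on_const Ck_on_mult[OF U(1) Ck_on_const U(3)]])
  then show "\<exists>U F. open U \<and> p \<in> U \<and> (\<forall>k. Ck_on k U F) \<and> (\<forall>x\<in>U \<inter> sphere 0 1. F x = 1 + s * \<eta> x)"
    using U by (intro exI[of _ U] exI[of _ "\<lambda>x. 1 + s * F x"]) simp
qed

lemma smooth_on_sphere_const: "smooth_on_sphere (\<lambda>_::real^'n. c)"
  unfolding smooth_on_sphere_def by (intro ballI exI[of _ UNIV] exI[of _ "\<lambda>_. c"]) auto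

lemma hessian_matrix_cone_ext_affine:
  fixes \<eta> :: "real^'n \<Rightarrow> real"
  assumes \<eta>: "smooth_on_sphere \<eta>" and p: "norm p = 1"
  shows "hessian_matrix (cone_ext (\<lambda>p. 1 + s * \<eta> p)) p $ i $ j =
    (if i = j then 1 else 0) - p $ i * p $ j + s * hessian_matrix (cone_ext \<eta>) p $ i $ j"
proof -
  have p0: "p \<noteq> 0" using p by auto
  let ?U = "cone_ext \<eta>"
  have D: "norm differentiable at x" "pd i norm differentiable at x"
    "?U differentiable at x" "pd i ?U differentiable at x" if "x \<noteq> 0" for i and x :: "real^'n"
    using smooth_on_differentiable[OF open_punctured] smooth_on_norm smooth_cone_ext[OF \<eta>]
      smooth_on_pd[OF smooth_cone_ext[OF \<eta>]] smooth_on_pd[OF smooth_on_norm] that by auto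
  have eq: "cone_ext (\<lambda>p. 1 + s * \<eta> p) = (\<lambda>x. norm x + s * ?U x)"
    by (simp add: fun_eq_iff cone_ext_def radial_ext_def algebra_simps)
  have "pd i (pd j (\<lambda>x. norm x + s * ?U x)) p = pd i (\<lambda>x. pd j norm x + s * pd j ?U x) p"
    by (rule pd_cong[OF open_punctured]) (use p0 in \<open>auto simp: pd_add pd_cmult D differentiable_mult\<close>)
  also have "\<dots> = pd i (pd j norm) p + s * pd i (pd j ?U) p"
    by (simp add: pd_add pd_cmult D p0 differentiable_mult)
  finally show ?thesis
    by (simp add: hessian_matrix_def eq pd_pd_norm p)
qed

text \<open>The Hessian of |x| contributes the tangential projection, which acts as the identity on
  \<open>v\<close> and is replaced by \<open>mat 1\<close>. With this choice the matrix fixes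
  \<open>p\<close>, as \<open>det_on_tangent_space\<close> demands.\<close>

lemma A_endo_affine:
  fixes \<eta> :: "real^'n \<Rightarrow> real"
  assumes \<eta>: "smooth_on_sphere \<eta>" and p: "norm p = 1" and v: "v \<in> tangent_space p"
  shows "A_endo (\<lambda>p. 1 + s * \<eta> p) p v = (mat 1 + s *\<^sub>R hessian_matrix (cone_ext \<eta>) p) *v v"
proof -
  have vp: "(\<Sum>j\<in>UNIV. p $ j * v $ j) = 0"
    using v by (simp add: tangent_space_def inner_vec_def mult.commute)
  let ?B = "hessian_matrix (cone_ext \<eta>) p"
  have "(hessian_matrix (cone_ext (\<lambda>p. 1 + s * \<eta> p)) p *v v) $ i = ((mat 1 + s *\<^sub>R ?B) *v v) $ i" for i
  proof -
    have "(hessian_matrix (cone_ext (\<lambda>p. 1 + s * \<eta> p)) p *v v) $ i =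
        (\<Sum>j\<in>UNIV. ((mat 1 + s *\<^sub>R ?B) $ i $ j) * v $ j - p $ i * (p $ j * v $ j))"
      unfolding matrix_vector_mult_def
      by (simp add: hessian_matrix_cone_ext_affine[OF \<eta> p] mat_def)
        (intro sum.cong refl, simp add: algebra_simps)
    also have "\<dots> = (\<Sum>j\<in>UNIV. ((mat 1 + s *\<^sub>R ?B) $ i $ j) * v $ j) - p $ i * (\<Sum>j\<in>UNIV. p $ j * v $ j)"
      unfolding sum_subtractf sum_distrib_left ..
    finally show ?thesis
      unfolding vp by (simp add: matrix_vector_mult_def)
  qed
  then show ?thesis
    unfolding A_endo_eq_hessian_matrix[OF smooth_on_sphere_affine[OF \<eta>] p v] by (simp add: vec_eq_iff)
qed

lemma det_A_affine:
  fixes \<eta> :: "real^'n \<Rightarrow> real"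
  assumes \<eta>: "smooth_on_sphere \<eta>" and p: "norm p = 1"
  shows "det_A (\<lambda>p. 1 + s * \<eta> p) p = poly (det_pencil (hessian_matrix (cone_ext \<eta>) p)) s"
  unfolding det_A_def poly_det_pencil
proof (rule det_on_tangent_space[OF p A_endo_affine[OF \<eta> p]])
  let ?B = "hessian_matrix (cone_ext \<eta>) p"
  have p0: "p \<noteq> 0" using p by auto
  show "(mat 1 + s *\<^sub>R ?B) *v p = p"
    using hessian_matrix_cone_ext_radial[OF \<eta> p0]
    by (simp add: matrix_vector_mult_add_rdistrib scaleR_matrix_vector_assoc[symmetric])
  show "transpose (mat 1 + s *\<^sub>R ?B) = mat 1 + s *\<^sub>R ?B"
    using hessian_matrix_symmetric[OF smooth_cone_ext[OF \<eta>] p0]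
    by (simp add: vec_eq_iff transpose_def mat_def)
qed

lemma soliton_1: "soliton (\<lambda>_::real^'n. 1)"
proof -
  have "det_A (\<lambda>_::real^'n. 1) p = 1" if "norm p = 1" for p
    \<comment> \<open>The constant 1 is 1 + 0 * 0, so its determinant is that of the identity
      matrix.\<close>
    using det_A_affine[OF smooth_on_sphere_const[of 0] that, of 0] by (simp add: poly_det_pencil)
  then show ?thesis
    by (simp add: soliton_def smooth_on_sphere_const)
qed

lemma sphere_bound:
  fixes f :: "real^'n \<Rightarrow> real"
  assumes "continuous_on usphere f"
  obtains C where "C > 0" "\<And>p. norm p = 1 \<Longrightarrow> \<bar>f p\<bar> \<le> C"
proof -
  have "bounded (f ` usphere)"
    by (intro compact_imp_bounded compact_continuous_image assms compact_sphere)
  then obtain C where "C > 0" "\<And>x. x \<in> usphere \<Longrightarrow> norm (f x) \<le> C"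
    unfolding bounded_pos by blast
  then show thesis using that by simp
qed

lemma smooth_on_sphere_continuous:
  fixes \<eta> :: "real^'n \<Rightarrow> real"
  assumes "smooth_on_sphere \<eta>"
  shows "continuous_on usphere \<eta>"
  using smooth_on_imp_continuous_on_sphere[OF smooth_radial_ext[OF assms]]
  by (rule continuous_on_eq) (simp add: radial_ext_sphere)

lemma continuous_on_hessian_cone_ext:
  assumes "smooth_on_sphere \<eta>"
  shows "continuous_on usphere (\<lambda>p. hessian_matrix (cone_ext \<eta>) p $ i $ j)"
  using smooth_on_imp_continuous_on_sphere[OF smooth_on_pd[OF smooth_on_pd[OF smooth_cone_ext[OF assms]]]]
  by (simp add: hessian_matrix_def)

text \<open>By compactness one \<open>C\<close> bounds both |\<open>\<eta>\<close>| and the sum of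
  the absolute Hessian entries, the latter dominating the quadratic form. So |s| < 1/C secures
  positivity of the function and of A_u at every point.\<close>

lemma admissible_affine:
  fixes \<eta> :: "real^'n \<Rightarrow> real"
  assumes \<eta>: "smooth_on_sphere \<eta>"
  shows "\<forall>\<^sub>F s in nhds 0. admissible (\<lambda>p. 1 + s * \<eta> p)"
proof -
  let ?B = "hessian_matrix (cone_ext \<eta>)"
  have "continuous_on usphere (\<lambda>p. (\<Sum>i\<in>UNIV. \<Sum>j\<in>UNIV. \<bar>?B p $ i $ j\<bar>) + \<bar>\<eta> p\<bar>)"
    by (intro continuous_intros continuous_on_hessian_cone_ext[OF \<eta>] smooth_on_sphere_continuous[OF \<eta>])
  then obtain C where C: "C > 0" "\<And>p. norm p = 1 \<Longrightarrow> \<bar>(\<Sum>i\<in>UNIV. \<Sum>j\<in>UNIV. \<bar>?B p $ i $ j\<bar>) + \<bar>\<eta> p\<bar>\<bar> \<le> C"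
    by (rule sphere_bound) blast
  have "admissible (\<lambda>p. 1 + s * \<eta> p)" if s: "\<bar>s\<bar> < 1 / C" for s
    unfolding admissible_def
  proof (intro conjI ballI smooth_on_sphere_affine[OF \<eta>])
    fix p :: "real^'n" assume "p \<in> usphere"
    then have p: "norm p = 1" by simp
    have sC: "\<bar>s\<bar> * C < 1" using s C(1) by (simp add: field_simps)
    have nn: "0 \<le> (\<Sum>i\<in>UNIV. \<Sum>j\<in>UNIV. \<bar>?B p $ i $ j\<bar>)"
      by (intro sum_nonneg) simp
    have \<eta>C: "\<bar>\<eta> p\<bar> \<le> C" and BC: "(\<Sum>i\<in>UNIV. \<Sum>j\<in>UNIV. \<bar>?B p $ i $ j\<bar>) \<le> C"
      using C(2)[OF p] nn by linarith+
    have "\<bar>s * \<eta> p\<bar> \<le> \<bar>s\<bar> * C"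
      unfolding abs_mult by (intro mult_left_mono \<eta>C) simp
    then show "1 + s * \<eta> p > 0" using sC by linarith
    fix v assume "v \<in> tangent_space p - {0}"
    then have v: "v \<in> tangent_space p" "v \<noteq> 0" by auto
    have "A_form (\<lambda>p. 1 + s * \<eta> p) p v v = A_endo (\<lambda>p. 1 + s * \<eta> p) p v \<bullet> v"
      by (simp add: A_form_def A_endo_def sphere_hessian_def inner_add_left)
    also have "\<dots> = v \<bullet> v + s * ((?B p *v v) \<bullet> v)"
      unfolding A_endo_affine[OF \<eta> p v(1)]
      by (simp add: matrix_vector_mult_add_rdistrib scaleR_matrix_vector_assoc[symmetric] inner_add_left)
    finally have A: "A_form (\<lambda>p. 1 + s * \<eta> p) p v v = v \<bullet> v + s * ((?B p *v v) \<bullet> v)" .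
    have "\<bar>(?B p *v v) \<bullet> v\<bar> = \<bar>\<Sum>i\<in>UNIV. \<Sum>j\<in>UNIV. ?B p $ i $ j * (v $ j * v $ i)\<bar>"
      by (simp add: inner_vec_def matrix_vector_mult_def sum_distrib_right mult.assoc)
    also have "\<dots> \<le> (\<Sum>i\<in>UNIV. \<Sum>j\<in>UNIV. \<bar>?B p $ i $ j * (v $ j * v $ i)\<bar>)"
      by (intro order_trans[OF sum_abs] sum_mono sum_abs)
    also have "\<dots> \<le> (\<Sum>i\<in>UNIV. \<Sum>j\<in>UNIV. \<bar>?B p $ i $ j\<bar> * (norm v * norm v))"
      unfolding abs_mult by (intro sum_mono mult_mono component_le_norm_cart) auto
    also have "\<dots> = (\<Sum>i\<in>UNIV. \<Sum>j\<in>UNIV. \<bar>?B p $ i $ j\<bar>) * (v \<bullet> v)"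
      by (simp add: sum_distrib_right power2_norm_eq_inner[symmetric] power2_eq_square)
    also have "\<dots> \<le> C * (v \<bullet> v)"
      by (intro mult_right_mono BC) simp
    finally have "\<bar>s\<bar> * \<bar>(?B p *v v) \<bullet> v\<bar> \<le> \<bar>s\<bar> * (C * (v \<bullet> v))"
      by (intro mult_left_mono) auto
    also have "\<dots> = (\<bar>s\<bar> * C) * (v \<bullet> v)" by simp
    also have "\<dots> < 1 * (v \<bullet> v)"
      using v(2) sC by (intro mult_strict_right_mono) auto
    finally have "\<bar>s * ((?B p *v v) \<bullet> v)\<bar> < v \<bullet> v"
      by (simp add: abs_mult)
    then show "A_form (\<lambda>p. 1 + s * \<eta> p) p v v > 0"
      unfolding A by linarith
  qed
  moreover have "\<forall>\<^sub>F s in nhds 0. \<bar>s\<bar> < 1 / C"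
    using C(1) by (intro eventually_nhds_metric[THEN iffD2] exI[of _ "1 / C"]) (auto simp: dist_real_def)
  ultimately show ?thesis
    by (rule eventually_mono[rotated])
qed

section \<open>Derivatives of the mean of the logarithm\<close>

lemma sphere_mean_add:
  fixes f g :: "real^'n \<Rightarrow> real"
  assumes "continuous_on usphere f" "continuous_on usphere g"
  shows "sphere_mean (\<lambda>p. f p + g p) = sphere_mean f + sphere_mean g"
  by (simp add: sphere_mean_def integrable_sphere_measure assms add_divide_distrib)

lemma sphere_mean_cong:
  fixes f g :: "real^'n \<Rightarrow> real"
  assumes "\<And>p. norm p = 1 \<Longrightarrow> f p = g p"
  shows "sphere_mean f = sphere_mean g"
  by (simp only: sphere_mean_def integral_sphere_cong[of f g, OF assms])

lemma has_real_derivative_sphere_mean: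
  fixes f f' :: "real \<Rightarrow> real^'n \<Rightarrow> real"
  assumes "e > 0" "\<And>s. \<bar>s - s0\<bar> < e \<Longrightarrow> continuous_on usphere (f s)" "continuous_on usphere (f' s0)"
    and "\<And>s p. \<bar>s - s0\<bar> < e \<Longrightarrow> norm p = 1 \<Longrightarrow> ((\<lambda>s. f s p) has_real_derivative f' s p) (at s)"
    and "\<And>s p. \<bar>s - s0\<bar> < e \<Longrightarrow> norm p = 1 \<Longrightarrow> \<bar>f' s p\<bar> \<le> C"
  shows "((\<lambda>s. sphere_mean (f s)) has_real_derivative sphere_mean (f' s0)) (at s0)"
  unfolding sphere_mean_def
  by (intro DERIV_cdivide has_real_derivative_integral[where e = e and C = C])
    (use assms in \<open>auto intro: integrable_sphere_measure borel_measurable_sphere_measure finite_sphere_measure\<close>)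

lemma sphere_mean_log_derivs:
  fixes \<eta> :: "real^'n \<Rightarrow> real"
  assumes c: "continuous_on usphere \<eta>"
  shows "\<forall>\<^sub>F s in nhds 0. ((\<lambda>s. sphere_mean (\<lambda>p. ln (1 + s * \<eta> p))) has_real_derivative
      sphere_mean (\<lambda>p. \<eta> p / (1 + s * \<eta> p))) (at s)"
    and "((\<lambda>s. sphere_mean (\<lambda>p. \<eta> p / (1 + s * \<eta> p))) has_real_derivative
      sphere_mean (\<lambda>p. - (\<eta> p)\<^sup>2)) (at 0)"
proof -
  obtain C where C: "C > 0" "\<And>p. norm p = 1 \<Longrightarrow> \<bar>\<eta> p\<bar> \<le> C"
    using sphere_bound[OF c] by blast
  \<comment> \<open>The first derivative is needed at every \<open>s0\<close> with |s0| < e, and the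
    domination there uses all \<open>s\<close> within \<open>e\<close> of \<open>s0\<close>. So |s|
    < 2e occurs, and then |s \<open>\<eta>\<close>| is at most 1/2.\<close>
  define e where "e = 1 / (4 * C)"
  have e: "e > 0" using C(1) by (simp add: e_def)
  have pos: "1 + s * \<eta> p \<ge> 1 / 2" if "\<bar>s\<bar> < 2 * e" "norm p = 1" for s p
  proof -
    have "\<bar>s * \<eta> p\<bar> \<le> (2 * e) * C"
      unfolding abs_mult using that C by (intro mult_mono) auto
    also have "\<dots> = 1 / 2" using C(1) by (simp add: e_def)
    finally show ?thesis by linarith
  qed
  have c1: "continuous_on usphere (\<lambda>p. 1 + s * \<eta> p)" for s
    by (intro continuous_intros c)
  have cln: "continuous_on usphere (\<lambda>p. ln (1 + s * \<eta> p))"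
    and cq: "continuous_on usphere (\<lambda>p. \<eta> p / (1 + s * \<eta> p))" if "\<bar>s\<bar> < 2 * e" for s
    using pos[OF that] by (fastforce intro!: continuous_intros c)+
  have bound: "\<bar>\<eta> p / (1 + s * \<eta> p)\<bar> \<le> 2 * C" if "\<bar>s\<bar> < 2 * e" "norm p = 1" for s p
  proof -
    have "\<bar>\<eta> p\<bar> \<le> C * 1" using C(2)[OF that(2)] by simp
    also have "\<dots> \<le> C * (2 * \<bar>1 + s * \<eta> p\<bar>)"
      using pos[OF that] C(1) by (intro mult_left_mono) auto
    finally show ?thesis
      using pos[OF that] by (simp add: abs_divide divide_le_eq algebra_simps)
  qed
  have "((\<lambda>s. sphere_mean (\<lambda>p. ln (1 + s * \<eta> p))) has_real_derivative
      sphere_mean (\<lambda>p. \<eta> p / (1 + s0 * \<eta> p))) (at s0)" if s0: "\<bar>s0\<bar> < e" for s0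
  proof (rule has_real_derivative_sphere_mean[OF e, where C = "2 * C"])
    fix s :: real assume "\<bar>s - s0\<bar> < e"
    then have s: "\<bar>s\<bar> < 2 * e" using s0 by linarith
    show "continuous_on usphere (\<lambda>p. ln (1 + s * \<eta> p))" by (rule cln[OF s])
    fix p :: "real^'n" assume p: "norm p = 1"
    show "((\<lambda>s. ln (1 + s * \<eta> p)) has_real_derivative \<eta> p / (1 + s * \<eta> p)) (at s)"
      using pos[OF s p] by (auto intro!: derivative_eq_intros)
    show "\<bar>\<eta> p / (1 + s * \<eta> p)\<bar> \<le> 2 * C" by (rule bound[OF s p])
  next
    show "continuous_on usphere (\<lambda>p. \<eta> p / (1 + s0 * \<eta> p))" using s0 e by (intro cq) simp
  qed
  moreover have "\<forall>\<^sub>F s in nhds 0. \<bar>s\<bar> < e"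
    using e by (intro eventually_nhds_metric[THEN iffD2] exI[of _ e]) (auto simp: dist_real_def)
  ultimately show "\<forall>\<^sub>F s in nhds 0. ((\<lambda>s. sphere_mean (\<lambda>p. ln (1 + s * \<eta> p))) has_real_derivative
      sphere_mean (\<lambda>p. \<eta> p / (1 + s * \<eta> p))) (at s)"
    by (rule eventually_mono[rotated])
  have "((\<lambda>s. sphere_mean (\<lambda>p. \<eta> p / (1 + s * \<eta> p))) has_real_derivative
      sphere_mean (\<lambda>p. - (\<eta> p / (1 + 0 * \<eta> p))\<^sup>2)) (at 0)"
  proof (rule has_real_derivative_sphere_mean[OF e, where C = "(2 * C)\<^sup>2"])
    fix s :: real assume "\<bar>s - 0\<bar> < e"
    then have s: "\<bar>s\<bar> < 2 * e" using e by linarith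
    show "continuous_on usphere (\<lambda>p. \<eta> p / (1 + s * \<eta> p))" by (rule cq[OF s])
    fix p :: "real^'n" assume p: "norm p = 1"
    show "((\<lambda>s. \<eta> p / (1 + s * \<eta> p)) has_real_derivative - (\<eta> p / (1 + s * \<eta> p))\<^sup>2) (at s)"
      using pos[OF s p] by (auto intro!: derivative_eq_intros simp: power2_eq_square)
    have "\<bar>\<eta> p / (1 + s * \<eta> p)\<bar>\<^sup>2 \<le> (2 * C)\<^sup>2"
      by (intro power_mono bound[OF s p]) simp
    then show "\<bar>- (\<eta> p / (1 + s * \<eta> p))\<^sup>2\<bar> \<le> (2 * C)\<^sup>2"
      by (simp only: power2_abs abs_minus_cancel abs_power2)
  next
    show "continuous_on usphere (\<lambda>p. - (\<eta> p / (1 + 0 * \<eta> p))\<^sup>2)"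
      by (simp add: continuous_on_minus continuous_on_power c)
  qed
  then show "((\<lambda>s. sphere_mean (\<lambda>p. \<eta> p / (1 + s * \<eta> p))) has_real_derivative
      sphere_mean (\<lambda>p. - (\<eta> p)\<^sup>2)) (at 0)"
    by simp
qed

section \<open>The divergence theorem for homogeneous vector fields\<close>

lemma integral_pd_euler:
  fixes f :: "real^'n \<Rightarrow> real"
  assumes f: "smooth_on (- {0}) f" and e: "euler m f"
  shows "(LINT p|sphere_measure. pd i f p) = (real CARD('n) - 1 + m) * (LINT p|sphere_measure. p $ i * f p)"
proof -
  have c1: "continuous_on usphere (tangential_pd i f)"
    by (rule continuous_on_sphere_tangential_pd[OF f])
  have c2: "continuous_on usphere (\<lambda>p. p $ i * f p)"
    by (rule smooth_on_imp_continuous_on_sphere) (intro smooth_on_mult smooth_on_coord f open_punctured)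
  \<comment> \<open>By Euler's relation the radial derivative subtracted in
    \<open>tangential_pd\<close> is \<open>m\<close> times \<open>f\<close>, which shifts the
    constant by \<open>m\<close>.\<close>
  have "(LINT p|sphere_measure. pd i f p) = (LINT p|sphere_measure. tangential_pd i f p + m * (p $ i * f p))"
  proof (rule integral_sphere_cong)
    fix p :: "real^'n" assume "norm p = 1"
    then have "p \<noteq> 0" by auto
    then show "pd i f p = tangential_pd i f p + m * (p $ i * f p)"
      using e by (simp add: tangential_pd_def euler_def)
  qed
  also have "\<dots> = (LINT p|sphere_measure. tangential_pd i f p) + m * (LINT p|sphere_measure. p $ i * f p)"
    using integrable_sphere_measure[OF c1] integrable_sphere_measure[OF c2]
    by (subst Bochner_Integration.integral_add) auto
  finally show ?thesis
    by (simp add: integral_tangential_pd[OF f] algebra_simps)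
qed

text \<open>The \<open>f i\<close> are the components of a vector field; its divergence stands on
  the left and its radial component on the right.\<close>

lemma integral_sum_pd_euler:
  fixes f :: "'n::finite \<Rightarrow> real^'n \<Rightarrow> real"
  assumes f: "\<And>i. smooth_on (- {0}) (f i)" and e: "\<And>i. euler m (f i)"
  shows "(LINT p|sphere_measure. (\<Sum>i\<in>UNIV. pd i (f i) p)) =
    (real CARD('n) - 1 + m) * (LINT p|sphere_measure. (\<Sum>i\<in>UNIV. p $ i * f i p))"
proof -
  have c1: "continuous_on usphere (pd i (f i))" for i
    by (intro smooth_on_imp_continuous_on_sphere smooth_on_pd f)
  have c2: "continuous_on usphere (\<lambda>p. p $ i * f i p)" for i
    by (rule smooth_on_imp_continuous_on_sphere) (intro smooth_on_mult smooth_on_coord f open_punctured)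
  show ?thesis
    using integrable_sphere_measure[OF c1] integrable_sphere_measure[OF c2]
    by (simp add: integral_pd_euler[OF f e] sum_distrib_left)
qed

lemma euler_sum:
  fixes f :: "'i \<Rightarrow> real^'n \<Rightarrow> real"
  assumes "\<And>k. k \<in> A \<Longrightarrow> smooth_on (- {0}) (f k)" "\<And>k. k \<in> A \<Longrightarrow> euler m (f k)"
  shows "euler m (\<lambda>x. \<Sum>k\<in>A. f k x)"
  unfolding euler_def
proof (intro allI impI)
  fix x :: "real^'n" assume x: "x \<noteq> 0"
  have "(\<Sum>i\<in>UNIV. x $ i * pd i (\<lambda>x. \<Sum>k\<in>A. f k x) x) = (\<Sum>i\<in>UNIV. \<Sum>k\<in>A. x $ i * pd i (f k) x)"
    using smooth_on_differentiable[OF open_punctured assms(1)] x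
    by (subst pd_sum) (auto simp: sum_distrib_left)
  also have "\<dots> = (\<Sum>k\<in>A. \<Sum>i\<in>UNIV. x $ i * pd i (f k) x)"
    by (rule sum.swap)
  also have "\<dots> = m * (\<Sum>k\<in>A. f k x)"
    using assms(2) x by (simp add: euler_def sum_distrib_left)
  finally show "(\<Sum>i\<in>UNIV. x $ i * pd i (\<lambda>x. \<Sum>k\<in>A. f k x) x) = m * (\<Sum>k\<in>A. f k x)" .
qed

lemma smooth_on_laplacian: "smooth_on (- {0}) f \<Longrightarrow> smooth_on (- {0}) (laplacian f)" for f :: "real^'n \<Rightarrow> real"
  unfolding laplacian_def[abs_def] by (intro smooth_on_sum smooth_on_pd open_punctured)

text \<open>Apply the divergence identity to grad U, a field of degree 0 whose radial component is
  U.\<close>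

lemma integral_laplacian_euler_1:
  fixes U :: "real^'n \<Rightarrow> real"
  assumes U: "smooth_on (- {0}) U" and e: "euler 1 U"
  shows "(LINT p|sphere_measure. laplacian U p) = (real CARD('n) - 1) * (LINT p|sphere_measure. U p)"
proof -
  have e0: "euler 0 (pd i U)" for i
    using euler_pd[OF U e] by simp
  have "(LINT p|sphere_measure. laplacian U p) =
      (real CARD('n) - 1) * (LINT p|sphere_measure. (\<Sum>i\<in>UNIV. p $ i * pd i U p))"
    unfolding laplacian_def using integral_sum_pd_euler[OF smooth_on_pd[OF U] e0] by simp
  also have "(LINT p|sphere_measure. (\<Sum>i\<in>UNIV. p $ i * pd i U p)) = (LINT p|sphere_measure. U p)"
  proof (rule integral_sphere_cong)
    fix p :: "real^'n" assume "norm p = 1"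
    then have "p \<noteq> 0" by auto
    then show "(\<Sum>i\<in>UNIV. p $ i * pd i U p) = U p"
      using e by (simp add: euler_def)
  qed
  finally show ?thesis .
qed

text \<open>Apply the divergence identity to U grad U, a field of degree 1 whose radial component is
  U^2.\<close>

lemma integral_mult_laplacian_euler_1:
  fixes U :: "real^'n \<Rightarrow> real"
  assumes U: "smooth_on (- {0}) U" and e: "euler 1 U"
  shows "sphere_inner U (laplacian U) = real CARD('n) * sphere_inner U U - (\<Sum>i\<in>UNIV. sphere_inner (pd i U) (pd i U))"
proof -
  have e0: "euler 0 (pd i U)" for i
    using euler_pd[OF U e] by simp
  have sU: "smooth_on (- {0}) (pd i U)" for i by (rule smooth_on_pd[OF U])
  have e1: "euler 1 (\<lambda>x. U x * pd i U x)" for i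
    using euler_mult[OF e e0 U sU] by simp
  have c: "continuous_on usphere U" "continuous_on usphere (pd i U)" "continuous_on usphere (laplacian U)" for i
    by (intro smooth_on_imp_continuous_on_sphere smooth_on_laplacian U sU)+
  have "(LINT p|sphere_measure. (\<Sum>i\<in>UNIV. pd i (\<lambda>x. U x * pd i U x) p)) =
      real CARD('n) * (LINT p|sphere_measure. (\<Sum>i\<in>UNIV. p $ i * (U p * pd i U p)))"
    using integral_sum_pd_euler[of "\<lambda>i x. U x * pd i U x" 1] e1 smooth_on_mult[OF open_punctured U sU] by simp
  also have "(LINT p|sphere_measure. (\<Sum>i\<in>UNIV. p $ i * (U p * pd i U p))) = sphere_inner U U"
    unfolding sphere_inner_def
  proof (rule integral_sphere_cong)
    fix p :: "real^'n" assume "norm p = 1"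
    then have p0: "p \<noteq> 0" by auto
    have "(\<Sum>i\<in>UNIV. p $ i * (U p * pd i U p)) = U p * (\<Sum>i\<in>UNIV. p $ i * pd i U p)"
      by (simp add: sum_distrib_left mult_ac)
    then show "(\<Sum>i\<in>UNIV. p $ i * (U p * pd i U p)) = U p * U p"
      using e p0 by (simp add: euler_def)
  qed
  finally have 1: "(LINT p|sphere_measure. (\<Sum>i\<in>UNIV. pd i (\<lambda>x. U x * pd i U x) p)) = real CARD('n) * sphere_inner U U" .
  have "(LINT p|sphere_measure. (\<Sum>i\<in>UNIV. pd i (\<lambda>x. U x * pd i U x) p)) =
      (LINT p|sphere_measure. U p * laplacian U p + (\<Sum>i\<in>UNIV. pd i U p * pd i U p))"
  proof (rule integral_sphere_cong)
    fix p :: "real^'n" assume "norm p = 1"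
    then have "p \<in> - {0}" by auto
    then have "U differentiable at p" "pd i U differentiable at p" for i
      using smooth_on_differentiable[OF open_punctured] U sU by auto
    then show "(\<Sum>i\<in>UNIV. pd i (\<lambda>x. U x * pd i U x) p) = U p * laplacian U p + (\<Sum>i\<in>UNIV. pd i U p * pd i U p)"
      by (simp add: pd_mult sum.distrib laplacian_def sum_distrib_left)
  qed
  also have "\<dots> = sphere_inner U (laplacian U) + (\<Sum>i\<in>UNIV. sphere_inner (pd i U) (pd i U))"
    unfolding sphere_inner_def using integrable_sphere_mult c
    by (subst Bochner_Integration.integral_add)
      (auto intro!: Bochner_Integration.integrable_sum Bochner_Integration.integral_sum)
  finally show ?thesis using 1 by simp
qed

text \<open>The integrand is the divergence of \<open>\<Delta>U \<nabla>U - \<nabla>\<^sup>2U \<nabla>U\<close>.\<close>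

lemma integral_hessian_minors_euler_1:
  fixes U :: "real^'n \<Rightarrow> real"
  assumes U: "smooth_on (- {0}) U" and e: "euler 1 U"
  shows "(LINT p|sphere_measure. (\<Sum>i\<in>UNIV. \<Sum>j\<in>UNIV. pd i (pd i U) p * pd j (pd j U) p
      - pd i (pd j U) p * pd j (pd i U) p)) = (real CARD('n) - 2) * sphere_inner U (laplacian U)"
proof -
  have e0: "euler 0 (pd i U)" for i
    using euler_pd[OF U e] by simp
  have sU: "smooth_on (- {0}) (pd i U)" for i by (rule smooth_on_pd[OF U])
  have e': "euler (- 1) (pd j (pd i U))" for i j
    using euler_pd[OF sU e0] by simp
  have sU2: "smooth_on (- {0}) (pd j (pd i U))" for i j by (rule smooth_on_pd[OF sU])
  have sL: "smooth_on (- {0}) (laplacian U)" by (rule smooth_on_laplacian[OF U])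
  have eL: "euler (- 1) (laplacian U)"
    unfolding laplacian_def[abs_def] by (intro euler_sum sU2 e')
  define W where "W = (\<lambda>i x. pd i U x * laplacian U x - (\<Sum>k\<in>UNIV. pd k U x * pd i (pd k U) x))"
  have sS: "smooth_on (- {0}) (\<lambda>x. \<Sum>k\<in>UNIV. pd k U x * pd i (pd k U) x)" for i
    by (intro smooth_on_sum smooth_on_mult sU sU2 open_punctured)
  have sP: "smooth_on (- {0}) (\<lambda>x. pd i U x * laplacian U x)" for i
    by (intro smooth_on_mult sU sL open_punctured)
  have sW: "smooth_on (- {0}) (W i)" for i
    unfolding W_def by (intro smooth_on_diff sP sS open_punctured)
  have eS: "euler (- 1) (\<lambda>x. \<Sum>k\<in>UNIV. pd k U x * pd i (pd k U) x)" for i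
  proof (rule euler_sum)
    show "smooth_on (- {0}) (\<lambda>x. pd k U x * pd i (pd k U) x)" for k
      by (intro smooth_on_mult sU sU2 open_punctured)
    show "euler (- 1) (\<lambda>x. pd k U x * pd i (pd k U) x)" for k
      using euler_mult[OF e0 e' sU sU2] by simp
  qed
  have eP: "euler (- 1) (\<lambda>x. pd i U x * laplacian U x)" for i
    using euler_mult[OF e0 eL sU sL] by simp
  have D: "f differentiable at p" if "smooth_on (- {0}) f" "norm p = 1" for f and p :: "real^'n"
  proof -
    have "p \<in> - {0}" using that(2) by auto
    then show ?thesis using smooth_on_differentiable[OF open_punctured that(1)] by simp
  qed
  have eW: "euler (- 1) (W i)" for i
    unfolding euler_def
  proof (intro allI impI)
    fix x :: "real^'n" assume x: "x \<noteq> 0"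
    have "(\<Sum>j\<in>UNIV. x $ j * pd j (W i) x) = (\<Sum>j\<in>UNIV. x $ j * pd j (\<lambda>x. pd i U x * laplacian U x) x)
        - (\<Sum>j\<in>UNIV. x $ j * pd j (\<lambda>x. \<Sum>k\<in>UNIV. pd k U x * pd i (pd k U) x) x)"
      unfolding W_def using smooth_on_differentiable[OF open_punctured sP] smooth_on_differentiable[OF open_punctured sS] x
      by (subst pd_diff) (auto simp: right_diff_distrib sum_subtractf)
    also have "\<dots> = - 1 * W i x"
      using eP eS x by (simp add: euler_def W_def)
    finally show "(\<Sum>j\<in>UNIV. x $ j * pd j (W i) x) = - 1 * W i x" .
  qed
  have "(LINT p|sphere_measure. (\<Sum>i\<in>UNIV. pd i (W i) p)) =
      (real CARD('n) - 2) * (LINT p|sphere_measure. (\<Sum>i\<in>UNIV. p $ i * W i p))"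
    using integral_sum_pd_euler[OF sW eW] by simp
  \<comment> \<open>Euler's relation for \<open>U\<close> makes the first part of the radial
    component U times its Laplacian; the Hessian part vanishes because the first derivatives of
    \<open>U\<close> have degree 0.\<close>
  also have "(LINT p|sphere_measure. (\<Sum>i\<in>UNIV. p $ i * W i p)) = sphere_inner U (laplacian U)"
    unfolding sphere_inner_def
  proof (rule integral_sphere_cong)
    fix p :: "real^'n" assume "norm p = 1"
    then have p0: "p \<noteq> 0" by auto
    have "(\<Sum>i\<in>UNIV. p $ i * W i p) = (\<Sum>i\<in>UNIV. p $ i * pd i U p) * laplacian U p
        - (\<Sum>i\<in>UNIV. \<Sum>k\<in>UNIV. p $ i * (pd k U p * pd i (pd k U) p))"
      by (simp add: W_def right_diff_distrib sum_subtractf sum_distrib_left sum_distrib_right mult.assoc)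
    also have "(\<Sum>i\<in>UNIV. \<Sum>k\<in>UNIV. p $ i * (pd k U p * pd i (pd k U) p)) =
        (\<Sum>k\<in>UNIV. pd k U p * (\<Sum>i\<in>UNIV. p $ i * pd i (pd k U) p))"
      by (subst sum.swap) (simp add: sum_distrib_left mult.left_commute)
    finally show "(\<Sum>i\<in>UNIV. p $ i * W i p) = U p * laplacian U p"
      using e e0 p0 by (simp add: euler_def)
  qed
  also have "(LINT p|sphere_measure. (\<Sum>i\<in>UNIV. pd i (W i) p)) =
    (LINT p|sphere_measure. (\<Sum>i\<in>UNIV. \<Sum>j\<in>UNIV. pd i (pd i U) p * pd j (pd j U) p
      - pd i (pd j U) p * pd j (pd i U) p))"
  proof (rule integral_sphere_cong)
    fix p :: "real^'n" assume p: "norm p = 1"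
    then have p0: "p \<noteq> 0" by auto
    note Dp = D[OF _ p]
    have comm: "pd i (pd j U) p = pd j (pd i U) p" for i j
      using pd_commute[OF open_punctured U] p0 by simp
    have "pd i (W i) p = pd i U p * pd i (laplacian U) p + pd i (pd i U) p * laplacian U p
        - (\<Sum>k\<in>UNIV. pd k U p * pd i (pd i (pd k U)) p + pd i (pd k U) p * pd i (pd k U) p)" for i
      unfolding W_def
      by (subst pd_diff[OF Dp[OF sP] Dp[OF sS]], subst pd_mult[OF Dp[OF sU] Dp[OF sL]], subst pd_sum)
        (auto simp: pd_mult[OF Dp[OF sU] Dp[OF sU2]] intro!: Dp smooth_on_mult sU sU2 open_punctured)
    then have "(\<Sum>i\<in>UNIV. pd i (W i) p) = (\<Sum>i\<in>UNIV. pd i U p * pd i (laplacian U) p) + laplacian U p * laplacian U p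
        - (\<Sum>i\<in>UNIV. \<Sum>k\<in>UNIV. pd k U p * pd i (pd i (pd k U)) p)
        - (\<Sum>i\<in>UNIV. \<Sum>k\<in>UNIV. pd i (pd k U) p * pd i (pd k U) p)"
      by (simp add: sum.distrib sum_subtractf laplacian_def[of U p] flip: sum_distrib_right)
    \<comment> \<open>The third derivatives from the Hessian part cancel those of
      \<open>pd i (laplacian U)\<close>, since the Laplacian commutes with \<open>pd\<close>. Only
      products of second derivatives remain.\<close>
    also have "(\<Sum>i\<in>UNIV. \<Sum>k\<in>UNIV. pd k U p * pd i (pd i (pd k U)) p) = (\<Sum>k\<in>UNIV. pd k U p * laplacian (pd k U) p)"
      by (subst sum.swap) (simp add: laplacian_def sum_distrib_left)
    also have "\<dots> = (\<Sum>i\<in>UNIV. pd i U p * pd i (laplacian U) p)"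
      by (simp add: laplacian_pd[OF U p0])
    also have "laplacian U p * laplacian U p = (\<Sum>i\<in>UNIV. \<Sum>j\<in>UNIV. pd i (pd i U) p * pd j (pd j U) p)"
      by (simp add: laplacian_def sum_product)
    also have "(\<Sum>i\<in>UNIV. \<Sum>k\<in>UNIV. pd i (pd k U) p * pd i (pd k U) p) =
        (\<Sum>i\<in>UNIV. \<Sum>k\<in>UNIV. pd i (pd k U) p * pd k (pd i U) p)"
      by (intro sum.cong refl arg_cong2[where f = "(*)"] comm)
    finally show "(\<Sum>i\<in>UNIV. pd i (W i) p) = (\<Sum>i\<in>UNIV. \<Sum>j\<in>UNIV. pd i (pd i U) p * pd j (pd j U) p
      - pd i (pd j U) p * pd j (pd i U) p)"
      by (simp add: sum_subtractf)
  qed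
  finally show ?thesis .
qed


section \<open>The mean of u det A_u as a polynomial in s\<close>

definition volume_poly :: "(real^'n \<Rightarrow> real) \<Rightarrow> real^'n \<Rightarrow> real poly" where
  "volume_poly \<eta> p = [:1, \<eta> p:] * det_pencil (hessian_matrix (cone_ext \<eta>) p)"

lemma poly_volume_poly:
  assumes "smooth_on_sphere \<eta>" "norm p = 1"
  shows "poly (volume_poly \<eta> p) s = (1 + s * \<eta> p) * det_A (\<lambda>p. 1 + s * \<eta> p) p"
  by (simp add: volume_poly_def det_A_affine[OF assms] algebra_simps)

lemma degree_volume_poly: "degree (volume_poly \<eta> p) \<le> Suc CARD('n)" for p :: "real^'n"
proof -
  have "degree (volume_poly \<eta> p) \<le> degree [:1, \<eta> p:] + degree (det_pencil (hessian_matrix (cone_ext \<eta>) p))"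
    unfolding volume_poly_def by (rule degree_mult_le)
  also have "\<dots> \<le> 1 + CARD('n)"
    by (intro add_mono degree_det_pencil) simp
  finally show ?thesis by simp
qed

lemma continuous_on_coeff_volume_poly:
  assumes "smooth_on_sphere \<eta>"
  shows "continuous_on usphere (\<lambda>p. coeff (volume_poly \<eta> p) k)"
  unfolding volume_poly_def
  by (intro continuous_on_coeff_mult continuous_on_coeff_linear continuous_on_const
      continuous_on_coeff_det_pencil continuous_on_hessian_cone_ext smooth_on_sphere_continuous assms)

text \<open>Averaging coefficients instead of values keeps the dependence on s formal. The range
  ends at the degree bound for det (I + sB) plus one for the factor 1 + s
  \<open>\<eta>\<close>.\<close>

definition mean_volume_poly :: "(real^'n \<Rightarrow> real) \<Rightarrow> real poly" where
  "mean_volume_poly \<eta> = (\<Sum>k\<le>Suc CARD('n). monom (sphere_mean (\<lambda>p. coeff (volume_poly \<eta> p) k)) k)"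

lemma coeff_mean_volume_poly:
  fixes \<eta> :: "real^'n \<Rightarrow> real"
  assumes "k \<le> Suc CARD('n)"
  shows "coeff (mean_volume_poly \<eta>) k = sphere_mean (\<lambda>p. coeff (volume_poly \<eta> p) k)"
  using assms by (simp add: mean_volume_poly_def coeff_sum if_distrib cong: if_cong)

lemma poly_eq_sum_atMost:
  fixes p :: "real poly"
  assumes "degree p \<le> n"
  shows "poly p x = (\<Sum>k\<le>n. coeff p k * x ^ k)"
  unfolding poly_altdef
  by (rule sum.mono_neutral_left) (use assms in \<open>auto simp: coeff_eq_0\<close>)

lemma sphere_mean_volume:
  fixes \<eta> :: "real^'n \<Rightarrow> real"
  assumes \<eta>: "smooth_on_sphere \<eta>"
  shows "sphere_mean (\<lambda>p. (1 + s * \<eta> p) * det_A (\<lambda>p. 1 + s * \<eta> p) p) = poly (mean_volume_poly \<eta>) s"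
proof -
  have c: "continuous_on usphere (\<lambda>p. coeff (volume_poly \<eta> p) k * s ^ k)" for k
    by (intro continuous_on_mult continuous_on_coeff_volume_poly[OF \<eta>] continuous_on_const)
  have "sphere_mean (\<lambda>p. (1 + s * \<eta> p) * det_A (\<lambda>p. 1 + s * \<eta> p) p) =
      sphere_mean (\<lambda>p. \<Sum>k\<le>Suc CARD('n). coeff (volume_poly \<eta> p) k * s ^ k)"
  proof (rule sphere_mean_cong)
    fix p :: "real^'n" assume "norm p = 1"
    then show "(1 + s * \<eta> p) * det_A (\<lambda>p. 1 + s * \<eta> p) p =
        (\<Sum>k\<le>Suc CARD('n). coeff (volume_poly \<eta> p) k * s ^ k)"
      using poly_eq_sum_atMost[OF degree_volume_poly[of \<eta> p], of s] poly_volume_poly[OF \<eta>, of p s]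
      by (simp del: sum.atMost_Suc)
  qed
  also have "\<dots> = (\<Sum>k\<le>Suc CARD('n). sphere_mean (\<lambda>p. coeff (volume_poly \<eta> p) k) * s ^ k)"
    unfolding sphere_mean_def using integrable_sphere_measure[OF c]
    by (subst Bochner_Integration.integral_sum) (auto simp: sum_divide_distrib simp del: sum.atMost_Suc)
  also have "\<dots> = poly (mean_volume_poly \<eta>) s"
    by (simp add: mean_volume_poly_def poly_sum poly_monom del: sum.atMost_Suc)
  finally show ?thesis .
qed

lemma poly_pderiv_0: "poly (pderiv p) 0 = coeff p 1" "poly (pderiv (pderiv p)) 0 = 2 * coeff p 2"
  for p :: "real poly"
  by (simp_all add: poly_0_coeff_0 coeff_pderiv numeral_2_eq_2)

lemma coeff_volume_poly:
  assumes "smooth_on_sphere \<eta>" "norm p = 1"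
  defines "U \<equiv> cone_ext \<eta>"
  shows "coeff (volume_poly \<eta> p) 0 = 1"
    and "coeff (volume_poly \<eta> p) 1 = \<eta> p + laplacian U p"
    and "2 * coeff (volume_poly \<eta> p) 2 = 2 * (\<eta> p * laplacian U p) +
      (\<Sum>i\<in>UNIV. \<Sum>j\<in>UNIV. pd i (pd i U) p * pd j (pd j U) p - pd i (pd j U) p * pd j (pd i U) p)"
proof -
  let ?D = "det_pencil (hessian_matrix U p)"
  have D0: "coeff ?D 0 = 1"
    using poly_det_pencil[of "hessian_matrix U p" 0] by (simp add: poly_0_coeff_0)
  have D1: "coeff ?D 1 = laplacian U p"
    using poly_pderiv_det_pencil_0[of "hessian_matrix U p"]
    by (simp add: poly_pderiv_0 hessian_matrix_def laplacian_def)
  have D2: "2 * coeff ?D 2 =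
      (\<Sum>i\<in>UNIV. \<Sum>j\<in>UNIV. pd i (pd i U) p * pd j (pd j U) p - pd i (pd j U) p * pd j (pd i U) p)"
    using poly_pderiv2_det_pencil_0[of "hessian_matrix U p"]
    unfolding poly_pderiv_0(2) by (simp add: hessian_matrix_def)
  have Q: "volume_poly \<eta> p = ?D + pCons 0 (smult (\<eta> p) ?D)"
    by (simp add: volume_poly_def U_def)
  show "coeff (volume_poly \<eta> p) 0 = 1"
    by (simp add: Q D0)
  show "coeff (volume_poly \<eta> p) 1 = \<eta> p + laplacian U p"
    using D0 D1 by (simp add: Q)
  have "coeff (volume_poly \<eta> p) 2 = coeff ?D 2 + \<eta> p * coeff ?D 1"
    by (simp add: Q numeral_2_eq_2)
  then show "2 * coeff (volume_poly \<eta> p) 2 = 2 * (\<eta> p * laplacian U p) +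
      (\<Sum>i\<in>UNIV. \<Sum>j\<in>UNIV. pd i (pd i U) p * pd j (pd j U) p - pd i (pd j U) p * pd j (pd i U) p)"
    using D1 D2 by (simp add: distrib_left)
qed

text \<open>The factor \<open>CARD('n)\<close> arises twice: at first order as 1 +
  (\<open>CARD('n)\<close> - 1) from \<open>\<eta>\<close> and the Laplacian of \<open>U\<close>, at
  second order as 2 + (\<open>CARD('n)\<close> - 2) from the cross term and the 2x2 minors.\<close>

lemma mean_volume_poly_derivs:
  fixes \<eta> :: "real^'n \<Rightarrow> real"
  assumes \<eta>: "smooth_on_sphere \<eta>"
  defines "U \<equiv> cone_ext \<eta>"
  shows "poly (mean_volume_poly \<eta>) 0 = 1"
    and "poly (pderiv (mean_volume_poly \<eta>)) 0 = real CARD('n) * sphere_mean \<eta>"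
    and "poly (pderiv (pderiv (mean_volume_poly \<eta>))) 0 =
      real CARD('n) * (sphere_inner U (laplacian U) / measure sphere_measure (usphere :: (real^'n) set))"
proof -
  let ?\<omega> = "measure sphere_measure (usphere :: (real^'n) set)"
  have \<omega>: "?\<omega> > 0" by (rule measure_sphere_measure_pos)
  have sU: "smooth_on (- {0}) U" unfolding U_def by (rule smooth_cone_ext[OF \<eta>])
  have eU: "euler 1 U" unfolding U_def by (rule euler_cone_ext[OF \<eta>])
  have U\<eta>: "U p = \<eta> p" if "norm p = 1" for p
    using that by (simp add: U_def cone_ext_sphere)
  have cU: "continuous_on usphere U" and cL: "continuous_on usphere (laplacian U)"
    by (intro smooth_on_imp_continuous_on_sphere sU smooth_on_laplacian)+
  have c\<eta>: "continuous_on usphere \<eta>" by (rule smooth_on_sphere_continuous[OF \<eta>])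
  have cM: "continuous_on usphere (\<lambda>p. \<Sum>i\<in>UNIV. \<Sum>j\<in>UNIV. pd i (pd i U) p * pd j (pd j U) p
      - pd i (pd j U) p * pd j (pd i U) p)"
    by (rule smooth_on_imp_continuous_on_sphere)
      (intro smooth_on_sum smooth_on_diff smooth_on_mult smooth_on_pd sU open_punctured)
  interpret finite_measure "sphere_measure :: (real^'n) measure"
    by (rule finite_sphere_measure)
  have "coeff (mean_volume_poly \<eta>) 0 = sphere_mean (\<lambda>p::real^'n. 1)"
    unfolding coeff_mean_volume_poly[OF le0]
    by (rule sphere_mean_cong) (rule coeff_volume_poly(1)[OF \<eta>])
  also have "\<dots> = 1"
    using \<omega> by (simp add: sphere_mean_def)
  finally show "poly (mean_volume_poly \<eta>) 0 = 1"
    by (simp add: poly_0_coeff_0)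
  have "coeff (mean_volume_poly \<eta>) 1 = sphere_mean (\<lambda>p. \<eta> p + laplacian U p)"
    using coeff_mean_volume_poly[of 1 \<eta>] coeff_volume_poly(2)[OF \<eta>]
    by (simp add: U_def cong: sphere_mean_cong)
  also have "\<dots> = sphere_mean \<eta> + sphere_mean (laplacian U)"
    by (rule sphere_mean_add[OF c\<eta> cL])
  also have "sphere_mean (laplacian U) = (real CARD('n) - 1) * sphere_mean \<eta>"
    by (simp add: sphere_mean_def integral_laplacian_euler_1[OF sU eU] integral_sphere_cong[of U \<eta>, OF U\<eta>])
  finally show "poly (pderiv (mean_volume_poly \<eta>)) 0 = real CARD('n) * sphere_mean \<eta>"
    by (simp add: poly_pderiv_0 algebra_simps)
  have "2 * coeff (mean_volume_poly \<eta>) 2 = 2 * sphere_mean (\<lambda>p. coeff (volume_poly \<eta> p) 2)"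
    by (subst coeff_mean_volume_poly) auto
  also have "\<dots> = sphere_mean (\<lambda>p. 2 * coeff (volume_poly \<eta> p) 2)"
    by (simp add: sphere_mean_def)
  also have "\<dots> = sphere_mean (\<lambda>p. 2 * (U p * laplacian U p) +
      (\<Sum>i\<in>UNIV. \<Sum>j\<in>UNIV. pd i (pd i U) p * pd j (pd j U) p - pd i (pd j U) p * pd j (pd i U) p))"
    by (rule sphere_mean_cong) (simp add: coeff_volume_poly(3)[OF \<eta>] U\<eta> U_def[symmetric])
  also have "\<dots> = sphere_mean (\<lambda>p. 2 * (U p * laplacian U p)) + sphere_mean (\<lambda>p.
      (\<Sum>i\<in>UNIV. \<Sum>j\<in>UNIV. pd i (pd i U) p * pd j (pd j U) p - pd i (pd j U) p * pd j (pd i U) p))"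
    by (rule sphere_mean_add) (intro cM continuous_on_mult continuous_on_const cU cL)+
  also have "\<dots> = 2 * (sphere_inner U (laplacian U) / ?\<omega>) + (real CARD('n) - 2) * sphere_inner U (laplacian U) / ?\<omega>"
    unfolding sphere_mean_def integral_hessian_minors_euler_1[OF sU eU] by (simp add: sphere_inner_def)
  also have "\<dots> = real CARD('n) * (sphere_inner U (laplacian U) / ?\<omega>)"
    by (simp add: left_diff_distrib diff_divide_distrib)
  finally show "poly (pderiv (pderiv (mean_volume_poly \<eta>))) 0 = real CARD('n) * (sphere_inner U (laplacian U) / ?\<omega>)"
    unfolding poly_pderiv_0(2) .
qed

text \<open>On the unit sphere the gradient of \<open>cone_ext \<eta>\<close> splits orthogonally
  into the tangential gradient of \<open>\<eta>\<close> and the radial vector \<open>\<eta>\<close>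
  p. The radial part lowers the factor \<open>CARD('n)\<close> of
  \<open>integral_mult_laplacian_euler_1\<close> by one.\<close>

lemma sphere_inner_cone_ext_laplacian:
  fixes \<eta> :: "real^'n \<Rightarrow> real"
  assumes \<eta>: "smooth_on_sphere \<eta>"
  shows "sphere_inner (cone_ext \<eta>) (laplacian (cone_ext \<eta>)) =
    (real CARD('n) - 1) * sphere_inner \<eta> \<eta> - dirichlet (radial_ext \<eta>) (radial_ext \<eta>)"
proof -
  let ?U = "cone_ext \<eta>" and ?r = "radial_ext \<eta>"
  have sr: "smooth_on (- {0}) ?r" by (rule smooth_radial_ext[OF \<eta>])
  have c\<eta>: "continuous_on usphere \<eta>" by (rule smooth_on_sphere_continuous[OF \<eta>])
  have er: "(\<Sum>j\<in>UNIV. p $ j * pd j ?r p) = 0" if "norm p = 1" for p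
  proof -
    have "p \<noteq> 0" using that by auto
    then show ?thesis using euler_radial_ext[OF \<eta>] by (simp add: euler_def)
  qed
  have "(\<Sum>i\<in>UNIV. sphere_inner (pd i ?U) (pd i ?U)) = (LINT p|sphere_measure. (\<Sum>i\<in>UNIV. pd i ?U p * pd i ?U p))"
    unfolding sphere_inner_def
    by (subst Bochner_Integration.integral_sum)
      (auto intro!: integrable_sphere_mult smooth_on_imp_continuous_on_sphere smooth_on_pd smooth_cone_ext[OF \<eta>])
  also have "\<dots> = (LINT p|sphere_measure. (\<Sum>i\<in>UNIV. tangential_pd i ?r p * tangential_pd i ?r p) + \<eta> p * \<eta> p)"
  proof (rule integral_sphere_cong)
    fix p :: "real^'n" assume p: "norm p = 1"
    then have p0: "p \<noteq> 0" by auto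
    have D: "norm differentiable at p" "?r differentiable at p"
      using smooth_on_differentiable[OF open_punctured] smooth_on_norm sr p0 by auto
    have tangential_pd: "tangential_pd i ?r p = pd i ?r p" for i
      by (simp add: tangential_pd_def er[OF p])
    have "pd i ?U p = tangential_pd i ?r p + p $ i * \<eta> p" for i
      unfolding cone_ext_def[abs_def] pd_mult[OF D] tangential_pd
      by (simp add: pd_norm[OF p0] p radial_ext_sphere)
    then have "(\<Sum>i\<in>UNIV. pd i ?U p * pd i ?U p) =
      (\<Sum>i\<in>UNIV. tangential_pd i ?r p * tangential_pd i ?r p + 2 * \<eta> p * (p $ i * tangential_pd i ?r p) + (p $ i * p $ i) * (\<eta> p * \<eta> p))"
      by (intro sum.cong refl) (simp add: algebra_simps)
    also have "\<dots> = (\<Sum>i\<in>UNIV. tangential_pd i ?r p * tangential_pd i ?r p) + 2 * \<eta> p * (\<Sum>i\<in>UNIV. p $ i * tangential_pd i ?r p)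
        + (\<Sum>i\<in>UNIV. p $ i * p $ i) * (\<eta> p * \<eta> p)"
      by (simp only: sum.distrib sum_distrib_left sum_distrib_right)
    also have "\<dots> = (\<Sum>i\<in>UNIV. tangential_pd i ?r p * tangential_pd i ?r p) + \<eta> p * \<eta> p"
      using norm_sq_eq_sum[of p] p by (simp add: sum_coord_tangential_pd[OF p])
    finally show "(\<Sum>i\<in>UNIV. pd i ?U p * pd i ?U p) = (\<Sum>i\<in>UNIV. tangential_pd i ?r p * tangential_pd i ?r p) + \<eta> p * \<eta> p" .
  qed
  also have "\<dots> = dirichlet ?r ?r + sphere_inner \<eta> \<eta>"
    unfolding dirichlet_def sphere_inner_def
    by (subst Bochner_Integration.integral_add)
      (auto intro!: Bochner_Integration.integrable_sum Bochner_Integration.integral_sum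
        integrable_sphere_mult continuous_on_sphere_tangential_pd sr c\<eta>)
  finally have "(\<Sum>i\<in>UNIV. sphere_inner (pd i ?U) (pd i ?U)) = dirichlet ?r ?r + sphere_inner \<eta> \<eta>" .
  moreover have "sphere_inner ?U ?U = sphere_inner \<eta> \<eta>"
    by (intro sphere_inner_cong cone_ext_sphere)
  ultimately show ?thesis
    using integral_mult_laplacian_euler_1[OF smooth_cone_ext[OF \<eta>] euler_cone_ext[OF \<eta>]]
    by (simp add: algebra_simps)
qed

text \<open>A second derivative needs the first one on a whole neighbourhood, so \<open>J'\<close>
  is given in closed form there. As V(0) = 1, the logarithm of V is differentiable near 0, and at 0
  the quadratic term contributes only the square of V'(0).\<close>

lemma J1_derivs:
  fixes \<eta> :: "real^'n \<Rightarrow> real"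
  assumes \<eta>: "smooth_on_sphere \<eta>"
  defines "V \<equiv> mean_volume_poly \<eta>"
  defines "J' \<equiv> \<lambda>s. sphere_mean (\<lambda>p. \<eta> p / (1 + s * \<eta> p))
      - 1 / real CARD('n) * (poly (pderiv V) s / poly V s) + (poly V s - 1) * poly (pderiv V) s"
  shows "\<forall>\<^sub>F s in nhds 0. ((\<lambda>s. J1 (\<lambda>p. 1 + s * \<eta> p)) has_real_derivative J' s) (at s)"
    and "(J' has_real_derivative sphere_mean (\<lambda>p. - (\<eta> p)\<^sup>2)
      - 1 / real CARD('n) * (poly (pderiv (pderiv V)) 0 - (poly (pderiv V) 0)\<^sup>2) + (poly (pderiv V) 0)\<^sup>2) (at 0)"
proof -
  have c: "continuous_on usphere \<eta>" by (rule smooth_on_sphere_continuous[OF \<eta>])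
  have V0: "poly V 0 = 1" unfolding V_def by (rule mean_volume_poly_derivs(1)[OF \<eta>])
  have J: "J1 (\<lambda>p. 1 + s * \<eta> p) = sphere_mean (\<lambda>p. ln (1 + s * \<eta> p))
      - 1 / real CARD('n) * ln (poly V s) + 1 / 2 * (poly V s - 1)\<^sup>2" for s
    unfolding J1_def sphere_mean_volume[OF \<eta>] V_def ..
  have "isCont (poly V) 0" by simp
  then have "(poly V \<longlongrightarrow> poly V 0) (nhds 0)"
    unfolding isCont_def tendsto_at_iff_tendsto_nhds .
  then have "\<forall>\<^sub>F s in nhds 0. poly V s > 0"
    by (rule order_tendstoD(1)) (simp add: V0)
  with sphere_mean_log_derivs(1)[OF c]
  show "\<forall>\<^sub>F s in nhds 0. ((\<lambda>s. J1 (\<lambda>p. 1 + s * \<eta> p)) has_real_derivative J' s) (at s)"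
  proof eventually_elim
    case (elim s)
    note D1 = elim(1)
    have D2: "((\<lambda>s. ln (poly V s)) has_real_derivative poly (pderiv V) s / poly V s) (at s)"
      using elim(2) by (auto intro!: derivative_eq_intros)
    have D3: "((\<lambda>s. 1 / 2 * (poly V s - 1)\<^sup>2) has_real_derivative (poly V s - 1) * poly (pderiv V) s) (at s)"
      by (auto intro!: derivative_eq_intros)
    show ?case
      unfolding J J'_def by (intro DERIV_add DERIV_diff DERIV_cmult D1 D2 D3)
  qed
  have E2: "((\<lambda>s. poly (pderiv V) s / poly V s) has_real_derivative
      poly (pderiv (pderiv V)) 0 - (poly (pderiv V) 0)\<^sup>2) (at 0)"
    by (rule DERIV_cong[OF DERIV_divide[OF poly_DERIV poly_DERIV]]) (simp_all add: V0 power2_eq_square)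
  have E3: "((\<lambda>s. (poly V s - 1) * poly (pderiv V) s) has_real_derivative (poly (pderiv V) 0)\<^sup>2) (at 0)"
    by (rule derivative_eq_intros poly_DERIV refl | simp add: V0 power2_eq_square)+
  show "(J' has_real_derivative sphere_mean (\<lambda>p. - (\<eta> p)\<^sup>2)
      - 1 / real CARD('n) * (poly (pderiv (pderiv V)) 0 - (poly (pderiv V) 0)\<^sup>2) + (poly (pderiv V) 0)\<^sup>2) (at 0)"
    unfolding J'_def by (intro DERIV_add DERIV_diff DERIV_cmult E2 E3 sphere_mean_log_derivs(2)[OF c])
qed

text \<open>V'(0) is \<open>CARD('n)\<close> times the mean of \<open>\<eta>\<close>, so the first
  variations of the two logarithmic terms cancel; the quadratic term has none because V(0) =
  1.\<close>

lemma J1_critical: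
  fixes \<eta> :: "real^'n \<Rightarrow> real"
  assumes \<eta>: "smooth_on_sphere \<eta>"
  shows "((\<lambda>s. J1 (\<lambda>p. 1 + s * \<eta> p)) has_real_derivative 0) (at 0)"
  using eventually_nhds_x_imp_x[OF J1_derivs(1)[OF \<eta>]]
  by (simp add: mean_volume_poly_derivs[OF \<eta>])

text \<open>Orthogonality to constants makes V'(0) zero, and the expression becomes the Dirichlet
  energy of \<open>\<eta>\<close> minus \<open>CARD('n)\<close> times its squared L2 norm, divided
  by the area.\<close>

lemma J1_second_derivative_nonneg:
  fixes \<eta> :: "real^'n \<Rightarrow> real"
  assumes N: "CARD('n) \<ge> 2" and \<eta>: "smooth_on_sphere \<eta>"
    and o0: "L2_orthogonal \<eta> (\<lambda>_. 1)" and o1: "\<And>i. L2_orthogonal \<eta> (\<lambda>p. p $ i)"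
  defines "V \<equiv> mean_volume_poly \<eta>"
  shows "sphere_mean (\<lambda>p. - (\<eta> p)\<^sup>2)
      - 1 / real CARD('n) * (poly (pderiv (pderiv V)) 0 - (poly (pderiv V) 0)\<^sup>2) + (poly (pderiv V) 0)\<^sup>2 \<ge> 0"
proof -
  let ?\<omega> = "measure sphere_measure (usphere :: (real^'n) set)" and ?r = "radial_ext \<eta>"
  have \<omega>: "?\<omega> > 0" by (rule measure_sphere_measure_pos)
  have "sphere_mean \<eta> = 0"
    using o0 by (simp add: L2_orthogonal_def sphere_mean_def)
  then have V1: "poly (pderiv V) 0 = 0"
    unfolding V_def by (simp add: mean_volume_poly_derivs(2)[OF \<eta>])
  have V2: "poly (pderiv (pderiv V)) 0 =
      real CARD('n) * (((real CARD('n) - 1) * sphere_inner \<eta> \<eta> - dirichlet ?r ?r) / ?\<omega>)"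
    unfolding V_def mean_volume_poly_derivs(3)[OF \<eta>] sphere_inner_cone_ext_laplacian[OF \<eta>] ..
  have m: "sphere_mean (\<lambda>p. - (\<eta> p)\<^sup>2) = - (sphere_inner \<eta> \<eta> / ?\<omega>)"
    by (simp add: sphere_mean_def sphere_inner_def power2_eq_square)
  have "2 * real CARD('n) * sphere_inner ?r ?r \<le> dirichlet ?r ?r"
  proof (rule spectral_gap[OF N smooth_radial_ext[OF \<eta>]])
    show "(LINT p|sphere_measure. ?r p) = 0"
      using o0 by (simp add: L2_orthogonal_def integral_sphere_cong[of ?r \<eta>] radial_ext_sphere)
    show "(LINT p|sphere_measure. ?r p * p $ i) = 0" for i
      using o1[of i] unfolding L2_orthogonal_def
      by (subst integral_sphere_cong[of _ "\<lambda>p. \<eta> p * p $ i"]) (simp_all add: radial_ext_sphere)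
  qed
  also have "sphere_inner ?r ?r = sphere_inner \<eta> \<eta>"
    by (intro sphere_inner_cong radial_ext_sphere)
  finally have gap: "2 * real CARD('n) * sphere_inner \<eta> \<eta> \<le> dirichlet ?r ?r" .
  \<comment> \<open>The gap has twice the required constant, and this is the surplus that is
    dropped.\<close>
  have "real CARD('n) * sphere_inner \<eta> \<eta> \<ge> 0"
    by (intro mult_nonneg_nonneg sphere_inner_nonneg) simp
  with gap have "0 \<le> (dirichlet ?r ?r - real CARD('n) * sphere_inner \<eta> \<eta>) / ?\<omega>"
    using \<omega> by simp
  also have "\<dots> = sphere_mean (\<lambda>p. - (\<eta> p)\<^sup>2)
      - 1 / real CARD('n) * (poly (pderiv (pderiv V)) 0 - (poly (pderiv V) 0)\<^sup>2) + (poly (pderiv V) 0)\<^sup>2"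
    using \<omega> N unfolding m V1 V2 by (simp add: field_simps)
  finally show ?thesis .
qed

text \<open>Derivatives are unique, so \<open>J'\<close> is determined near 0 and \<open>D\<close>
  is the second derivative at 0; the existential form also asserts that both derivatives exist.
  Admissibility near \<open>s = 0\<close> places the variation where \<open>J1\<close> has its
  intended meaning. The assumption on \<open>CARD('n)\<close> says n >= 1.\<close>

theorem proposition6p3:
  assumes "CARD('n::finite) \<ge> 2"
  shows "soliton (\<lambda>_::real^'n. 1)
    \<and> (\<forall>\<eta>::real^'n \<Rightarrow> real. smooth_on_sphere \<eta> \<longrightarrow>
         (\<forall>\<^sub>F s in nhds 0. admissible (\<lambda>p. 1 + s * \<eta> p))
       \<and> ((\<lambda>s. J1 (\<lambda>p. 1 + s * \<eta> p)) has_real_derivative 0) (at 0))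
    \<and> (\<forall>\<eta>::real^'n \<Rightarrow> real. smooth_on_sphere \<eta> \<longrightarrow>
         L2_orthogonal \<eta> (\<lambda>_. 1) \<longrightarrow>
         (\<forall>i. L2_orthogonal \<eta> (\<lambda>p. p $ i)) \<longrightarrow>
         (\<exists>J' D. (\<forall>\<^sub>F s in nhds 0.
                    ((\<lambda>s. J1 (\<lambda>p. 1 + s * \<eta> p)) has_real_derivative J' s) (at s))
               \<and> (J' has_real_derivative D) (at 0)
               \<and> D \<ge> 0))"
proof (intro conjI allI impI)
  show "soliton (\<lambda>_::real^'n. 1)" by (rule soliton_1)
next
  fix \<eta> :: "real^'n \<Rightarrow> real" assume \<eta>: "smooth_on_sphere \<eta>"
  show "\<forall>\<^sub>F s in nhds 0. admissible (\<lambda>p. 1 + s * \<eta> p)" by (rule admissible_affine[OF \<eta>])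
  show "((\<lambda>s. J1 (\<lambda>p. 1 + s * \<eta> p)) has_real_derivative 0) (at 0)" by (rule J1_critical[OF \<eta>])
next
  fix \<eta> :: "real^'n \<Rightarrow> real"
  assume \<eta>: "smooth_on_sphere \<eta>" and o: "L2_orthogonal \<eta> (\<lambda>_. 1)" "\<forall>i. L2_orthogonal \<eta> (\<lambda>p. p $ i)"
  show "\<exists>J' D. (\<forall>\<^sub>F s in nhds 0. ((\<lambda>s. J1 (\<lambda>p. 1 + s * \<eta> p)) has_real_derivative J' s) (at s))
               \<and> (J' has_real_derivative D) (at 0) \<and> D \<ge> 0"
    by (intro exI conjI, rule J1_derivs(1)[OF \<eta>], rule J1_derivs(2)[OF \<eta>],
      rule J1_second_derivative_nonneg[OF assms \<eta> o(1)]) (use o(2) in blast)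
qed

end
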